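(* Suppose $\sigma(x)/x\in\mathbb{Z}[\zeta_p]$. Then $\mathcal{I}=x\mathcal{O}_{\mathbb{KL}}$ is the principal ideal generated by $x$; with $\beta=p^{-2}\left(\frac1k-\frac\theta{2k}\right)$ the lattice $\varphi_\beta(\mathcal{I})$ (a rotated version of $\mathbb{Z}^n$) has minimum product distance $d_{p,\min}(\varphi_\beta(\mathcal{I}))=p^{(k-n)/2}\,2^{(l-n(m-1))/2}$; and $|N_{\mathbb{KL}}(x)|=p^{(n+k)/2}$.
   Context: Let $l>1$ be odd and $p$ a prime with $p\equiv1\pmod l$; let $\zeta_p=e^{2\pi i/p}$, $r$ a primitive root mod $p$, $\sigma\in\mathrm{Gal}(\mathbb{Q}(\zeta_p)/\mathbb{Q})$ with $\sigma(\zeta_p)=\zeta_p^r$, $\mathbb{K}=\{y\in\mathbb{Q}(\zeta_p):\sigma^l(y)=y\}$ (totally real, degree $l$). Let $\alpha=\prod_{j=0}^{(p-3)/2}(1-\zeta_p^{r^j})$, $\lambda$ an integer with $\lambda(r-1)\equiv1\pmod p$, $z=\zeta_p^\lambda\alpha(1-\zeta_p)$, $x=\sum_{j=1}^{(p-1)/l}\sigma^{jl}(z)\in\mathcal{O}_\mathbb{K}$, and $I=\mathbb{Z}x+\dots+\mathbb{Z}\sigma^{l-1}(x)$. Let $m\ge3$, $k=2^{m-2}$, $\omega=e^{2\pi i/2^m}$, $\theta=\omega+\omega^{-1}$, $\mathbb{L}=\mathbb{Q}(\theta)$ (totally real, degree $k$). Let $n=kl$, $\mathbb{KL}$ the compositum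 (totally real of degree $n$), and $\mathcal{I}=I\mathcal{O}_\mathbb{L}$ the $\mathbb{Z}$-module generated by all products $ab$ with $a\in I$, $b\in\mathcal{O}_\mathbb{L}$. For totally positive $\beta\in\mathbb{KL}$, $\varphi_\beta(y)=(\sqrt{\rho(\beta)}\rho(y))_\rho\in\mathbb{R}^n$, $\rho$ running over the $n$ real embeddings of $\mathbb{KL}$. $d_{p,\min}(\Lambda)=\inf\{|y_1\cdots y_n|:0\ne y\in\Lambda\}$; $N_{\mathbb{KL}}$ is the norm to $\mathbb{Q}$. *)

theory Defs
  imports "HOL-Analysis.Analysis" "HOL-Number_Theory.Number_Theory"
    "HOL-Computational_Algebra.Polynomial"
begin

text \<open>All number fields are realised as subfields of the complex numbers.\<close>

definition zeta :: "nat \<Rightarrow> complex" where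
  "zeta p = cis (2 * pi / real p)"

definition Qzeta :: "nat \<Rightarrow> complex set" where
  "Qzeta p = {poly (map_poly of_rat f) (zeta p) | f :: rat poly. True}"

definition Zzeta :: "nat \<Rightarrow> complex set" where
  "Zzeta p = {poly (map_poly of_int f) (zeta p) | f :: int poly. True}"

text \<open>The Galois automorphism sigma of Q(zeta_p) with sigma(zeta_p) = zeta_p^r.\<close>
definition sigma :: "nat \<Rightarrow> nat \<Rightarrow> complex \<Rightarrow> complex" where
  "sigma p r y = (THE w. \<exists>f :: rat poly. y = poly (map_poly of_rat f) (zeta p)
                        \<and> w = poly (map_poly of_rat f) (zeta p ^ r))"

definition Kfield :: "nat \<Rightarrow> nat \<Rightarrow> nat \<Rightarrow> complex set" where
  "Kfield p r l = {y \<in> Qzeta p. (sigma p r ^^ l) y = y}"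

definition alpha :: "nat \<Rightarrow> nat \<Rightarrow> complex" where
  "alpha p r = (\<Prod>j = 0..(p - 3) div 2. 1 - zeta p ^ (r ^ j))"

definition zelt :: "nat \<Rightarrow> nat \<Rightarrow> int \<Rightarrow> complex" where
  "zelt p r lam = zeta p powi lam * alpha p r * (1 - zeta p)"

definition xelt :: "nat \<Rightarrow> nat \<Rightarrow> nat \<Rightarrow> int \<Rightarrow> complex" where
  "xelt p r l lam = (\<Sum>j = 1..(p - 1) div l. (sigma p r ^^ (j * l)) (zelt p r lam))"

definition zspan :: "complex set \<Rightarrow> complex set" where
  "zspan S = {\<Sum>i<N. of_int (c i) * s i | (N::nat) (c::nat \<Rightarrow> int) s. \<forall>i<N. s i \<in> S}"

definition Iset :: "nat \<Rightarrow> nat \<Rightarrow> nat \<Rightarrow> int \<Rightarrow> complex set" where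
  "Iset p r l lam = zspan {(sigma p r ^^ j) (xelt p r l lam) | j. j < l}"

definition theta :: "nat \<Rightarrow> real" where
  "theta m = 2 * cos (2 * pi / 2 ^ m)"

definition Lfield :: "nat \<Rightarrow> complex set" where
  "Lfield m = {poly (map_poly of_rat f) (complex_of_real (theta m)) | f :: rat poly. True}"

definition algebraic_int :: "complex \<Rightarrow> bool" where
  "algebraic_int y \<longleftrightarrow> (\<exists>f :: int poly. lead_coeff f = 1 \<and> poly (map_poly of_int f) y = 0)"

definition ring_of_integers :: "complex set \<Rightarrow> complex set" where
  "ring_of_integers F = {y \<in> F. algebraic_int y}"

definition is_subfield :: "complex set \<Rightarrow> bool" where
  "is_subfield F \<longleftrightarrow> 0 \<in> F \<and> 1 \<in> F \<and> (\<forall>a\<in>F. \<forall>b\<in>F. a + b \<in> F \<and> a - b \<in> F \<and> a * b \<in> F)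
     \<and> (\<forall>a\<in>F. a \<noteq> 0 \<longrightarrow> inverse a \<in> F)"

definition compositum :: "complex set \<Rightarrow> complex set \<Rightarrow> complex set" where
  "compositum A B = \<Inter> {F. is_subfield F \<and> A \<union> B \<subseteq> F}"

definition prod_module :: "complex set \<Rightarrow> complex set \<Rightarrow> complex set" where
  "prod_module A B = zspan {a * b | a b. a \<in> A \<and> b \<in> B}"

definition embeddings :: "complex set \<Rightarrow> (complex \<Rightarrow> complex) set" where
  "embeddings F = {\<rho>. (\<forall>a\<in>F. \<forall>b\<in>F. \<rho> (a + b) = \<rho> a + \<rho> b \<and> \<rho> (a * b) = \<rho> a * \<rho> b)
                       \<and> \<rho> 1 = 1 \<and> (\<forall>a. a \<notin> F \<longrightarrow> \<rho> a = 0)}"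

definition real_embeddings :: "complex set \<Rightarrow> (complex \<Rightarrow> complex) set" where
  "real_embeddings F = {\<rho> \<in> embeddings F. \<forall>a\<in>F. \<rho> a \<in> \<real>}"

definition field_norm :: "complex set \<Rightarrow> complex \<Rightarrow> complex" where
  "field_norm F y = (\<Prod>\<rho>\<in>embeddings F. \<rho> y)"

text \<open>Vectors in R^n indexed by the real embeddings (zero outside)\<close>
definition phi :: "complex set \<Rightarrow> complex \<Rightarrow> complex \<Rightarrow> ((complex \<Rightarrow> complex) \<Rightarrow> real)" where
  "phi F \<beta> y = (\<lambda>\<rho>. if \<rho> \<in> real_embeddings F then sqrt (Re (\<rho> \<beta>)) * Re (\<rho> y) else 0)"

definition dpmin :: "complex set \<Rightarrow> ((complex \<Rightarrow> complex) \<Rightarrow> real) set \<Rightarrow> real" where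
  "dpmin F \<Lambda> = Inf {\<bar>\<Prod>\<rho>\<in>real_embeddings F. v \<rho>\<bar> | v. v \<in> \<Lambda> \<and> v \<noteq> (\<lambda>_. 0)}"

definition rotated_Zn :: "complex set \<Rightarrow> nat \<Rightarrow> ((complex \<Rightarrow> complex) \<Rightarrow> real) set \<Rightarrow> bool" where
  "rotated_Zn F n \<Lambda> \<longleftrightarrow> card (real_embeddings F) = n \<and>
     (\<exists>b :: nat \<Rightarrow> ((complex \<Rightarrow> complex) \<Rightarrow> real).
        (\<forall>i<n. \<forall>\<rho>. \<rho> \<notin> real_embeddings F \<longrightarrow> b i \<rho> = 0) \<and>
        (\<forall>i<n. \<forall>j<n. (\<Sum>\<rho>\<in>real_embeddings F. b i \<rho> * b j \<rho>) = (if i = j then 1 else 0)) \<and>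
        \<Lambda> = {(\<lambda>\<rho>. \<Sum>i<n. of_int (c i) * b i \<rho>) | c :: nat \<Rightarrow> int. True})"

end

theory Submission
  imports Defs "Jordan_Normal_Form.Char_Poly"
begin

text \<open>
  Let \<open>E = \<rat>(\<zeta>\<^sub>p, \<omega>)\<close>. Up to sign the conjugates of \<open>x\<close> are \<open>w\<close> times a sum of \<open>\<chi>(a) \<zeta>\<^sub>p\<^sup>a\<close> over a coset
  of the \<open>l\<close>-th powers, where \<open>\<chi>\<close> is the quadratic character and \<open>w\<^sup>2 = \<plusminus>p\<close>. They are orthogonal for
  the trace form of \<open>\<bbbK>\<close>, while the Dirichlet kernels in \<open>\<theta>\<close> are orthogonal for the form of \<open>\<bbbL>\<close>
  twisted by \<open>2 - \<theta>\<close>. The products \<open>b\<close> of the two families are therefore orthonormal for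
  \<open>Tr(\<beta> u v)\<close>, and the Gram matrix being square, every \<open>y\<close> in the compositum equals
  \<open>\<Sum> Tr(\<beta> y b) b\<close>.

  For an algebraic integer \<open>y\<close> the coordinates of \<open>x y\<close> are integers: \<open>2 k\<close> times a coordinate is
  integral because a rational integer divisible by \<open>1 - \<zeta>\<^sub>p\<close> is divisible by \<open>p\<close>, and \<open>p\<^sup>2\<close> times it is
  integral because \<open>\<int>[\<theta>]\<close> is integrally closed. Hence \<open>x O \<subseteq> \<I>\<close>, and the reverse inclusion holds as
  \<open>\<sigma>(x)/x\<close> is integral. The norm of \<open>x\<close> is bounded from below by the factor \<open>1 - \<zeta>\<^sub>p\<close> of each
  alternating sum and from above by testing a generator of the codifferent of \<open>\<bbbK>\<close> against \<open>\<I>\<close>.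
\<close>

hide_const (open) up_ring.coeff up_ring.monom Module.smult

subsection \<open>Algebraic integers\<close>

lemma algebraic_int_iff: "Defs.algebraic_int y \<longleftrightarrow> Polynomial.algebraic_int y"
proof
  assume "Defs.algebraic_int y"
  then obtain f :: "int poly" where "lead_coeff f = 1" "poly (map_poly of_int f) y = 0"
    unfolding Defs.algebraic_int_def by blast
  then show "Polynomial.algebraic_int y"
    unfolding algebraic_int_altdef_ipoly by (intro exI[of _ f]) auto
next
  assume "Polynomial.algebraic_int y"
  then show "Defs.algebraic_int y"
    unfolding algebraic_int_altdef_ipoly Defs.algebraic_int_def by auto
qed

abbreviation aint :: "complex \<Rightarrow> bool" where "aint \<equiv> Defs.algebraic_int"

text \<open>A nonzero vector spanning a module stable under multiplication by \<open>y\<close> is an eigenvector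
  of an integer matrix, whose characteristic polynomial then annihilates \<open>y\<close>.\<close>

lemma aint_of_stable_module:
  fixes v :: "nat \<Rightarrow> complex" and M :: "nat \<Rightarrow> nat \<Rightarrow> int"
  assumes "i0 < n" "v i0 \<noteq> 0"
    and M: "\<And>i. i < n \<Longrightarrow> y * v i = (\<Sum>j<n. of_int (M i j) * v j)"
  shows "aint y"
proof -
  define A where "A = Matrix.mat n n (\<lambda>(i, j). M i j)"
  have A: "A \<in> carrier_mat n n" by (simp add: A_def)
  let ?A = "map_mat complex_of_int A"
  have cA: "?A \<in> carrier_mat n n" using A by simp
  have "eigenvector ?A (Matrix.vec n v) y"
    unfolding eigenvector_def
  proof (intro conjI)
    show "Matrix.vec n v \<in> carrier_vec (dim_row ?A)" using A by simp
    show "Matrix.vec n v \<noteq> 0\<^sub>v (dim_row ?A)"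
    proof
      assume "Matrix.vec n v = 0\<^sub>v (dim_row ?A)"
      then have "vec_index (Matrix.vec n v) i0 = vec_index (0\<^sub>v n) i0" using A by simp
      then show False using assms(1,2) by simp
    qed
    show "?A *\<^sub>v Matrix.vec n v = y \<cdot>\<^sub>v Matrix.vec n v"
    proof (rule eq_vecI)
      fix i assume "i < dim_vec (y \<cdot>\<^sub>v Matrix.vec n v)"
      then have i: "i < n" by simp
      have "vec_index (?A *\<^sub>v Matrix.vec n v) i = (\<Sum>j = 0..<n. of_int (M i j) * v j)"
        using i by (simp add: A_def scalar_prod_def)
      also have "\<dots> = y * v i" using M[OF i] by (simp add: atLeast0LessThan)
      finally show "vec_index (?A *\<^sub>v Matrix.vec n v) i = vec_index (y \<cdot>\<^sub>v Matrix.vec n v) i"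
        using i by simp
    qed (simp add: A_def)
  qed
  then have "eigenvalue ?A y" unfolding eigenvalue_def by blast
  then have "poly (char_poly ?A) y = 0" using eigenvalue_root_char_poly[OF cA] by simp
  moreover have "char_poly ?A = map_poly of_int (char_poly A)"
    using of_int_hom.char_poly_hom[OF A] .
  ultimately show ?thesis
    unfolding Defs.algebraic_int_def using degree_monic_char_poly[OF A]
    by (intro exI[of _ "char_poly A"]) auto
qed

lemma monic_power_reduce:
  fixes f :: "int poly" and a :: complex
  assumes "lead_coeff f = 1" "poly (map_poly of_int f) a = 0"
  shows "a ^ degree f = (\<Sum>i<degree f. of_int (- coeff f i) * a ^ i)"
proof -
  have "degree (map_poly (of_int :: int \<Rightarrow> complex) f) = degree f" by simp
  then have "0 = (\<Sum>i\<le>degree f. of_int (coeff f i) * a ^ i)"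
    using assms(2) by (simp add: poly_altdef)
  also have "\<dots> = (\<Sum>i<degree f. of_int (coeff f i) * a ^ i) + a ^ degree f"
    using assms(1) by (simp add: lessThan_Suc_atMost[symmetric])
  finally show ?thesis by (simp add: sum_negf eq_neg_iff_add_eq_0 add.commute)
qed

context
  fixes a b :: complex and f g :: "int poly"
  assumes f: "lead_coeff f = 1" "poly (map_poly of_int f) a = 0" "degree f > 0"
    and g: "lead_coeff g = 1" "poly (map_poly of_int g) b = 0" "degree g > 0"
begin

private definition span where
  "span = {\<Sum>i<degree f. \<Sum>j<degree g. of_int (c i j) * (a ^ i * b ^ j) | c :: nat \<Rightarrow> nat \<Rightarrow> int. True}"

private lemma span_add: "x \<in> span \<Longrightarrow> y \<in> span \<Longrightarrow> x + y \<in> span"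
proof -
  assume "x \<in> span" "y \<in> span"
  then obtain c c' where
    "x = (\<Sum>i<degree f. \<Sum>j<degree g. of_int (c i j) * (a ^ i * b ^ j))"
    "y = (\<Sum>i<degree f. \<Sum>j<degree g. of_int (c' i j) * (a ^ i * b ^ j))"
    unfolding span_def by blast
  then have "x + y = (\<Sum>i<degree f. \<Sum>j<degree g. of_int ((\<lambda>i j. c i j + c' i j) i j) * (a ^ i * b ^ j))"
    by (simp add: sum.distrib distrib_right)
  then show "x + y \<in> span" unfolding span_def by (intro CollectI exI[of _ "\<lambda>i j. c i j + c' i j"]) simp
qed

private lemma span_scale: "x \<in> span \<Longrightarrow> of_int m * x \<in> span"
proof -
  assume "x \<in> span"
  then obtain c where "x = (\<Sum>i<degree f. \<Sum>j<degree g. of_int (c i j) * (a ^ i * b ^ j))"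
    unfolding span_def by blast
  then have "of_int m * x = (\<Sum>i<degree f. \<Sum>j<degree g. of_int ((\<lambda>i j. m * c i j) i j) * (a ^ i * b ^ j))"
    by (simp add: sum_distrib_left mult.assoc)
  then show ?thesis unfolding span_def by (intro CollectI exI[of _ "\<lambda>i j. m * c i j"]) simp
qed

private lemma span_0: "0 \<in> span"
  unfolding span_def by (rule CollectI, rule exI[of _ "\<lambda>_ _. 0"]) simp

private lemma span_sum: "(\<And>i. i \<in> A \<Longrightarrow> x i \<in> span) \<Longrightarrow> sum x A \<in> span"
  by (induction A rule: infinite_finite_induct) (auto simp: span_0 span_add)

private lemma span_gen: "i < degree f \<Longrightarrow> j < degree g \<Longrightarrow> a ^ i * b ^ j \<in> span"
proof -
  assume ij: "i < degree f" "j < degree g"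
  have "(\<Sum>i'<degree f. \<Sum>j'<degree g. of_int (if i' = i \<and> j' = j then 1 else 0) * (a ^ i' * b ^ j'))
     = (\<Sum>i'<degree f. if i' = i then a ^ i * b ^ j else 0)"
  proof (rule sum.cong[OF refl])
    fix i' assume "i' \<in> {..<degree f}"
    have "(\<Sum>j'<degree g. of_int (if i' = i \<and> j' = j then 1 else 0) * (a ^ i' * b ^ j'))
      = (\<Sum>j'<degree g. if j' = j then (if i' = i then a ^ i * b ^ j else 0) else 0)"
      by (rule sum.cong) auto
    then show "(\<Sum>j'<degree g. of_int (if i' = i \<and> j' = j then 1 else 0) * (a ^ i' * b ^ j')) =
         (if i' = i then a ^ i * b ^ j else 0)" using ij by simp
  qed
  also have "\<dots> = a ^ i * b ^ j" using ij by simp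
  finally show ?thesis unfolding span_def
    by (intro CollectI exI[of _ "\<lambda>i' j'. if i' = i \<and> j' = j then 1 else 0"]) simp
qed

private lemma span_mult_a: "x \<in> span \<Longrightarrow> a * x \<in> span"
proof -
  assume "x \<in> span"
  then obtain c where x: "x = (\<Sum>i<degree f. \<Sum>j<degree g. of_int (c i j) * (a ^ i * b ^ j))"
    unfolding span_def by blast
  have "a * (a ^ i * b ^ j) \<in> span" if ij: "i < degree f" "j < degree g" for i j
  proof (cases "Suc i < degree f")
    case True
    then show ?thesis using span_gen[OF True ij(2)] by (simp add: mult.assoc)
  next
    case False
    then have "Suc i = degree f" using ij by simp
    then have "a * (a ^ i * b ^ j) = a ^ degree f * b ^ j" by (metis mult.assoc power_Suc)
    also have "\<dots> = (\<Sum>i<degree f. of_int (- coeff f i) * (a ^ i * b ^ j))"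
      by (subst monic_power_reduce[OF f(1,2)]) (simp add: sum_distrib_right mult.assoc)
    finally show ?thesis using ij by (auto intro!: span_sum span_scale span_gen simp del: of_int_minus)
  qed
  then have "(\<Sum>i<degree f. \<Sum>j<degree g. of_int (c i j) * (a * (a ^ i * b ^ j))) \<in> span"
    by (intro span_sum span_scale) auto
  then show ?thesis unfolding x by (simp add: sum_distrib_left mult.left_commute)
qed

private lemma span_mult_b: "x \<in> span \<Longrightarrow> b * x \<in> span"
proof -
  assume "x \<in> span"
  then obtain c where x: "x = (\<Sum>i<degree f. \<Sum>j<degree g. of_int (c i j) * (a ^ i * b ^ j))"
    unfolding span_def by blast
  have "b * (a ^ i * b ^ j) \<in> span" if ij: "i < degree f" "j < degree g" for i j
  proof (cases "Suc j < degree g")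
    case True
    then show ?thesis using span_gen[OF ij(1) True] by (simp add: mult.left_commute)
  next
    case False
    then have "Suc j = degree g" using ij by simp
    then have "b * (a ^ i * b ^ j) = a ^ i * b ^ degree g" by (metis mult.left_commute power_Suc)
    also have "\<dots> = (\<Sum>j<degree g. of_int (- coeff g j) * (a ^ i * b ^ j))"
      by (subst monic_power_reduce[OF g(1,2)]) (simp add: sum_distrib_left mult.assoc mult.left_commute)
    finally show ?thesis using ij by (auto intro!: span_sum span_scale span_gen simp del: of_int_minus)
  qed
  then have "(\<Sum>i<degree f. \<Sum>j<degree g. of_int (c i j) * (b * (a ^ i * b ^ j))) \<in> span"
    by (intro span_sum span_scale) auto
  then show ?thesis unfolding x by (simp add: sum_distrib_left mult.left_commute)
qed

private lemma aint_of_stable_span: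
  assumes y: "\<And>x. x \<in> span \<Longrightarrow> y * x \<in> span"
  shows "aint y"
proof -
  let ?n = "degree f" and ?m = "degree g"
  define v where "v q = a ^ (q div ?m) * b ^ (q mod ?m)" for q
  have sum_conv: "(\<Sum>q<?n * ?m. h (q div ?m) (q mod ?m)) = (\<Sum>i<?n. \<Sum>j<?m. h i j)"
    for h :: "nat \<Rightarrow> nat \<Rightarrow> complex"
    unfolding sum.cartesian_product
  proof (rule sum.reindex_bij_witness[of _ "\<lambda>(i, j). i * ?m + j" "\<lambda>q. (q div ?m, q mod ?m)"])
    fix ij assume "ij \<in> {..<?n} \<times> {..<?m}"
    then obtain i j where ij: "ij = (i, j)" "i < ?n" "j < ?m" by auto
    have "i * ?m + j < Suc i * ?m" using ij by simp
    also have "\<dots> \<le> ?n * ?m" using ij by (intro mult_le_mono1) simp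
    finally show "(case ij of (i, j) \<Rightarrow> i * ?m + j) \<in> {..<?n * ?m}" using ij by simp
    show "((case ij of (i, j) \<Rightarrow> i * ?m + j) div ?m, (case ij of (i, j) \<Rightarrow> i * ?m + j) mod ?m) = ij"
      using ij by simp
  qed (auto simp: less_mult_imp_div_less g(3))
  have "\<exists>M :: nat \<Rightarrow> int. y * v q = (\<Sum>q'<?n * ?m. of_int (M q') * v q')" if "q < ?n * ?m" for q
  proof -
    have "v q \<in> span" unfolding v_def
      using that g(3) by (intro span_gen) (auto simp: less_mult_imp_div_less)
    then obtain c where "y * v q = (\<Sum>i<?n. \<Sum>j<?m. of_int (c i j) * (a ^ i * b ^ j))"
      using y unfolding span_def by blast
    then show ?thesis
      by (intro exI[of _ "\<lambda>q'. c (q' div ?m) (q' mod ?m)"]) (simp add: v_def sum_conv[of "\<lambda>i j. of_int (c i j) * (a ^ i * b ^ j)"])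
  qed
  then obtain M :: "nat \<Rightarrow> nat \<Rightarrow> int" where
    "\<And>q. q < ?n * ?m \<Longrightarrow> y * v q = (\<Sum>q'<?n * ?m. of_int (M q q') * v q')" by metis
  then show ?thesis
    using f(3) g(3) by (intro aint_of_stable_module[of 0 "?n * ?m" v y M]) (auto simp: v_def)
qed

lemma aint_sum_product: "aint (a + b)" "aint (a * b)"
  by (rule aint_of_stable_span; simp add: distrib_right span_add span_mult_a span_mult_b mult.assoc)+

end

lemma monic_root_degree_pos:
  fixes f :: "int poly" and a :: complex
  assumes "lead_coeff f = 1" "poly (map_poly of_int f) a = 0"
  shows "degree f > 0"
proof (rule ccontr)
  assume "\<not> degree f > 0"
  then obtain c where "f = [:c:]" using degree_eq_zeroE by blast
  then show False using assms by simp
qed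

lemma aint_add [intro]: "aint a \<Longrightarrow> aint b \<Longrightarrow> aint (a + b)"
  and aint_mult [intro]: "aint a \<Longrightarrow> aint b \<Longrightarrow> aint (a * b)"
proof -
  assume "aint a" "aint b"
  then obtain f g :: "int poly" where "lead_coeff f = 1" "poly (map_poly of_int f) a = 0"
    "lead_coeff g = 1" "poly (map_poly of_int g) b = 0"
    unfolding Defs.algebraic_int_def by blast
  note * = this(1,2) monic_root_degree_pos[OF this(1,2)] this(3,4) monic_root_degree_pos[OF this(3,4)]
  show "aint (a + b)" "aint (a * b)"
    using aint_sum_product[OF *] by blast+
qed

lemma aint_of_int [simp, intro]: "aint (of_int n)"
  by (simp add: algebraic_int_iff int_imp_algebraic_int)

lemma aint_of_nat [simp, intro]: "aint (of_nat n)"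
  using aint_of_int[of "int n"] by simp

lemma aint_numeral [simp, intro]: "aint (numeral n)" "aint 0" "aint 1"
  using aint_of_int[of "numeral n"] aint_of_int[of 0] aint_of_int[of 1] by simp_all

lemma aint_uminus [intro]: "aint a \<Longrightarrow> aint (- a)"
  by (auto simp: algebraic_int_iff)

lemma aint_diff [intro]: "aint a \<Longrightarrow> aint b \<Longrightarrow> aint (a - b)"
  using aint_add[of a "- b"] by auto

lemma aint_power [intro]: "aint a \<Longrightarrow> aint (a ^ n)"
  by (induction n) auto

lemma aint_sum [intro]: "(\<And>i. i \<in> A \<Longrightarrow> aint (f i)) \<Longrightarrow> aint (sum f A)"
  by (induction A rule: infinite_finite_induct) auto

lemma aint_prod [intro]: "(\<And>i. i \<in> A \<Longrightarrow> aint (f i)) \<Longrightarrow> aint (prod f A)"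
  by (induction A rule: infinite_finite_induct) auto

lemma aint_poly [intro]: "aint a \<Longrightarrow> aint (poly (map_poly of_int f) a)"
  by (simp add: poly_altdef) blast

lemma aint_root_of_unity:
  assumes "n > 0" "a ^ n = 1"
  shows "aint a"
proof -
  have d: "degree (monom 1 n - 1 :: int poly) = n"
    using assms(1) by (intro antisym degree_le le_degree) (auto simp: coeff_eq_0)
  have "coeff (monom 1 n - 1 :: int poly) n = 1" using assms(1) by (simp add: coeff_eq_0)
  then show ?thesis unfolding Defs.algebraic_int_def
    using d assms(2) by (intro exI[of _ "monom 1 n - 1"]) (simp add: of_int_poly_hom.hom_minus poly_monom)
qed

lemma rational_aint_int: 
  assumes "a \<in> \<rat>" "aint a"
  obtains n where "a = of_int n"
  using rational_algebraic_int_is_int[of a] assms unfolding algebraic_int_iff by (auto elim: Ints_cases)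

lemma aint_divide_int: 
  assumes "aint (of_int b / of_int a)" "a \<noteq> 0"
  shows "a dvd b"
proof -
  have "of_int b / complex_of_int a \<in> \<rat>" by simp
  then obtain n where n: "of_int b / complex_of_int a = of_int n"
    using rational_aint_int assms(1) by blast
  then have "complex_of_int b = of_int (a * n)" using assms(2) by (simp add: field_simps)
  then have "b = a * n" using of_int_eq_iff by blast
  then show "a dvd b" by simp
qed

subsection \<open>Conjugates of roots of unity\<close>

lemma aint_freshman:
  assumes q: "prime q" and "aint a" "aint b"
  shows "aint (((a + b) ^ q - a ^ q - b ^ q) / of_nat q)"
proof -
  have q0: "q > 0" using q prime_gt_0_nat by blast
  have "(a + b) ^ q = (\<Sum>k\<le>q. of_nat (q choose k) * a ^ k * b ^ (q - k))"
    by (rule binomial_ring)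
  also have "{..q} = insert 0 (insert q {1..<q})" using q0 by auto
  also have "(\<Sum>k\<in>\<dots>. of_nat (q choose k) * a ^ k * b ^ (q - k))
     = b ^ q + (a ^ q + (\<Sum>k\<in>{1..<q}. of_nat (q choose k) * a ^ k * b ^ (q - k)))"
    using q0 by simp
  finally have *: "((a + b) ^ q - a ^ q - b ^ q) / of_nat q
     = (\<Sum>k\<in>{1..<q}. of_nat (q choose k) * a ^ k * b ^ (q - k)) / of_nat q" by simp
  also have "\<dots> = (\<Sum>k\<in>{1..<q}. of_nat ((q choose k) div q) * a ^ k * b ^ (q - k))"
    unfolding sum_divide_distrib
  proof (rule sum.cong[OF refl])
    fix k assume "k \<in> {1..<q}"
    then have "q dvd (q choose k)" using q by (intro dvd_choose_prime) auto
    then have "complex_of_nat (q choose k) = of_nat q * of_nat ((q choose k) div q)"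
      by (metis dvd_mult_div_cancel of_nat_mult)
    then show "of_nat (q choose k) * a ^ k * b ^ (q - k) / of_nat q
       = of_nat ((q choose k) div q) * a ^ k * b ^ (q - k)" using q0 by simp
  qed
  finally show ?thesis using assms(2,3) by (auto intro!: aint_sum)
qed

lemma aint_frobenius:
  fixes h :: "int poly"
  assumes q: "prime q" and "aint w"
  shows "aint ((poly (map_poly of_int h) w ^ q - poly (map_poly of_int h) (w ^ q)) / of_nat q)"
proof (induction h)
  case 0
  then show ?case using q prime_gt_0_nat[of q] by (simp add: power_0_left)
next
  case (pCons a h)
  let ?g = "poly (map_poly of_int h) w" and ?g' = "poly (map_poly of_int h) (w ^ q)"
  have q0: "q > 0" using q prime_gt_0_nat by blast
  have "[a ^ q = a] (mod int q)"
  proof -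
    have "[nat (a mod q) ^ q = nat (a mod q)] (mod q)"
    proof (cases "q dvd nat (a mod q)")
      case True
      moreover have "nat (a mod q) < q" using q0 by (simp add: nat_less_iff)
      ultimately have "nat (a mod q) = 0" using nat_dvd_not_less by blast
      then show ?thesis using q0 by (simp only: power_0_left) simp
    next
      case False
      then have "[nat (a mod q) ^ (q - 1) * nat (a mod q) = 1 * nat (a mod q)] (mod q)"
        using fermat_theorem[OF q] by (intro cong_scalar_right) auto
      then show ?thesis using q0 by (simp flip: power_Suc2)
    qed
    then have "[int (nat (a mod q) ^ q) = int (nat (a mod q))] (mod int q)"
      by (simp only: cong_int_iff)
    then have "[(a mod q) ^ q = a mod q] (mod int q)" using q0 by simp
    then show ?thesis by (simp add: cong_def power_mod)
  qed
  then obtain c where "a ^ q - a = int q * c" by (auto simp: cong_iff_dvd_diff)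
  then have "complex_of_int (a ^ q - a) = of_int (int q * c)" by simp
  then have c: "of_int a ^ q = complex_of_int a + of_nat q * of_int c" by (simp add: algebra_simps)
  have "(poly (map_poly of_int (pCons a h)) w ^ q - poly (map_poly of_int (pCons a h)) (w ^ q)) / of_nat q
     = ((of_int a + w * ?g) ^ q - of_int a ^ q - (w * ?g) ^ q) / of_nat q
       + of_int c + w ^ q * ((?g ^ q - ?g') / of_nat q)"
  proof -
    have "(P - (A + W * G')) / Q = (P - (A + Q * C) - W * G) / Q + C + W * ((G - G') / Q)"
      if "Q \<noteq> 0" for P A W G G' Q C :: complex
      using that by (simp add: field_simps)
    from this[of "of_nat q"] show ?thesis using q0
      unfolding c of_int_hom.map_poly_pCons_hom poly_pCons power_mult_distrib by simp
  qed
  also have "aint \<dots>"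
    using assms pCons by (intro aint_add aint_mult aint_freshman) auto
  finally show ?case .
qed

lemma int_poly_minimal_divisor:
  assumes n: "n > 0" and z: "z ^ n = (1 :: complex)"
  obtains f h :: "int poly" where "monom 1 n - 1 = f * h" "poly (map_poly of_int f) z = 0"
    "\<And>g :: int poly. poly (map_poly of_int g) z = 0 \<Longrightarrow> f dvd g"
proof -
  define P where "P f \<longleftrightarrow> f \<noteq> 0 \<and> poly (map_poly of_int f) z = 0" for f :: "int poly"
  have nz: "monom 1 n - 1 \<noteq> (0 :: int poly)"
  proof
    assume "monom 1 n - 1 = (0 :: int poly)"
    then have "coeff (monom 1 n - 1 :: int poly) n = 0" by simp
    then show False using n by (simp add: coeff_eq_0)
  qed
  have zn: "poly (map_poly of_int (monom 1 n - 1)) z = 0"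
    using z by (simp add: of_int_poly_hom.hom_minus poly_monom)
  have "P (monom 1 n - 1)" using nz zn by (simp add: P_def)
  then obtain f0 where f0: "P f0" and min: "\<And>g. P g \<Longrightarrow> degree f0 \<le> degree g"
    using ex_has_least_nat[of P _ degree] by blast
  define f where "f = primitive_part f0"
  have f0': "f0 = smult (content f0) f" by (simp add: f_def)
  have c0: "content f0 \<noteq> 0" using f0 by (simp add: P_def)
  have df: "degree f = degree f0" "f \<noteq> 0" using f0 by (auto simp: f_def P_def)
  have fz: "poly (map_poly of_int f) z = 0"
  proof -
    have "poly (map_poly of_int (smult (content f0) f)) z = 0" using f0 f0' by (simp add: P_def)
    then show ?thesis using c0 by (simp add: of_int_hom.map_poly_hom_smult)
  qed
  have cf: "content f = 1" using f0 by (simp add: f_def P_def)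
  have dvd: "f dvd g" if g: "poly (map_poly of_int g) z = 0" for g
  proof -
    obtain a q where aq: "a \<noteq> 0" "smult a g = f * q + pseudo_mod g f"
      using pseudo_mod(1)[OF df(2)] by blast
    have "poly (map_poly of_int (smult a g)) z = 0" using g by (simp add: of_int_hom.map_poly_hom_smult)
    then have "poly (map_poly of_int (pseudo_mod g f)) z = 0"
      unfolding aq(2) using fz by (simp add: of_int_poly_hom.hom_add of_int_poly_hom.hom_mult)
    then have "pseudo_mod g f = 0"
      using pseudo_mod(2)[OF df(2), of g] min[of "pseudo_mod g f"] df(1) unfolding P_def by linarith
    then have e: "smult a g = f * q" using aq(2) by simp
    then have "normalize a * content g = content q"
      by (metis content_smult content_mult cf mult_1)
    then have "a dvd content q" by (metis dvd_triv_left normalize_dvd_iff)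
    then have "[:a:] dvd q" by (simp add: const_poly_dvd_iff_dvd_content)
    then obtain q' where "q = smult a q'" by (auto elim!: dvdE)
    then have "smult a (g - f * q') = 0" using e by (simp add: smult_diff_right)
    then have "g = f * q'" using aq(1) by (simp only: smult_eq_0_iff) simp
    then show "f dvd g" by simp
  qed
  from dvd[OF zn] obtain h where "monom 1 n - 1 = f * h" by (auto elim: dvdE)
  then show ?thesis using that fz dvd by blast
qed

lemma root_prime_power:
  fixes f h :: "int poly" and w :: complex
  assumes n: "n > 0" and fh: "monom 1 n - 1 = f * h"
    and q: "prime q" "\<not> q dvd n" and w: "poly (map_poly of_int f) w = 0"
  shows "poly (map_poly of_int f) (w ^ q) = 0"
proof (rule ccontr)
  let ?P = "\<lambda>f x. poly (map_poly of_int f) (x :: complex)"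
  assume nz: "?P f (w ^ q) \<noteq> 0"
  have fact: "x ^ n - 1 = ?P f x * ?P h x" for x
  proof -
    have "?P (monom 1 n - 1) x = x ^ n - 1" by (simp add: of_int_poly_hom.hom_minus poly_monom)
    then show ?thesis unfolding fh by (simp add: of_int_poly_hom.hom_mult)
  qed
  have wn: "w ^ n = 1" using fact[of w] w by simp
  then have w0: "w \<noteq> 0" using n by (auto simp: power_0_left)
  have aw: "aint w" using aint_root_of_unity[OF n wn] .
  have "?P f (w ^ q) * ?P h (w ^ q) = 0"
    using fact[of "w ^ q"] wn by (simp flip: power_mult add: mult.commute[of q]) (simp add: power_mult)
  then have hq: "?P h (w ^ q) = 0" using nz by simp
  have ah: "aint (?P h w ^ q / of_nat q)" using aint_frobenius[OF q(1) aw, of h] hq by simp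
  have "pderiv (monom 1 n - 1 :: int poly) = monom (of_nat n) (n - 1)"
    by (simp add: pderiv_diff pderiv_monom)
  then have "monom (of_nat n) (n - 1) = f * pderiv h + h * pderiv f"
    unfolding fh pderiv_mult by simp
  then have "?P (monom (of_nat n) (n - 1)) w = ?P (f * pderiv h + h * pderiv f) w" by simp
  then have d: "of_nat n * w ^ (n - 1) = ?P h w * ?P (pderiv f) w"
    using w by (simp add: of_int_poly_hom.hom_add of_int_poly_hom.hom_mult poly_monom)
  have "of_nat n = w * (of_nat n * w ^ (n - 1))"
    using wn n by (metis mult.left_commute mult.right_neutral power_eq_if neq0_conv)
  also have "\<dots> = w * ?P (pderiv f) w * ?P h w" unfolding d by simp
  finally have "of_nat n ^ q / of_nat q = (w * ?P (pderiv f) w) ^ q * (?P h w ^ q / of_nat q)"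
    by (simp add: power_mult_distrib)
  also have "aint \<dots>" using aw ah by (intro aint_mult aint_power aint_poly) auto
  finally have "aint (of_int (int n ^ q) / of_int (int q))" by simp
  then have "int q dvd int n ^ q" using prime_gt_0_nat[OF q(1)] by (intro aint_divide_int) auto
  then have "q dvd n ^ q" by (metis of_nat_dvd_iff of_nat_power)
  then show False using q prime_dvd_power by blast
qed

lemma root_coprime_power:
  fixes f h :: "int poly" and w :: complex
  assumes n: "n > 0" and fh: "monom 1 n - 1 = f * h"
  shows "coprime a n \<Longrightarrow> a > 0 \<Longrightarrow> poly (map_poly of_int f) w = 0 \<Longrightarrow> poly (map_poly of_int f) (w ^ a) = 0"
proof (induction a arbitrary: w rule: less_induct)
  case (less a)
  show ?case
  proof (cases "a = 1")
    case False
    then obtain q where q: "prime q" "q dvd a" using prime_factor_nat by blast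
    then obtain b where b: "a = q * b" by (auto elim: dvdE)
    have "\<not> q dvd n" using q less.prems(1) by (meson coprime_common_divisor not_prime_unit)
    then have "poly (map_poly of_int f) (w ^ q) = 0" using root_prime_power[OF n fh q(1)] less.prems by blast
    moreover have "b < a" "b > 0" using b less.prems(2) prime_gt_1_nat[OF q(1)] by auto
    moreover have "coprime b n" using less.prems(1) b by simp
    ultimately have "poly (map_poly of_int f) ((w ^ q) ^ b) = 0" using less.IH by blast
    then show ?thesis unfolding b power_mult .
  qed (use less in simp)
qed

lemma rat_poly_scale_int:
  fixes f :: "rat poly"
  obtains D :: int and g :: "int poly" where "D > 0" "smult (of_int D) f = map_poly of_int g"
proof -
  have "\<exists>D (g :: int poly). D > 0 \<and> smult (of_int D) f = map_poly of_int g"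
  proof (induction f)
    case 0
    then show ?case by (intro exI[of _ 1] exI[of _ 0]) simp
  next
    case (pCons a f)
    then obtain D and g :: "int poly" where D: "D > 0" "smult (of_int D) f = map_poly of_int g" by blast
    obtain u v where uv: "a = of_int u / of_int v" "v > 0"
      by (metis Fract_of_int_quotient quotient_of_denom_pos' quotient_of_div surjective_pairing)
    have "smult (of_int (v * D)) (pCons a f) = pCons (of_int (u * D)) (smult (of_int v) (smult (of_int D) f))"
      using uv by simp
    also have "\<dots> = map_poly of_int (pCons (u * D) (smult v g))"
      unfolding D(2) by (simp add: of_int_hom.map_poly_hom_smult of_int_hom.map_poly_pCons_hom)
    finally have "smult (of_int (v * D)) (pCons a f) = map_poly of_int (pCons (u * D) (smult v g))" .
    then show ?case using D(1) uv(2) by (intro exI[of _ "v * D"] exI[of _ "pCons (u * D) (smult v g)"]) auto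
  qed
  then show ?thesis using that by blast
qed

abbreviation rpoly :: "rat poly \<Rightarrow> complex \<Rightarrow> complex" where
  "rpoly f \<equiv> poly (map_poly of_rat f)"

interpretation of_rat_poly_hom: map_poly_idom_hom "of_rat :: rat \<Rightarrow> complex" ..

lemma rpoly_simps [simp]:
  "rpoly (f + g) x = rpoly f x + rpoly g x" "rpoly (f - g) x = rpoly f x - rpoly g x"
  "rpoly (f * g) x = rpoly f x * rpoly g x" "rpoly (smult c f) x = of_rat c * rpoly f x"
  "rpoly (- f) x = - rpoly f x" 
  by (simp_all add: of_rat_hom.map_poly_hom_smult of_rat_poly_hom.hom_minus of_rat_poly_hom.hom_add
      of_rat_poly_hom.hom_mult of_rat_poly_hom.hom_uminus)

lemma rpoly_pCons [simp]: "rpoly (pCons c f) x = of_rat c + x * rpoly f x"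
  by (simp add: of_rat_hom.map_poly_pCons_hom)

lemma rpoly_int_poly: "rpoly (map_poly of_int g) x = poly (map_poly of_int g) x"
  by (simp add: poly_altdef)

lemma rpoly_eq_sum: "rpoly f x = (\<Sum>i\<le>degree f. of_rat (coeff f i) * x ^ i)"
  by (simp add: poly_altdef)

lemma conjugate_root_of_unity:
  assumes n: "n > 0" and z: "z ^ n = 1" and a: "coprime a n" "a > 0" and f: "rpoly f z = 0"
  shows "rpoly f (z ^ a) = 0"
proof -
  obtain D g where D: "D > 0" "smult (of_int D) f = map_poly of_int g"
    using rat_poly_scale_int .
  have *: "of_int D * rpoly f x = poly (map_poly of_int g) x" for x
    using arg_cong[OF D(2), of "\<lambda>f. rpoly f x"] by (simp add: rpoly_int_poly)
  obtain f0 h where f0: "monom 1 n - 1 = f0 * h" "poly (map_poly of_int f0) z = 0"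
    "\<And>g :: int poly. poly (map_poly of_int g) z = 0 \<Longrightarrow> f0 dvd g"
    using int_poly_minimal_divisor[OF n z] by blast
  have "f0 dvd g" using f0(3) *[of z] f by simp
  moreover have "poly (map_poly of_int f0) (z ^ a) = 0"
    using root_coprime_power[OF n f0(1) a f0(2)] .
  ultimately have "poly (map_poly of_int g) (z ^ a) = 0"
    by (auto elim!: dvdE simp: of_int_poly_hom.hom_mult)
  then show ?thesis using *[of "z ^ a"] D(1) by simp
qed

subsection \<open>The automorphisms of a cyclotomic field\<close>

lemma zeta_power_self: "n > 0 \<Longrightarrow> zeta n ^ n = 1"
  by (simp add: zeta_def Complex.DeMoivre complex_eq_iff)

lemma zeta_nonzero [simp]: "zeta n \<noteq> 0"
  by (simp add: zeta_def)

lemma zeta_power_cong: "n > 0 \<Longrightarrow> [a = b] (mod n) \<Longrightarrow> zeta n ^ a = zeta n ^ b"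
proof -
  have "zeta n ^ a = zeta n ^ (a mod n)" if "n > 0" for a
  proof -
    have "zeta n ^ a = zeta n ^ (n * (a div n) + a mod n)" by simp
    also have "\<dots> = zeta n ^ (a mod n)" by (simp only: power_add power_mult zeta_power_self[OF that]) simp
    finally show ?thesis .
  qed
  then show "n > 0 \<Longrightarrow> [a = b] (mod n) \<Longrightarrow> zeta n ^ a = zeta n ^ b" unfolding cong_def by metis
qed

lemma zeta_power_eq_1_iff: "n > 0 \<Longrightarrow> zeta n ^ a = 1 \<longleftrightarrow> n dvd a"
proof
  assume n: "n > 0" and 1: "zeta n ^ a = 1"
  have "inj_on (\<lambda>k. cis (2 * pi * real k / real n)) {..<n}"
    using Complex.bij_betw_roots_unity[OF n] by (simp add: bij_betw_def)
  moreover have "zeta n ^ k = cis (2 * pi * real k / real n)" for k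
    by (simp add: zeta_def Complex.DeMoivre mult_ac)
  ultimately have "inj_on (\<lambda>k. zeta n ^ k) {..<n}" by simp
  moreover have "zeta n ^ (a mod n) = zeta n ^ 0" using 1 zeta_power_cong[OF n, of "a mod n" a] by simp
  ultimately have "a mod n = 0" using n unfolding inj_on_def by (metis lessThan_iff mod_less_divisor)
  then show "n dvd a" by auto
next
  assume "n > 0" "n dvd a"
  then show "zeta n ^ a = 1" by (auto simp: power_mult zeta_power_self)
qed

lemma zeta_mult_left: "a > 0 \<Longrightarrow> n > 0 \<Longrightarrow> zeta (a * n) ^ a = zeta n"
  by (simp add: zeta_def Complex.DeMoivre)

lemma Qzeta_rpoly [intro]: "rpoly f (zeta n) \<in> Qzeta n"
  unfolding Qzeta_def by blast

lemma QzetaE: assumes "y \<in> Qzeta n" obtains f where "y = rpoly f (zeta n)"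
  using assms unfolding Qzeta_def by blast

lemma Qzeta_add [intro]: "x \<in> Qzeta n \<Longrightarrow> y \<in> Qzeta n \<Longrightarrow> x + y \<in> Qzeta n"
  and Qzeta_diff [intro]: "x \<in> Qzeta n \<Longrightarrow> y \<in> Qzeta n \<Longrightarrow> x - y \<in> Qzeta n"
  and Qzeta_mult [intro]: "x \<in> Qzeta n \<Longrightarrow> y \<in> Qzeta n \<Longrightarrow> x * y \<in> Qzeta n"
  by (metis QzetaE Qzeta_rpoly rpoly_simps(1-3))+

lemma Qzeta_of_rat [simp, intro]: "of_rat c \<in> Qzeta n"
  using Qzeta_rpoly[of "[:c:]" n] by simp

lemma Qzeta_Rats: "y \<in> \<rat> \<Longrightarrow> y \<in> Qzeta n"
  by (auto elim!: Rats_cases)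

lemma Qzeta_0_1 [simp, intro]: "0 \<in> Qzeta n" "1 \<in> Qzeta n"
  using Qzeta_of_rat[of 0 n] Qzeta_of_rat[of 1 n] by simp_all

lemma Qzeta_zeta [simp, intro]: "zeta n \<in> Qzeta n"
  using Qzeta_rpoly[of "[:0, 1:]" n] by simp

lemma Qzeta_power [intro]: "y \<in> Qzeta n \<Longrightarrow> y ^ k \<in> Qzeta n"
  by (induction k) auto

lemma Qzeta_uminus [intro]: "y \<in> Qzeta n \<Longrightarrow> - y \<in> Qzeta n"
  using Qzeta_diff[of 0 n y] by simp

lemma Qzeta_sum [intro]: "(\<And>i. i \<in> A \<Longrightarrow> f i \<in> Qzeta n) \<Longrightarrow> sum f A \<in> Qzeta n"
  by (induction A rule: infinite_finite_induct) auto

lemma Qzeta_prod [intro]: "(\<And>i. i \<in> A \<Longrightarrow> f i \<in> Qzeta n) \<Longrightarrow> prod f A \<in> Qzeta n"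
  by (induction A rule: infinite_finite_induct) auto

lemma Qzeta_rpoly' [intro]: "y \<in> Qzeta n \<Longrightarrow> rpoly f y \<in> Qzeta n"
  unfolding rpoly_eq_sum by auto

context
  fixes n a :: nat
  assumes n: "n > 0" and a: "coprime a n" "a > 0"
begin

lemma sigma_rpoly: "sigma n a (rpoly f (zeta n)) = rpoly f (zeta n ^ a)"
  unfolding sigma_def
proof (rule the_equality)
  fix w assume "\<exists>g. rpoly f (zeta n) = rpoly g (zeta n) \<and> w = rpoly g (zeta n ^ a)"
  then obtain g where g: "rpoly f (zeta n) = rpoly g (zeta n)" "w = rpoly g (zeta n ^ a)" by blast
  then have "rpoly (g - f) (zeta n) = 0" by simp
  then have "rpoly (g - f) (zeta n ^ a) = 0"
    using conjugate_root_of_unity[OF n zeta_power_self[OF n] a] by blast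
  then show "w = rpoly f (zeta n ^ a)" using g by simp
qed blast

lemma sigma_of_rat: "sigma n a (of_rat c) = of_rat c"
  using sigma_rpoly[of "[:c:]"] by simp

lemma sigma_add: "x \<in> Qzeta n \<Longrightarrow> y \<in> Qzeta n \<Longrightarrow> sigma n a (x + y) = sigma n a x + sigma n a y"
  and sigma_mult: "x \<in> Qzeta n \<Longrightarrow> y \<in> Qzeta n \<Longrightarrow> sigma n a (x * y) = sigma n a x * sigma n a y"
proof -
  assume "x \<in> Qzeta n" "y \<in> Qzeta n"
  then obtain f g where fg: "x = rpoly f (zeta n)" "y = rpoly g (zeta n)" by (elim QzetaE)
  show "sigma n a (x + y) = sigma n a x + sigma n a y"
    using sigma_rpoly[of "f + g"] by (simp add: fg sigma_rpoly)
  show "sigma n a (x * y) = sigma n a x * sigma n a y"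
    using sigma_rpoly[of "f * g"] by (simp add: fg sigma_rpoly)
qed

lemma sigma_in_Qzeta: "x \<in> Qzeta n \<Longrightarrow> sigma n a x \<in> Qzeta n"
  by (elim QzetaE) (auto simp: sigma_rpoly)

end

lemma sigma_cong:
  assumes "n > 0" "coprime a n" "a > 0" "coprime b n" "b > 0" "[a = b] (mod n)" "y \<in> Qzeta n"
  shows "sigma n a y = sigma n b y"
  using assms(7) zeta_power_cong[OF assms(1,6)]
  by (elim QzetaE) (simp add: sigma_rpoly[OF assms(1,2,3)] sigma_rpoly[OF assms(1,4,5)])

lemma aint_inverse_rpoly:
  assumes "aint y" "y \<noteq> 0"
  obtains q where "inverse y = rpoly q y"
proof -
  have "\<exists>q. inverse y = rpoly q y" if "f \<noteq> 0" "rpoly f y = 0" for f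
    using that
  proof (induction f)
    case (pCons a f)
    show ?case
    proof (cases "a = 0")
      case True
      then show ?thesis using pCons assms(2) by auto
    next
      case False
      have "y * rpoly f y = - of_rat a" using pCons.prems(2) by (simp add: eq_neg_iff_add_eq_0 add.commute)
      then have "inverse y = - rpoly f y / of_rat a"
        using assms(2) False by (simp add: field_simps)
      also have "\<dots> = rpoly (smult (- 1 / a) f) y" by (simp add: of_rat_divide of_rat_minus)
      finally show ?thesis by blast
    qed
  qed simp
  moreover obtain f :: "int poly" where "lead_coeff f = 1" "poly (map_poly of_int f) y = 0"
    using assms(1) unfolding Defs.algebraic_int_def by blast
  moreover from this have "f \<noteq> 0" by auto
  ultimately show ?thesis using that by (metis map_poly_eq_0_iff of_int_eq_0_iff rpoly_int_poly)
qed

lemma aint_zeta [simp, intro]: "n > 0 \<Longrightarrow> aint (zeta n)"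
  using aint_root_of_unity zeta_power_self by blast

lemma Qzeta_inverse [intro]:
  assumes n: "n > 0" and y: "y \<in> Qzeta n"
  shows "inverse y \<in> Qzeta n"
proof (cases "y = 0")
  case False
  obtain f where f: "y = rpoly f (zeta n)" using y by (rule QzetaE)
  obtain D g where D: "D > 0" "smult (of_int D) f = map_poly of_int g"
    using rat_poly_scale_int .
  have "of_int D * y = poly (map_poly of_int g) (zeta n)"
    using arg_cong[OF D(2), of "\<lambda>f. rpoly f (zeta n)"] by (simp add: rpoly_int_poly f)
  then have "aint (of_int D * y)" using n by auto
  then obtain q where q: "inverse (of_int D * y) = rpoly q (of_int D * y)"
    using aint_inverse_rpoly[of "of_int D * y"] False D(1) by auto
  have "complex_of_int D \<in> Qzeta n" by (intro Qzeta_Rats) simp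
  then have "of_int D * inverse (of_int D * y) \<in> Qzeta n"
    unfolding q using y by (intro Qzeta_mult Qzeta_rpoly')
  then show ?thesis using D(1) by (simp add: field_simps)
qed simp

lemma sum_periodic:
  fixes f :: "nat \<Rightarrow> 'a :: comm_semiring_1"
  assumes "\<And>s. f (s + l) = f s"
  shows "sum f {..<d * l} = of_nat d * sum f {..<l}"
proof (induction d)
  case (Suc d)
  have "f (s + d * l) = f s" for s
    by (induction d) (simp_all add: assms add.assoc[symmetric] add.commute[of l])
  then have "sum f {d * l..<d * l + l} = sum f {..<l}"
    using sum.shift_bounds_nat_ivl[of f 0 "d * l" l] by (simp add: atLeast0LessThan add.commute)
  moreover have "{..<Suc d * l} = {..<d * l} \<union> {d * l..<d * l + l}" by auto
  ultimately show ?case using Suc by (simp add: sum.union_disjoint ivl_disj_int algebra_simps)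
qed simp

lemma sum_shift_periodic:
  fixes f :: "nat \<Rightarrow> 'a :: comm_monoid_add"
  assumes "\<And>s. f (s + l) = f s"
  shows "(\<Sum>s<l. f (s + i)) = sum f {..<l}"
proof (induction i)
  case (Suc i)
  show ?case
  proof (cases l)
    case (Suc l')
    have "(\<Sum>s<l. f (s + Suc i)) = (\<Sum>s<l'. f (Suc s + i)) + f (i + l)"
      by (simp add: Suc add.commute)
    also have "\<dots> = f (0 + i) + (\<Sum>s<l'. f (Suc s + i))"
      using assms[of i] by (simp add: ac_simps)
    also have "\<dots> = (\<Sum>s<l. f (s + i))"
      unfolding Suc sum.lessThan_Suc_shift ..
    finally show ?thesis using Suc.IH by simp
  qed simp
qed simp

lemma prod_shift_periodic:
  fixes f :: "nat \<Rightarrow> 'a :: comm_monoid_mult"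
  assumes "\<And>s. f (s + l) = f s"
  shows "(\<Prod>s<l. f (s + i)) = prod f {..<l}"
proof (induction i)
  case (Suc i)
  show ?case
  proof (cases l)
    case (Suc l')
    have "(\<Prod>s<l. f (s + Suc i)) = (\<Prod>s<l'. f (Suc s + i)) * f (i + l)"
      by (simp add: Suc add.commute)
    also have "\<dots> = f (0 + i) * (\<Prod>s<l'. f (Suc s + i))"
      using assms[of i] by (simp add: ac_simps)
    also have "\<dots> = (\<Prod>s<l. f (s + i))"
      unfolding Suc prod.lessThan_Suc_shift ..
    finally show ?thesis using Suc.IH by simp
  qed simp
qed simp

lemma sum_fold_reflect:
  fixes f :: "nat \<Rightarrow> 'a :: comm_monoid_add"
  shows "sum f {..<2 * k} = (\<Sum>t<k. f t + f (2 * k - 1 - t))"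
proof -
  have "{..<2 * k} = {..<k} \<union> {k..<2 * k}" by auto
  then have "sum f {..<2 * k} = sum f {..<k} + sum f {k..<2 * k}" by (simp add: sum.union_disjoint ivl_disj_int)
  also have "sum f {k..<2 * k} = (\<Sum>t<k. f (2 * k - 1 - t))"
    by (rule sum.reindex_bij_witness[of _ "\<lambda>t. 2 * k - 1 - t" "\<lambda>t. 2 * k - 1 - t"]) auto
  finally show ?thesis by (simp add: sum.distrib)
qed

lemma prod_fold_reflect:
  fixes f :: "nat \<Rightarrow> 'a :: comm_monoid_mult"
  shows "prod f {..<2 * k} = (\<Prod>t<k. f t * f (2 * k - 1 - t))"
proof -
  have "{..<2 * k} = {..<k} \<union> {k..<2 * k}" by auto
  then have "prod f {..<2 * k} = prod f {..<k} * prod f {k..<2 * k}" by (simp add: prod.union_disjoint ivl_disj_int)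
  also have "prod f {k..<2 * k} = (\<Prod>t<k. f (2 * k - 1 - t))"
    by (rule prod.reindex_bij_witness[of _ "\<lambda>t. 2 * k - 1 - t" "\<lambda>t. 2 * k - 1 - t"]) auto
  finally show ?thesis by (simp add: prod.distrib)
qed

lemma monic_eq_prod_roots:
  fixes P :: "complex poly"
  assumes A: "finite A" "\<And>a. a \<in> A \<Longrightarrow> poly P a = 0" and P: "lead_coeff P = 1" "degree P = card A"
  shows "poly P x = (\<Prod>a\<in>A. x - a)"
proof -
  define R where "R = (\<Prod>a\<in>A. [:- a, 1:])"
  have dR: "degree R = card A" unfolding R_def by (simp add: degree_prod_sum_eq)
  have lR: "lead_coeff R = 1" unfolding R_def lead_coeff_prod by simp
  have "P - R = 0"
  proof (rule ccontr)
    assume nz: "P - R \<noteq> 0"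
    have "coeff (P - R) (card A) = 0" using P dR lR by simp
    moreover have "degree (P - R) \<le> card A" using P dR by (intro degree_diff_le) auto
    ultimately have less: "degree (P - R) < card A"
      using nz by (metis le_neq_implies_less leading_coeff_0_iff)
    have "A \<subseteq> {x. poly (P - R) x = 0}"
      using A by (auto simp: R_def poly_prod)
    then have "card A \<le> card {x. poly (P - R) x = 0}" by (intro card_mono poly_roots_finite[OF nz])
    also have "\<dots> \<le> degree (P - R)" using nz by (rule card_poly_roots_bound)
    finally show False using less by simp
  qed
  then have "P = R" by simp
  then show ?thesis by (simp add: R_def poly_prod)
qed

lemma prod_one_minus_zeta:
  assumes n: "n > 0"
  shows "(\<Prod>a\<in>{1..<n}. 1 - zeta n ^ a) = of_nat n"
proof -
  have inj: "inj_on (\<lambda>a. zeta n ^ a) {..<n}"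
  proof -
    have "zeta n ^ k = cis (2 * pi * real k / real n)" for k
      by (simp add: zeta_def Complex.DeMoivre mult_ac)
    then show ?thesis using Complex.bij_betw_roots_unity[OF n] by (simp add: bij_betw_def)
  qed
  define P :: "complex poly" where "P = (\<Sum>i<n. monom 1 i)"
  have pP: "poly P x = (\<Sum>i<n. x ^ i)" for x by (simp add: P_def poly_sum poly_monom)
  have cP: "coeff P i = (if i < n then 1 else 0)" for i by (simp add: P_def coeff_sum)
  have dP: "degree P = n - 1"
    using n by (intro antisym degree_le le_degree) (auto simp: cP)
  have "poly P 1 = (\<Prod>a\<in>(\<lambda>a. zeta n ^ a) ` {1..<n}. 1 - a)"
  proof (rule monic_eq_prod_roots)
    fix x assume "x \<in> (\<lambda>a. zeta n ^ a) ` {1..<n}"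
    then obtain a where a: "x = zeta n ^ a" "1 \<le> a" "a < n" by auto
    then have "x \<noteq> 1" using zeta_power_eq_1_iff[OF n, of a] nat_dvd_not_less[of a n] by auto
    moreover have "x ^ n = 1" by (metis a(1) mult.commute power_mult power_one zeta_power_self[OF n])
    ultimately show "poly P x = 0" unfolding pP by (simp add: sum_gp_strict)
  next
    have "inj_on (\<lambda>a. zeta n ^ a) {1..<n}" using inj by (rule inj_on_subset) auto
    then show "degree P = card ((\<lambda>a. zeta n ^ a) ` {1..<n})" by (simp add: card_image dP)
  qed (use n in \<open>simp_all add: dP cP\<close>)
  moreover have "inj_on (\<lambda>a. zeta n ^ a) {1..<n}" using inj by (rule inj_on_subset) auto
  ultimately show ?thesis by (simp add: prod.reindex pP)
qed

declare Qzeta_add [simp] Qzeta_mult [simp] Qzeta_diff [simp] Qzeta_uminus [simp] Qzeta_power [simp]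
  Qzeta_sum [simp] Qzeta_prod [simp] Qzeta_rpoly' [simp]

lemma cnj_of_rat: "cnj (of_rat c) = of_rat c"
  by (cases c) (simp add: of_rat_rat)

locale lattice_setting =
  fixes l p r m :: nat and lam :: int
  assumes l: "l > 1" "odd l"
    and p: "prime p" and pl: "[p = 1] (mod l)"
    and r: "residue_primroot p r"
    and lam: "[lam * (int r - 1) = 1] (mod int p)"
    and m: "m \<ge> 3"
begin

definition k :: nat where "k = 2 ^ (m - 2)"
definition d :: nat where "d = (p - 1) div l"
definition h :: nat where "h = (p - 1) div 2"
definition N :: nat where "N = p * 2 ^ m"

abbreviation zp :: complex where "zp \<equiv> zeta p"
abbreviation om :: complex where "om \<equiv> zeta (2 ^ m)"
abbreviation E :: "complex set" where "E \<equiv> Qzeta N"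

lemma k_pos: "k > 0" by (simp add: k_def)

lemma four_k: "4 * k = 2 ^ m"
proof -
  have "2 + (m - 2) = m" using m by simp
  then have "(2::nat) ^ (2 + (m - 2)) = 2 ^ m" by (simp only:)
  then show ?thesis by (simp add: power_add k_def)
qed

lemma l_dvd: "l dvd p - 1" using pl cong_to_1_nat by blast

lemma p_gt_2: "p > 2"
proof -
  have "p \<noteq> 2" using l_dvd l by auto
  then show ?thesis using prime_ge_2_nat[OF p] by simp
qed

lemma p_pos [simp]: "p > 0" using p_gt_2 by simp

lemma odd_p: "odd p" using p p_gt_2 prime_odd_nat by blast

lemma dl: "d * l = p - 1" using l_dvd by (simp add: d_def)

lemma even_d: "even d"
proof -
  have "even (d * l)" unfolding dl using odd_p by simp
  then show ?thesis using l by simp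
qed

lemma two_h: "2 * h = p - 1" using odd_p by (simp add: h_def)

lemma h_eq: "h = d div 2 * l"
proof -
  have "2 * h = 2 * (d div 2 * l)" unfolding two_h dl[symmetric] using even_d by simp
  then show ?thesis by simp
qed

lemma d_pos: "d > 0" using dl p_gt_2 by (cases d) auto

lemma h_pos: "h > 0" using two_h p_gt_2 by simp

lemma N_pos [simp]: "N > 0" by (simp add: N_def)

lemma coprime_p_2m: "coprime p (2 ^ m)"
  using odd_p by simp

lemma coprime_r: "coprime r p"
  using r by (simp add: residue_primroot_def coprime_commute)

lemma ord_r: "ord p r = p - 1"
  using r p by (simp add: residue_primroot_def totient_prime)

lemma r_cong: "[i = j] (mod (p - 1)) \<Longrightarrow> [r ^ i = r ^ j] (mod p)"
  using order_divides_expdiff[of p r i j] ord_r coprime_r by (simp add: coprime_commute)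

lemma r_pow_h: "[int r ^ h = - 1] (mod int p)"
proof -
  have "[r ^ (p - 1) = 1] (mod p)" using r_cong[of "p - 1" 0] by (simp add: cong_def)
  then have "[int (r ^ (p - 1)) = int 1] (mod int p)" by (simp only: cong_int_iff)
  then have "[int r ^ (2 * h) = 1] (mod int p)" by (simp add: two_h)
  then have "int p dvd (int r ^ h) ^ 2 - 1" by (simp add: cong_iff_dvd_diff power_mult mult.commute)
  then have "int p dvd (int r ^ h - 1) * (int r ^ h + 1)" by (simp add: power2_eq_square algebra_simps)
  then have "int p dvd int r ^ h - 1 \<or> int p dvd int r ^ h + 1"
    using p by (simp add: prime_dvd_mult_iff)
  moreover have "\<not> int p dvd int r ^ h - 1"
  proof
    assume "int p dvd int r ^ h - 1"
    then have "[int (r ^ h) = int 1] (mod int p)" by (simp add: cong_iff_dvd_diff)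
    then have "[r ^ h = 1] (mod p)" by (simp only: cong_int_iff)
    then have "p - 1 dvd h" using ord_divides ord_r by metis
    then show False using two_h h_pos by (metis dvd_imp_le mult_2 not_add_less1 not_le nat_less_le less_add_same_cancel1)
  qed
  ultimately show ?thesis by (simp add: cong_iff_dvd_diff)
qed

lemma bij_r: "bij_betw (\<lambda>i. r ^ i mod p) {..<p - 1} {1..<p}"
proof -
  have "{0<..<p} = {1..<p}" by auto
  then have t: "totatives p = {1..<p}" unfolding totatives_prime[OF p] .
  have "p > 1" using p_gt_2 by simp
  from residue_primroot_is_generator[OF this r] show ?thesis
    unfolding t totient_prime[OF p] .
qed

text \<open>Every element of the Galois group of \<open>E\<close> acts on \<open>zp\<close> by a power of \<open>r\<close> and on \<open>om\<close> by an
  odd exponent, which gives the indexing of the automorphisms by pairs \<open>(s, t)\<close>.\<close>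

definition A :: "nat \<Rightarrow> nat \<Rightarrow> nat" where
  "A s t = (SOME u. [u = r ^ s] (mod p) \<and> [u = 2 * t + 1] (mod 2 ^ m))"

lemma A: "[A s t = r ^ s] (mod p)" "[A s t = 2 * t + 1] (mod 2 ^ m)"
proof -
  have "\<exists>u. [u = r ^ s] (mod p) \<and> [u = 2 * t + 1] (mod 2 ^ m)"
    using binary_chinese_remainder_nat[OF coprime_p_2m] by blast
  from someI_ex[OF this] show "[A s t = r ^ s] (mod p)" "[A s t = 2 * t + 1] (mod 2 ^ m)"
    by (simp_all add: A_def)
qed

lemma coprime_A: "coprime (A s t) N"
proof -
  have "coprime (A s t) p" using A(1)[of s t] coprime_r by (metis cong_imp_coprime cong_sym coprime_power_left_iff)
  moreover have "coprime (A s t) (2 ^ m)" using A(2)[of s t]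
    by (rule cong_imp_coprime[OF cong_sym]) simp
  ultimately show ?thesis by (simp add: N_def)
qed

lemma A_pos: "A s t > 0"
proof (rule ccontr)
  assume "\<not> A s t > 0"
  then have "N = 1" using coprime_A[of s t] by simp
  then show False using p_gt_2 by (simp add: N_def)
qed

lemma A_eqI: "[r ^ s = r ^ s'] (mod p) \<Longrightarrow> [2 * t + 1 = 2 * t' + 1] (mod 2 ^ m) \<Longrightarrow> [A s t = A s' t'] (mod N)"
  unfolding N_def by (intro coprime_cong_mult_nat coprime_p_2m) (metis A cong_trans cong_sym)+

definition g :: "nat \<Rightarrow> nat \<Rightarrow> complex \<Rightarrow> complex" where "g s t = sigma N (A s t)"

lemmas sigma_facts = N_pos coprime_A A_pos

lemma g_add: "x \<in> E \<Longrightarrow> y \<in> E \<Longrightarrow> g s t (x + y) = g s t x + g s t y"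
  unfolding g_def by (rule sigma_add[OF sigma_facts])

lemma g_mult: "x \<in> E \<Longrightarrow> y \<in> E \<Longrightarrow> g s t (x * y) = g s t x * g s t y"
  unfolding g_def by (rule sigma_mult[OF sigma_facts])

lemma g_of_rat [simp]: "g s t (of_rat c) = of_rat c"
  unfolding g_def by (rule sigma_of_rat[OF sigma_facts])

lemma g_in_E [simp, intro]: "x \<in> E \<Longrightarrow> g s t x \<in> E"
  unfolding g_def by (rule sigma_in_Qzeta[OF sigma_facts])

lemma g_rpoly_zeta: "g s t (rpoly f (zeta N)) = rpoly f (zeta N ^ A s t)"
  unfolding g_def by (rule sigma_rpoly[OF sigma_facts])

lemma g_0 [simp]: "g s t 0 = 0" and g_1 [simp]: "g s t 1 = 1"
  using g_of_rat[of s t 0] g_of_rat[of s t 1] by simp_all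

lemma g_of_int [simp]: "g s t (of_int c) = of_int c"
  using g_of_rat[of s t "of_int c"] by simp

lemma g_of_nat [simp]: "g s t (of_nat c) = of_nat c"
  using g_of_int[of s t "int c"] by simp

lemma g_uminus: "x \<in> E \<Longrightarrow> g s t (- x) = - g s t x"
  using g_add[of x "- x" s t] by (simp add: Qzeta_uminus eq_neg_iff_add_eq_0 add.commute)

lemma g_diff: "x \<in> E \<Longrightarrow> y \<in> E \<Longrightarrow> g s t (x - y) = g s t x - g s t y"
  using g_add[of "x - y" y s t] by (simp add: Qzeta_diff)

lemma g_power: "x \<in> E \<Longrightarrow> g s t (x ^ n) = g s t x ^ n"
  by (induction n) (auto simp: g_mult)

lemma g_sum: "(\<And>i. i \<in> B \<Longrightarrow> f i \<in> E) \<Longrightarrow> g s t (sum f B) = (\<Sum>i\<in>B. g s t (f i))"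
  by (induction B rule: infinite_finite_induct) (auto simp: g_add)

lemma g_prod: "(\<And>i. i \<in> B \<Longrightarrow> f i \<in> E) \<Longrightarrow> g s t (prod f B) = (\<Prod>i\<in>B. g s t (f i))"
  by (induction B rule: infinite_finite_induct) (auto simp: g_mult)

lemma g_rpoly: "x \<in> E \<Longrightarrow> g s t (rpoly f x) = rpoly f (g s t x)"
  unfolding rpoly_eq_sum by (subst g_sum) (auto simp: g_mult g_power)

lemma E_inverse: "x \<in> E \<Longrightarrow> inverse x \<in> E"
  by (rule Qzeta_inverse) simp_all

lemma g_inverse: "x \<in> E \<Longrightarrow> g s t (inverse x) = inverse (g s t x)"
proof (cases "x = 0")
  case False
  assume x: "x \<in> E"
  have "g s t x * g s t (inverse x) = 1"
    using g_mult[OF x E_inverse[OF x], of s t] False by simp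
  then show ?thesis by (metis inverse_unique)
qed simp

lemma g_nonzero: "x \<in> E \<Longrightarrow> x \<noteq> 0 \<Longrightarrow> g s t x \<noteq> 0"
  using g_mult[of x "inverse x" s t] E_inverse[of x] by auto

lemma g_powi: "x \<in> E \<Longrightarrow> g s t (x powi n) = g s t x powi n"
  by (auto simp: power_int_def g_power g_inverse E_inverse)

lemma zp_eq: "zp = zeta N ^ (2 ^ m)"
  using zeta_mult_left[of "2 ^ m" p] by (simp add: N_def mult.commute)

lemma om_eq: "om = zeta N ^ p"
  using zeta_mult_left[of p "2 ^ m"] by (simp add: N_def)

lemma zp_in_E [simp, intro]: "zp \<in> E" and om_in_E [simp, intro]: "om \<in> E"
  unfolding zp_eq om_eq by auto

lemma Qzeta_p_E: "y \<in> Qzeta p \<Longrightarrow> y \<in> E"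
  by (elim QzetaE) auto

lemma g_zetaN: "g s t (zeta N) = zeta N ^ A s t"
  using g_rpoly_zeta[of s t "[:0, 1:]"] by simp

lemma g_zp: "g s t zp = zp ^ r ^ s"
proof -
  have "g s t zp = zp ^ A s t"
    unfolding zp_eq by (simp add: g_power g_zetaN flip: power_mult) (simp add: mult.commute)
  also have "\<dots> = zp ^ r ^ s" by (rule zeta_power_cong) (simp_all add: A)
  finally show ?thesis .
qed

lemma g_om: "g s t om = om ^ (2 * t + 1)"
proof -
  have "g s t om = om ^ A s t"
    unfolding om_eq by (simp add: g_power g_zetaN flip: power_mult) (simp add: mult.commute)
  also have "\<dots> = om ^ (2 * t + 1)" by (rule zeta_power_cong) (simp_all only: A, simp)
  finally show ?thesis .
qed

lemma g_cong: 
  assumes "[s = s'] (mod (p - 1))" "[2 * t + 1 = 2 * t' + 1] (mod 2 ^ m)" "y \<in> E"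
  shows "g s t y = g s' t' y"
  unfolding g_def using assms
  by (intro sigma_cong A_eqI coprime_A A_pos r_cong) auto

lemma g_0_0: "y \<in> E \<Longrightarrow> g 0 0 y = y"
proof -
  have "[A 0 0 = 1] (mod N)"
    unfolding N_def using A[of 0 0] by (intro coprime_cong_mult_nat coprime_p_2m) auto
  then have "zeta N ^ A 0 0 = zeta N" using zeta_power_cong[OF N_pos] by force
  then show "y \<in> E \<Longrightarrow> g 0 0 y = y" by (elim QzetaE) (simp add: g_rpoly_zeta)
qed

lemma g_compose: "y \<in> E \<Longrightarrow> g s t (g s' t' y) = g (s + s') (2 * t * t' + t + t') y"
proof -
  have "[A s t * A s' t' = A (s + s') (2 * t * t' + t + t')] (mod N)"
    unfolding N_def
  proof (intro coprime_cong_mult_nat coprime_p_2m)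
    have "[A s t * A s' t' = r ^ s * r ^ s'] (mod p)" by (intro cong_mult A)
    then show "[A s t * A s' t' = A (s + s') (2 * t * t' + t + t')] (mod p)"
      by (metis A(1) cong_sym cong_trans power_add)
    have "[A s t * A s' t' = (2 * t + 1) * (2 * t' + 1)] (mod 2 ^ m)" by (intro cong_mult A)
    also have "(2 * t + 1) * (2 * t' + 1) = 2 * (2 * t * t' + t + t') + 1" by (simp add: algebra_simps)
    finally show "[A s t * A s' t' = A (s + s') (2 * t * t' + t + t')] (mod 2 ^ m)"
      by (metis A(2) cong_sym cong_trans)
  qed
  then have "zeta N ^ (A s t * A s' t') = zeta N ^ A (s + s') (2 * t * t' + t + t')"
    by (rule zeta_power_cong[OF N_pos])
  then show "y \<in> E \<Longrightarrow> ?thesis"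
    by (elim QzetaE) (simp add: g_rpoly_zeta g_rpoly g_power g_zetaN Qzeta_power flip: power_mult)
qed

lemma cnj_g: "y \<in> E \<Longrightarrow> g h (2 * k - 1) y = cnj y"
proof -
  have "[int (A h (2 * k - 1)) = int (r ^ h)] (mod int p)" using A(1) by (simp only: cong_int_iff)
  then have "[int (A h (2 * k - 1)) = - 1] (mod int p)" using r_pow_h by (metis cong_trans of_nat_power)
  then have "int p dvd int (A h (2 * k - 1) + 1)" by (simp add: cong_iff_dvd_diff add.commute)
  then have "p dvd A h (2 * k - 1) + 1" by (simp only: of_nat_dvd_iff)
  moreover have "2 ^ m dvd A h (2 * k - 1) + 1"
  proof -
    have "[A h (2 * k - 1) + 1 = 2 * (2 * k - 1) + 1 + 1] (mod 2 ^ m)" by (intro cong_add A) simp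
    also have "2 * (2 * k - 1) + 1 + 1 = 2 ^ m" using four_k k_pos by simp
    finally show ?thesis by (simp add: cong_def mod_eq_0_iff_dvd)
  qed
  ultimately have "N dvd A h (2 * k - 1) + 1" unfolding N_def using coprime_p_2m by (rule divides_mult)
  then have "zeta N ^ (A h (2 * k - 1) + 1) = 1" using zeta_power_eq_1_iff[OF N_pos] by blast
  then have "zeta N ^ A h (2 * k - 1) = inverse (zeta N)" by (simp add: field_simps)
  also have "\<dots> = cnj (zeta N)" by (simp add: zeta_def cis_cnj)
  finally have e: "zeta N ^ A h (2 * k - 1) = cnj (zeta N)" .
  have "rpoly f (cnj (zeta N)) = cnj (rpoly f (zeta N))" for f
    by (simp add: rpoly_eq_sum cnj_of_rat)
  then show "y \<in> E \<Longrightarrow> ?thesis" by (elim QzetaE) (simp only: g_rpoly_zeta e)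
qed

lemma aint_g: "aint y \<Longrightarrow> y \<in> E \<Longrightarrow> aint (g s t y)"
proof -
  assume "aint y" and y: "y \<in> E"
  then obtain f :: "int poly" where f: "lead_coeff f = 1" "poly (map_poly of_int f) y = 0"
    unfolding Defs.algebraic_int_def by blast
  have "rpoly (map_poly of_int f) (g s t y) = g s t (rpoly (map_poly of_int f) y)"
    using g_rpoly[OF y] by simp
  then have "poly (map_poly of_int f) (g s t y) = 0" using f(2) by (simp add: rpoly_int_poly)
  then show ?thesis using f(1) unfolding Defs.algebraic_int_def by blast
qed

lemma zeta_N_eq: obtains a b where "zeta N = zp ^ a * om ^ b"
proof -
  obtain u where u: "[u = 1] (mod p)" "[u = 0] (mod 2 ^ m)"
    using binary_chinese_remainder_nat[OF coprime_p_2m] by blast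
  obtain v where v: "[v = 0] (mod p)" "[v = 1] (mod 2 ^ m)"
    using binary_chinese_remainder_nat[OF coprime_p_2m] by blast
  obtain a b where ab: "u = 2 ^ m * a" "v = p * b" using u v by (auto simp: cong_0_iff elim!: dvdE)
  have "[u + v = 1 + 0] (mod p)" "[u + v = 0 + 1] (mod 2 ^ m)" using u v by (intro cong_add; simp)+
  then have "[u + v = 1] (mod N)" unfolding N_def by (intro coprime_cong_mult_nat coprime_p_2m) auto
  then have "zeta N ^ (u + v) = zeta N ^ 1" by (rule zeta_power_cong[OF N_pos])
  then have "zeta N = zp ^ a * om ^ b" by (simp add: ab zp_eq om_eq power_add power_mult)
  then show ?thesis using that by blast
qed

lemma sum_zp_powers: "(\<Sum>s<p - 1. zp ^ (c * r ^ s)) \<in> \<rat>"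
proof -
  have "(\<Sum>s<p - 1. zp ^ (c * r ^ s)) = (\<Sum>s<p - 1. zp ^ (c * (r ^ s mod p)))"
    by (intro sum.cong refl zeta_power_cong cong_mult) (simp_all add: cong_def)
  also have "\<dots> = (\<Sum>u\<in>{1..<p}. zp ^ (c * u))"
    by (rule sum.reindex_bij_betw[OF bij_r])
  also have "\<dots> = (\<Sum>u<p. (zp ^ c) ^ u) - 1"
    using p_pos by (simp add: lessThan_atLeast0 sum.atLeast_Suc_lessThan power_mult)
  also have "\<dots> \<in> \<rat>"
  proof (cases "zp ^ c = 1")
    case False
    have "(zp ^ c) ^ p = 1" by (metis mult.commute p_pos power_mult power_one zeta_power_self)
    then show ?thesis using False by (simp add: sum_gp_strict)
  qed simp
  finally show ?thesis .
qed

lemma sum_om_powers: "(\<Sum>t<2 * k. om ^ (c * (2 * t + 1))) \<in> \<rat>"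
proof -
  have "(\<Sum>t<2 * k. om ^ (c * (2 * t + 1))) = om ^ c * (\<Sum>t<2 * k. (om ^ (2 * c)) ^ t)"
  proof -
    have "c * (2 * t + 1) = c + 2 * c * t" for t by (simp add: algebra_simps)
    then show ?thesis by (simp only: power_add power_mult sum_distrib_left)
  qed
  also have "\<dots> \<in> \<rat>"
  proof (cases "om ^ (2 * c) = 1")
    case True
    then have "(om ^ c) ^ 2 = 1" by (simp add: mult.commute flip: power_mult)
    then have "om ^ c = 1 \<or> om ^ c = - 1" by (simp add: power2_eq_1_iff)
    then show ?thesis unfolding True by auto
  next
    case False
    have "(om ^ (2 * c)) ^ (2 * k) = om ^ (2 ^ m * c)" unfolding four_k[symmetric] by (simp add: mult_ac flip: power_mult)
    also have "\<dots> = 1" by (simp add: power_mult zeta_power_self)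
    finally show ?thesis using False by (simp add: sum_gp_strict)
  qed
  finally show ?thesis .
qed

lemma trace_rational:
  assumes y: "y \<in> E"
  shows "(\<Sum>s<p - 1. \<Sum>t<2 * k. g s t y) \<in> \<rat>"
proof -
  obtain f where f: "y = rpoly f (zeta N)" using y by (rule QzetaE)
  obtain a b where ab: "zeta N = zp ^ a * om ^ b" by (rule zeta_N_eq)
  have gz: "g s t (zeta N ^ i) = zp ^ (a * i * r ^ s) * om ^ (b * i * (2 * t + 1))" for s t i
  proof -
    have "g s t (zeta N ^ i) = ((zp ^ r ^ s) ^ a * (om ^ (2 * t + 1)) ^ b) ^ i"
      unfolding ab by (simp add: g_power g_mult g_zp g_om Qzeta_mult Qzeta_power)
    then show ?thesis by (simp only: power_mult_distrib flip: power_mult) (simp only: mult_ac)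
  qed
  have "(\<Sum>s<p - 1. \<Sum>t<2 * k. g s t y)
      = (\<Sum>s<p - 1. \<Sum>t<2 * k. \<Sum>i\<le>degree f. of_rat (coeff f i) * g s t (zeta N ^ i))"
    unfolding f rpoly_eq_sum by (simp add: g_sum g_mult Qzeta_mult Qzeta_power)
  also have "\<dots> = (\<Sum>s<p - 1. \<Sum>i\<le>degree f. \<Sum>t<2 * k. of_rat (coeff f i) * g s t (zeta N ^ i))"
    by (intro sum.cong refl sum.swap)
  also have "\<dots> = (\<Sum>i\<le>degree f. \<Sum>s<p - 1. \<Sum>t<2 * k. of_rat (coeff f i) * g s t (zeta N ^ i))"
    by (rule sum.swap)
  also have "\<dots> = (\<Sum>i\<le>degree f. of_rat (coeff f i) *
      ((\<Sum>s<p - 1. zp ^ (a * i * r ^ s)) * (\<Sum>t<2 * k. om ^ (b * i * (2 * t + 1)))))"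
    by (simp only: gz sum_product) (simp only: sum_distrib_left)
  also have "\<dots> \<in> \<rat>"
    by (intro Rats_sum Rats_mult sum_zp_powers sum_om_powers) auto
  finally show ?thesis .
qed

end

lemma sum_block:
  fixes f :: "nat \<Rightarrow> 'a :: comm_monoid_add"
  shows "(\<Sum>j<d. \<Sum>s<l. f (j * l + s)) = sum f {..<d * l}"
proof -
  have "(\<Sum>s<l. f (j * l + s)) = sum f {j * l..<j * l + l}" for j
    using sum.shift_bounds_nat_ivl[of f 0 "j * l" l] by (simp add: atLeast0LessThan add.commute)
  then show ?thesis using sum.nat_group[of f l d] by simp
qed

lemma prod_block:
  fixes f :: "nat \<Rightarrow> 'a :: comm_monoid_mult"
  shows "(\<Prod>j<d. \<Prod>s<l. f (j * l + s)) = prod f {..<d * l}"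
proof -
  have "(\<Prod>s<l. f (j * l + s)) = prod f {j * l..<j * l + l}" for j
    using prod.shift_bounds_nat_ivl[of f 0 "j * l" l] by (simp add: atLeast0LessThan add.commute)
  then show ?thesis using prod.nat_group[of f l d] by simp
qed

lemma neg_one_power_square: "(- 1) ^ n * (- 1) ^ n = (1 :: complex)"
  by (simp flip: power_mult_distrib)

lemma sum_alternating: "even n \<Longrightarrow> (\<Sum>j<n. (- 1) ^ j :: complex) = 0"
  by (auto elim!: evenE simp: sum_gp_strict power_mult)

context lattice_setting
begin

text \<open>The element \<open>w\<close> is a square root of \<open>p\<close> or \<open>- p\<close>, and \<open>X s\<close> is the conjugate of \<open>x\<close> under the
  \<open>s\<close>-th power of \<open>\<sigma>\<close>: since \<open>\<sigma>\<close> negates \<open>w\<close> and \<open>l\<close> is odd, the trace defining \<open>x\<close> becomes the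
  alternating sum \<open>S 0\<close>.\<close>

definition e :: "nat \<Rightarrow> complex" where "e i = zp ^ r ^ i"
definition w :: complex where "w = zp powi lam * alpha p r"
definition S :: "nat \<Rightarrow> complex" where "S s = (\<Sum>j<d. (- 1) ^ (j + s) * e (j * l + s))"
definition X :: "nat \<Rightarrow> complex" where "X s = - w * S s"

lemma e_in_E [simp, intro]: "e i \<in> E" by (simp add: e_def)

lemma e_0: "e 0 = zp" by (simp add: e_def)

lemma g_e: "g s t (e i) = e (i + s)"
  by (simp add: e_def g_power g_zp power_add flip: power_mult) (simp add: mult.commute)

lemma e_cong: "[i = j] (mod (p - 1)) \<Longrightarrow> e i = e j"
  unfolding e_def by (intro zeta_power_cong r_cong) simp_all

lemma e_period: "e (i + d * l) = e i"
  by (rule e_cong) (simp add: dl cong_def)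

lemma cnj_zp: "cnj zp = inverse zp"
  by (simp add: zeta_def cis_cnj)

lemma e_h: "e (i + h) = cnj (e i)"
  using cnj_g[of "e i"] by (simp add: g_e)

lemma e_ne_1: "e i \<noteq> 1"
proof
  assume "e i = 1"
  then have "p dvd r ^ i" unfolding e_def using zeta_power_eq_1_iff[of p] by simp
  then have "p dvd r" using p prime_dvd_power by blast
  then show False using coprime_r p by (metis coprime_absorb_right not_prime_unit)
qed

lemma prod_e: "(\<Prod>i<p - 1. 1 - e i) = of_nat p"
proof -
  have "e i = zp ^ (r ^ i mod p)" for i
    unfolding e_def by (rule zeta_power_cong) (simp_all add: cong_def)
  then have "(\<Prod>i<p - 1. 1 - e i) = (\<Prod>i<p - 1. 1 - zp ^ (r ^ i mod p))" by simp
  also have "\<dots> = (\<Prod>a\<in>{1..<p}. 1 - zp ^ a)" by (rule prod.reindex_bij_betw[OF bij_r])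
  finally show ?thesis by (simp only: prod_one_minus_zeta[OF p_pos])
qed

lemma alpha_eq: "alpha p r = (\<Prod>j<h. 1 - e j)"
proof -
  have "{0..(p - 3) div 2} = {..<h}" using h_pos by (auto simp: h_def)
  then show ?thesis by (simp add: alpha_def e_def)
qed

lemma alpha_in_E [simp]: "alpha p r \<in> E"
  unfolding alpha_eq by simp

lemma g_alpha: "g 1 t (alpha p r) = - inverse zp * alpha p r"
proof -
  have "g 1 t (alpha p r) * (1 - e 0) = (\<Prod>j<h. 1 - e (Suc j)) * (1 - e 0)"
    unfolding alpha_eq by (simp add: g_prod g_diff g_e)
  also have "\<dots> = (\<Prod>j<Suc h. 1 - e j)" unfolding prod.lessThan_Suc_shift by (simp add: mult.commute)
  also have "\<dots> = alpha p r * (1 - e h)" by (simp add: alpha_eq)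
  also have "1 - e h = - inverse zp * (1 - e 0)"
    using e_h[of 0] by (simp add: e_0 cnj_zp algebra_simps)
  finally have "g 1 t (alpha p r) * (1 - e 0) = - inverse zp * alpha p r * (1 - e 0)"
    by (simp only: mult_ac)
  moreover have "1 - e 0 \<noteq> 0" using e_ne_1[of 0] by simp
  from mult_right_cancel[OF this] calculation show ?thesis by blast
qed

lemma powi_in_Qzeta [simp]: "n > 0 \<Longrightarrow> x \<in> Qzeta n \<Longrightarrow> x powi a \<in> Qzeta n"
  by (auto simp: power_int_def intro!: Qzeta_power Qzeta_inverse)

lemma w_in_E [simp]: "w \<in> E"
  by (simp add: w_def)

lemma zp_powi_lam: "(zp ^ r) powi lam = zp * zp powi lam"
proof -
  obtain c where "lam * (int r - 1) - 1 = int p * c"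
    using lam by (auto simp: cong_iff_dvd_diff elim: dvdE)
  then have "int r * lam = 1 + lam + int p * c" by (simp add: algebra_simps)
  then have "zp powi (int r * lam) = zp powi 1 * zp powi lam * (zp powi int p) powi c"
    by (simp only: power_int_add power_int_mult zeta_nonzero simp_thms)
  then show ?thesis by (simp add: power_int_mult zeta_power_self)
qed

lemma g_w_1: "g 1 0 w = - w"
proof -
  have "g 1 0 w = (zp ^ r) powi lam * (- inverse zp * alpha p r)"
    unfolding w_def g_mult[OF powi_in_Qzeta[OF N_pos zp_in_E] alpha_in_E] g_powi[OF zp_in_E] g_alpha g_zp
    by simp
  then show ?thesis by (simp add: zp_powi_lam w_def)
qed

lemma g_w: "g s t w = (- 1) ^ s * w"
proof (induction s)
  case 0
  have "g 0 t (alpha p r) = alpha p r"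
    unfolding alpha_eq by (simp add: g_prod g_diff g_e)
  moreover have "g 0 t (zp powi lam) = zp powi lam"
    using g_zp[of 0 t] by (simp add: g_powi)
  ultimately show ?case by (simp add: w_def g_mult)
next
  case (Suc s)
  have "g (Suc s) t w = g 1 0 (g s t w)" by (simp add: g_compose)
  also have "\<dots> = g 1 0 (of_int ((- 1) ^ s) * w)" using Suc by simp
  also have "\<dots> = (- 1) ^ Suc s * w"
    by (subst g_mult) (simp_all only: g_of_int g_w_1, simp_all add: Qzeta_Rats)
  finally show ?case .
qed

lemma w_square: "w * w = (- 1) ^ h * of_nat p"
proof -
  have "cnj (alpha p r) = (\<Prod>j<h. 1 - e (h + j))"
    unfolding alpha_eq by (simp add: e_h[symmetric] add.commute)
  then have "alpha p r * cnj (alpha p r) = (\<Prod>j<h. 1 - e j) * (\<Prod>j<h. 1 - e (1 * h + j))"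
    by (simp add: alpha_eq)
  also have "\<dots> = (\<Prod>i<2 * h. 1 - e i)" using prod_block[of "\<lambda>i. 1 - e i" h 2]
    by (simp add: numeral_2_eq_2)
  finally have a: "alpha p r * cnj (alpha p r) = of_nat p" by (simp only: two_h prod_e)
  have "cmod (zp powi lam) = 1" by (simp add: norm_power_int zeta_def)
  then have z: "zp powi lam * cnj (zp powi lam) = 1" by (subst complex_norm_square[symmetric]) simp
  have "w * cnj w = (zp powi lam * cnj (zp powi lam)) * (alpha p r * cnj (alpha p r))"
    by (simp add: w_def)
  then have "w * cnj w = of_nat p" using a z by simp
  moreover have "cnj w = (- 1) ^ h * w" using cnj_g[of w] g_w by simp
  ultimately have "w * ((- 1) ^ h * w) = of_nat p" by simp
  moreover have "w * w = (- 1) ^ h * (w * ((- 1) ^ h * w))"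
    using neg_one_power_square[of h] by (metis mult.assoc mult.left_commute mult_1)
  ultimately show ?thesis by simp
qed

lemma S_in_E [simp]: "S s \<in> E"
  unfolding S_def by (intro Qzeta_sum Qzeta_mult Qzeta_power Qzeta_uminus) auto

lemma X_in_E [simp]: "X s \<in> E"
  by (simp add: X_def)

lemma g_X: "g s t (X i) = X (i + s)"
proof -
  have "(- 1 :: complex) ^ n \<in> E" for n by (intro Qzeta_power Qzeta_uminus) auto
  then have "g s t (X i) = - ((- 1) ^ s * w) * (\<Sum>j<d. (- 1) ^ (j + i) * e (j * l + (i + s)))"
    unfolding X_def S_def by (simp add: g_mult g_sum g_uminus g_power g_w g_e add.assoc)
  also have "\<dots> = X (i + s)"
    by (simp add: X_def S_def sum_distrib_left power_add mult_ac)
  finally show ?thesis .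
qed

lemma S_period: "S (s + l) = S s"
proof -
  define f where "f j = (- 1) ^ (j + s) * e (j * l + s)" for j
  have "f (j + d) = f j" for j
  proof -
    have "e ((j + d) * l + s) = e (j * l + s)" using e_period[of "j * l + s"] by (simp add: algebra_simps)
    then show ?thesis using even_d by (simp add: f_def power_add)
  qed
  then have "(\<Sum>j<d. f (j + 1)) = sum f {..<d}" by (rule sum_shift_periodic)
  moreover have "S (s + l) = (\<Sum>j<d. f (j + 1))"
    unfolding S_def f_def using l(2) by (intro sum.cong refl) (simp add: power_add algebra_simps)
  ultimately show ?thesis by (simp add: S_def f_def)
qed

lemma X_period: "X (s + l) = X s"
  by (simp add: X_def S_period)

lemma X_mod: "X (s mod l) = X s"
proof -
  have "X (s + n * l) = X s" for s n
    by (induction n) (simp_all add: X_period add.assoc[symmetric] add.commute[of l])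
  from this[of "s mod l" "s div l"] show ?thesis by simp
qed

lemma X_cong: "[s = s'] (mod l) \<Longrightarrow> X s = X s'"
  using X_mod[of s] X_mod[of s'] by (simp add: cong_def)

lemma sum_ee: "(\<Sum>a<p - 1. e a * e (a + v)) = (if [v = h] (mod (p - 1)) then of_nat p else 0) - 1"
proof -
  have "e a * e (a + v) = zp ^ ((1 + r ^ v) * (r ^ a mod p))" for a
  proof -
    have "e a * e (a + v) = zp ^ ((1 + r ^ v) * r ^ a)"
      by (simp add: e_def power_add algebra_simps)
    also have "\<dots> = zp ^ ((1 + r ^ v) * (r ^ a mod p))"
      by (intro zeta_power_cong cong_mult cong_refl) (simp_all add: cong_def)
    finally show ?thesis .
  qed
  then have "(\<Sum>a<p - 1. e a * e (a + v)) = (\<Sum>u\<in>{1..<p}. zp ^ ((1 + r ^ v) * u))"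
    using sum.reindex_bij_betw[OF bij_r, of "\<lambda>u. zp ^ ((1 + r ^ v) * u)"] by simp
  also have "\<dots> = (\<Sum>u\<in>{1..<p}. (zp ^ (1 + r ^ v)) ^ u)" by (simp only: power_mult)
  also have "\<dots> = (\<Sum>u<p. (zp ^ (1 + r ^ v)) ^ u) - 1"
    using p_pos by (simp add: lessThan_atLeast0 sum.atLeast_Suc_lessThan)
  also have "(\<Sum>u<p. (zp ^ (1 + r ^ v)) ^ u) = (if p dvd 1 + r ^ v then of_nat p else 0)"
  proof -
    have "(zp ^ (1 + r ^ v)) ^ p = 1" by (metis mult.commute p_pos power_mult power_one zeta_power_self)
    then show ?thesis using zeta_power_eq_1_iff[OF p_pos, of "1 + r ^ v"] by (auto simp: sum_gp_strict)
  qed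
  also have "p dvd 1 + r ^ v \<longleftrightarrow> [v = h] (mod (p - 1))"
  proof -
    have "p dvd 1 + r ^ v \<longleftrightarrow> int p dvd int (1 + r ^ v)" by (simp only: of_nat_dvd_iff)
    also have "\<dots> \<longleftrightarrow> [int r ^ v = - 1] (mod int p)" by (simp add: cong_iff_dvd_diff add.commute)
    also have "\<dots> \<longleftrightarrow> [int (r ^ v) = int (r ^ h)] (mod int p)"
      using r_pow_h by (metis cong_sym cong_trans of_nat_power)
    also have "\<dots> \<longleftrightarrow> [v = h] (mod (p - 1))"
      using order_divides_expdiff[of p r v h] ord_r coprime_r
      by (simp only: cong_int_iff) (simp add: coprime_commute)
    finally show ?thesis .
  qed
  finally show ?thesis by simp
qed

lemma S_autocorrelation:
  assumes c: "c < l"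
  shows "(\<Sum>s<l. S s * S (s + c)) = (if c = 0 then (- 1) ^ h * of_nat p else 0)"
proof -
  have S_shift: "S (s + c) = (\<Sum>i<d. (- 1) ^ (i + j + s + c) * e (i * l + j * l + s + c))" for s j
  proof -
    define f where "f i = (- 1) ^ (i + s + c) * e (i * l + s + c)" for i
    have "f (i + d) = f i" for i
    proof -
      have "e ((i + d) * l + s + c) = e (i * l + s + c)"
        using e_period[of "i * l + s + c"] by (simp add: algebra_simps)
      then show ?thesis using even_d by (simp add: f_def power_add)
    qed
    then have "(\<Sum>i<d. f (i + j)) = sum f {..<d}" by (rule sum_shift_periodic)
    then show ?thesis by (simp add: S_def f_def algebra_simps)
  qed
  have "(\<Sum>s<l. S s * S (s + c)) = (\<Sum>s<l. \<Sum>j<d. (- 1) ^ (j + s) * e (j * l + s) *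
      (\<Sum>i<d. (- 1) ^ (i + j + s + c) * e (i * l + j * l + s + c)))"
    unfolding S_def[of s for s] S_shift[symmetric] by (simp add: sum_distrib_right S_def[of "s + c" for s])
  also have "\<dots> = (\<Sum>s<l. \<Sum>j<d. \<Sum>i<d. (- 1) ^ (i + c) * (e (j * l + s) * e (j * l + s + (i * l + c))))"
  proof (intro sum.cong refl)
    fix s j
    have "(- 1) ^ (j + s) * e (j * l + s) * ((- 1) ^ (i + j + s + c) * e (i * l + j * l + s + c))
       = (- 1) ^ (i + c) * (e (j * l + s) * e (j * l + s + (i * l + c)))" for i
    proof -
      have sign: "(- 1 :: complex) ^ (j + s) * (- 1) ^ (i + j + s + c) = (- 1) ^ (i + c) * ((- 1) ^ (j + s)) ^ 2"
        by (simp add: power_add power2_eq_square)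
      have one: "((- 1 :: complex) ^ (j + s)) ^ 2 = 1" by (simp flip: power_mult)
      have idx: "i * l + j * l + s + c = j * l + s + (i * l + c)" by simp
      have "(- 1) ^ (j + s) * x * ((- 1) ^ (i + j + s + c) * y)
          = (- 1 :: complex) ^ (j + s) * (- 1) ^ (i + j + s + c) * (x * y)" for x y
        by (simp only: mult_ac)
      then show ?thesis unfolding idx sign one by simp
    qed
    then show "(- 1) ^ (j + s) * e (j * l + s) * (\<Sum>i<d. (- 1) ^ (i + j + s + c) * e (i * l + j * l + s + c))
      = (\<Sum>i<d. (- 1) ^ (i + c) * (e (j * l + s) * e (j * l + s + (i * l + c))))"
      by (simp only: sum_distrib_left)
  qed
  also have "\<dots> = (\<Sum>s<l. \<Sum>i<d. \<Sum>j<d. (- 1) ^ (i + c) * (e (j * l + s) * e (j * l + s + (i * l + c))))"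
    by (intro sum.cong refl sum.swap)
  also have "\<dots> = (\<Sum>i<d. \<Sum>s<l. \<Sum>j<d. (- 1) ^ (i + c) * (e (j * l + s) * e (j * l + s + (i * l + c))))"
    by (rule sum.swap)
  also have "\<dots> = (\<Sum>i<d. \<Sum>j<d. \<Sum>s<l. (- 1) ^ (i + c) * (e (j * l + s) * e (j * l + s + (i * l + c))))"
    by (intro sum.cong refl sum.swap)
  also have "\<dots> = (\<Sum>i<d. (- 1) ^ (i + c) * (\<Sum>a<p - 1. e a * e (a + (i * l + c))))"
    unfolding dl[symmetric] sum_block[symmetric] by (simp add: sum_distrib_left)
  also have "\<dots> = (\<Sum>i<d. (- 1) ^ (i + c) * (if [i * l + c = h] (mod (p - 1)) then of_nat p else 0))
      - (- 1) ^ c * (\<Sum>i<d. (- 1) ^ i)"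
    unfolding sum_ee by (simp add: right_diff_distrib sum_subtractf sum_distrib_left power_add mult.commute)
  also have "(\<Sum>i<d. (- 1) ^ i :: complex) = 0" by (rule sum_alternating[OF even_d])
  also have "(\<Sum>i<d. (- 1) ^ (i + c) * (if [i * l + c = h] (mod (p - 1)) then of_nat p else 0))
     = (\<Sum>i<d. if i = d div 2 \<and> c = 0 then (- 1) ^ h * of_nat p else (0 :: complex))"
  proof (intro sum.cong refl)
    fix i assume i: "i \<in> {..<d}"
    have iff: "[i * l + c = h] (mod (p - 1)) \<longleftrightarrow> i = d div 2 \<and> c = 0"
    proof
      assume a: "[i * l + c = h] (mod (p - 1))"
      have "i * l + c < Suc i * l" using c by simp
      also have "Suc i * l \<le> d * l" using i by (intro mult_le_mono1) simp
      finally have "i * l + c < p - 1" by (simp add: dl)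
      moreover have "h < p - 1" using two_h h_pos by simp
      ultimately have "i * l + c = d div 2 * l" using a unfolding h_eq by (simp add: cong_def)
      then have "(i * l + c) div l = d div 2 * l div l" "(i * l + c) mod l = d div 2 * l mod l" by simp_all
      then show "i = d div 2 \<and> c = 0" using c by simp
    qed (simp add: h_eq)
    have "(- 1 :: complex) ^ (d div 2) = (- 1) ^ h"
      unfolding h_eq using l(2) by (simp add: power_mult mult.commute[of _ l])
    then show "(- 1) ^ (i + c) * (if [i * l + c = h] (mod (p - 1)) then of_nat p else 0)
      = (if i = d div 2 \<and> c = 0 then (- 1) ^ h * of_nat p else (0 :: complex))"
      unfolding iff by auto
  qed
  also have "\<dots> = (if c = 0 then (- 1) ^ h * of_nat p else 0)"
  proof -
    have "d div 2 \<in> {..<d}" using d_pos by simp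
    then show ?thesis by (cases "c = 0") simp_all
  qed
  finally show ?thesis by simp
qed

lemma X_orthogonal:
  "(\<Sum>s<l. X (s + i) * X (s + j)) = (if [i = j] (mod l) then of_nat p ^ 2 else 0)"
proof -
  define c where "c = (j + (l - 1) * i) mod l"
  have c: "c < l" using l by (simp add: c_def)
  have ic: "[i + c = j] (mod l)"
  proof -
    have "i + (j + (l - 1) * i) = j + l * i"
      using l by (cases l) (simp_all add: algebra_simps)
    moreover have "[j + l * i = j] (mod l)" by (simp add: cong_def)
    ultimately have "[i + (j + (l - 1) * i) = j] (mod l)" by (simp only:)
    moreover have "[i + c = i + (j + (l - 1) * i)] (mod l)"
      unfolding c_def by (intro cong_add) (simp_all add: cong_def)
    ultimately show ?thesis by (metis cong_trans)
  qed
  have c0: "c = 0 \<longleftrightarrow> [i = j] (mod l)"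
  proof
    assume "[i = j] (mod l)"
    then have "[i + c = i + 0] (mod l)" using ic by (metis add.right_neutral cong_sym cong_trans)
    then have "[c = 0] (mod l)" by (simp only: cong_add_lcancel_nat)
    then show "c = 0" using c by (simp add: cong_def)
  qed (use ic in simp)
  define f where "f s = X s * X (s + c)" for s
  have "f (s + l) = f s" for s
    using X_period[of s] X_period[of "s + c"] by (simp add: f_def add_ac)
  then have "(\<Sum>s<l. f (s + i)) = sum f {..<l}" by (rule sum_shift_periodic)
  moreover have "f (s + i) = X (s + i) * X (s + j)" for s
  proof -
    have "[s + (i + c) = s + j] (mod l)" using ic by (intro cong_add) simp_all
    then show ?thesis using X_cong by (simp add: f_def add.assoc)
  qed
  ultimately have "(\<Sum>s<l. X (s + i) * X (s + j)) = (\<Sum>s<l. X s * X (s + c))"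
    by (simp only: f_def[abs_def])
  also have "\<dots> = w * w * (\<Sum>s<l. S s * S (s + c))"
    by (simp add: X_def sum_distrib_left mult_ac)
  also have "\<dots> = (if c = 0 then of_nat p ^ 2 else 0)"
  proof (cases "c = 0")
    case True
    have "w * w * ((- 1) ^ h * of_nat p) = ((- 1) ^ h * (- 1) ^ h) * (of_nat p * of_nat p)"
      unfolding w_square by (simp only: mult_ac)
    then show ?thesis unfolding S_autocorrelation[OF c] neg_one_power_square
      using True by (simp add: power2_eq_square)
  qed (simp add: S_autocorrelation[OF c])
  finally show ?thesis unfolding c0 .
qed

lemma sigma_eq_g: "y \<in> Qzeta p \<Longrightarrow> sigma p r y = g 1 t y"
proof -
  have "r > 0" using coprime_r p_gt_2 by (cases r) auto
  then show "y \<in> Qzeta p \<Longrightarrow> ?thesis"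
    using sigma_rpoly[OF p_pos coprime_r] g_zp[of 1 t] by (elim QzetaE) (simp add: g_rpoly)
qed

lemma g_Qzeta_p: "y \<in> Qzeta p \<Longrightarrow> g s t y \<in> Qzeta p"
  by (elim QzetaE) (simp add: g_rpoly g_zp)

lemma sigma_power: "y \<in> Qzeta p \<Longrightarrow> (sigma p r ^^ s) y = g s t y"
proof (induction s)
  case 0
  then show ?case by (elim QzetaE) (simp add: g_rpoly g_zp)
next
  case (Suc s)
  have "sigma p r (g s t y) = g 1 0 (g s t y)" using Suc.prems by (intro sigma_eq_g g_Qzeta_p)
  also have "\<dots> = g (Suc s) t y" using Suc.prems by (simp add: g_compose Qzeta_p_E)
  finally show ?case using Suc by simp
qed

lemma e_in_Qzeta_p [simp]: "e i \<in> Qzeta p"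
  by (simp add: e_def)

lemma w_in_Qzeta_p [simp]: "w \<in> Qzeta p"
  by (simp add: w_def alpha_eq)

lemma X_in_Qzeta_p [simp]: "X s \<in> Qzeta p"
  unfolding X_def S_def by (intro Qzeta_mult Qzeta_sum Qzeta_power Qzeta_uminus) auto

lemma xelt_eq: "xelt p r l lam = X 0"
proof -
  define f where "f j = (- 1) ^ j * (1 - e (j * l))" for j
  have "f (j + d) = f j" for j
    using e_period[of "j * l"] even_d by (simp add: f_def power_add algebra_simps)
  then have *: "(\<Sum>j<d. f (j + 1)) = sum f {..<d}" by (rule sum_shift_periodic)
  have z: "zelt p r lam = w * (1 - e 0)" by (simp add: zelt_def w_def e_0)
  have "(sigma p r ^^ (j * l)) (zelt p r lam) = w * f j" for j
  proof -
    have "(sigma p r ^^ (j * l)) (zelt p r lam) = g (j * l) 0 (w * (1 - e 0))"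
      unfolding z by (intro sigma_power) simp
    also have "\<dots> = (- 1) ^ (j * l) * w * (1 - e (j * l))"
      by (simp add: g_mult g_diff g_e g_w)
    also have "(- 1 :: complex) ^ (j * l) = (- 1) ^ j"
      using l(2) by (simp add: power_mult mult.commute[of _ l])
    finally show ?thesis by (simp add: f_def mult_ac)
  qed
  then have "xelt p r l lam = (\<Sum>j = 1..d. w * f j)"
    by (simp add: xelt_def d_def)
  also have "\<dots> = w * (\<Sum>j<d. f (j + 1))"
    by (simp add: sum.atLeast1_atMost_eq sum_distrib_left)
  also have "\<dots> = w * ((\<Sum>j<d. (- 1) ^ j) - (\<Sum>j<d. (- 1) ^ j * e (j * l)))"
    unfolding * by (simp add: f_def right_diff_distrib sum_subtractf)
  also have "\<dots> = X 0"
    using sum_alternating[OF even_d] by (simp add: X_def S_def)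
  finally show ?thesis .
qed

lemma sigma_xelt: "(sigma p r ^^ s) (xelt p r l lam) = X s"
  unfolding xelt_eq using sigma_power[of "X 0" s 0] by (simp add: g_X)

lemma X_in_Kfield: "X s \<in> Kfield p r l"
  unfolding Kfield_def using sigma_power[of "X s" l 0] by (simp add: g_X X_period)

lemma aint_e [simp, intro]: "aint (e i)"
  unfolding e_def by auto

lemma aint_zp_powi [simp]: "aint (zp powi a)"
proof -
  have "(zp powi a) ^ p = 1"
    by (metis mult.commute p_pos power_int_1_left power_int_mult power_int_of_nat zeta_power_self)
  then show ?thesis using aint_root_of_unity[OF p_pos] by blast
qed

lemma aint_w [simp]: "aint w"
  unfolding w_def alpha_eq by (intro aint_mult aint_prod aint_diff) auto

lemma aint_neg_one_power [simp]: "aint ((- 1) ^ n)"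
  by (intro aint_power aint_uminus) simp

lemma aint_X [simp]: "aint (X s)"
  unfolding X_def S_def by (intro aint_mult aint_sum aint_uminus) auto

lemma X_nonzero: "X s \<noteq> 0"
proof
  assume s: "X s = 0"
  have "X i = 0" for i
  proof -
    have "g i 0 (X s) = 0" using s by simp
    then have *: "X (s + i) = 0" for i using g_X[of i 0 s] s by simp
    have "[s + (i + (l - 1) * s) = i] (mod l)"
    proof -
      have "s + (i + (l - 1) * s) = i + l * s" using l by (cases l) (simp_all add: algebra_simps)
      moreover have "[i + l * s = i] (mod l)" by (simp add: cong_def)
      ultimately show ?thesis by (simp only:)
    qed
    then show "X i = 0" using * X_cong by metis
  qed
  then show False using X_orthogonal[of 0 0] p_pos by simp
qed

text \<open>The quotient of \<open>e i - 1\<close> by \<open>zp - 1\<close> is a geometric sum.\<close>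

lemma one_minus_zp_dvd_S: "aint (S s / (1 - zp))"
proof -
  have "(\<Sum>j<d. (- 1 :: complex) ^ (j + s)) = (\<Sum>j<d. (- 1) ^ j) * (- 1) ^ s"
    by (simp add: power_add sum_distrib_right)
  then have "S s = (\<Sum>j<d. (- 1) ^ (j + s) * (e (j * l + s) - 1))"
    using sum_alternating[OF even_d] by (simp add: S_def right_diff_distrib sum_subtractf)
  moreover have "e i - 1 = (1 - zp) * (- (\<Sum>u<r ^ i. zp ^ u))" for i
  proof -
    have "zp \<noteq> 1" using e_ne_1[of 0] by (simp add: e_0)
    then show ?thesis by (simp add: e_def sum_gp_strict field_simps)
  qed
  ultimately have "S s = (1 - zp) * (\<Sum>j<d. (- 1) ^ (j + s) * (- (\<Sum>u<r ^ (j * l + s). zp ^ u)))"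
    by (simp add: sum_distrib_left mult_ac)
  moreover have "1 - zp \<noteq> 0" using e_ne_1[of 0] by (simp add: e_0)
  ultimately have "S s / (1 - zp) = (\<Sum>j<d. (- 1) ^ (j + s) * (- (\<Sum>u<r ^ (j * l + s). zp ^ u)))" by simp
  also have "aint \<dots>" by (intro aint_sum aint_mult aint_uminus aint_power) auto
  finally show ?thesis .
qed

lemma dvd_of_one_minus_zp:
  assumes "aint (of_int n / (1 - zp))"
  shows "int p dvd n"
proof -
  have z: "1 - zp \<noteq> 0" using e_ne_1[of 0] by (simp add: e_0)
  have in_E: "of_int n / (1 - zp) \<in> E"
    unfolding divide_inverse by (intro Qzeta_mult E_inverse) (auto intro: Qzeta_Rats)
  have "(\<Prod>i<p - 1. g i 0 (of_int n / (1 - zp))) = (\<Prod>i<p - 1. of_int n / (1 - e i))"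
  proof (intro prod.cong refl)
    fix i
    have "g i 0 (of_int n / (1 - zp)) * g i 0 (1 - zp) = of_int n"
      using z in_E by (subst g_mult[symmetric]) auto
    moreover have "g i 0 (1 - zp) = 1 - e i" using g_e[of i 0 0] by (simp add: g_diff e_0)
    ultimately show "g i 0 (of_int n / (1 - zp)) = of_int n / (1 - e i)"
      using e_ne_1[of i] by (simp add: field_simps)
  qed
  also have "\<dots> = of_int (n ^ (p - 1)) / of_int (int p)"
    unfolding prod_dividef prod_e by simp
  finally have "aint (of_int (n ^ (p - 1)) / of_int (int p))"
    using aint_prod[of "{..<p - 1}" "\<lambda>i. g i 0 (of_int n / (1 - zp))"] aint_g[OF assms in_E] by simp
  then have "int p dvd n ^ (p - 1)" by (rule aint_divide_int) simp
  then show ?thesis using p prime_dvd_power by (metis prime_nat_int_transfer)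
qed

end

lemma mult_pi_divide_less:
  fixes a b :: real
  assumes "0 < b" "a < b"
  shows "a * pi / b < pi"
proof -
  have "a / b * pi < 1 * pi" using assms by (intro mult_strict_right_mono) simp_all
  then show ?thesis by simp
qed

lemma sum_cos_odd:
  fixes y :: real
  assumes "sin y \<noteq> 0" "sin (2 * real k * y) = 0"
  shows "(\<Sum>t<k. cos ((2 * real t + 1) * y)) = 0"
proof -
  have "2 * sin y * (\<Sum>t<k. cos ((2 * real t + 1) * y)) = sin (2 * real k * y)"
  proof (induction k)
    case (Suc k)
    have "2 * sin y * cos ((2 * real k + 1) * y) = sin (2 * real (Suc k) * y) - sin (2 * real k * y)"
    proof -
      have "2 * real (Suc k) * y = (2 * real k + 1) * y + y" "2 * real k * y = (2 * real k + 1) * y - y"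
        by (simp_all add: algebra_simps)
      then show ?thesis by (simp only: sin_add sin_diff) simp
    qed
    then show ?case using Suc by (simp add: distrib_left)
  qed simp
  then show ?thesis using assms by simp
qed

fun U :: "nat \<Rightarrow> int poly" where
  "U 0 = 1"
| "U (Suc 0) = [:1, 1:]"
| "U (Suc (Suc j)) = [:0, 1:] * U (Suc j) - U j"

lemma sin_mult_U:
  fixes y :: real
  shows "sin y * poly (map_poly of_int (U j)) (2 * cos (2 * y)) = sin ((2 * real j + 1) * y)"
proof (induction j rule: U.induct)
  case 2
  have "sin (3 * y) = sin (2 * y + y)" by simp
  also have "\<dots> = sin (2 * y) * cos y + cos (2 * y) * sin y" by (rule sin_add)
  also have "\<dots> = sin y * (1 + 2 * cos (2 * y))"
  proof -
    have "2 * s * c * c + (c * c - s * s) * s = s * (1 + 2 * (c * c - s * s))"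
      if "s * s + c * c = 1" for s c :: real
    proof -
      have "2 * s * c * c + (c * c - s * s) * s - s * (1 + 2 * (c * c - s * s)) = s * (s * s + c * c - 1)"
        by (simp add: algebra_simps)
      then show ?thesis using that by simp
    qed
    from this[of "sin y" "cos y"] show ?thesis
      unfolding sin_double cos_double power2_eq_square using sin_cos_squared_add[of y]
      by (simp add: power2_eq_square)
  qed
  finally show ?case by (simp add: algebra_simps)
next
  case (3 j)
  let ?u = "(2 * real j + 3) * y"
  have "(2 * real (Suc (Suc j)) + 1) * y = ?u + 2 * y" "(2 * real j + 1) * y = ?u - 2 * y"
    "(2 * real (Suc j) + 1) * y = ?u" by (simp_all add: algebra_simps)
  then have "sin ((2 * real (Suc (Suc j)) + 1) * y)
      = 2 * cos (2 * y) * sin ((2 * real (Suc j) + 1) * y) - sin ((2 * real j + 1) * y)"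
    by (simp only: sin_add sin_diff) simp
  also have "\<dots> = 2 * cos (2 * y) * (sin y * poly (map_poly of_int (U (Suc j))) (2 * cos (2 * y)))
      - sin y * poly (map_poly of_int (U j)) (2 * cos (2 * y))"
    unfolding 3 ..
  also have "\<dots> = sin y * poly (map_poly of_int (U (Suc (Suc j)))) (2 * cos (2 * y))"
    by (simp add: of_int_poly_hom.hom_minus of_int_poly_hom.hom_mult of_int_hom.map_poly_pCons_hom algebra_simps)
  finally show ?case by simp
qed simp

context lattice_setting
begin

text \<open>The \<open>F j t\<close> are the values of the Dirichlet kernels at the conjugates \<open>th t\<close> of \<open>\<theta>\<close>; their
  orthogonality is that of the discrete sine transform of type IV.\<close>

definition ang :: "nat \<Rightarrow> real" where "ang t = (2 * real t + 1) * pi / 2 ^ m"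
definition th :: "nat \<Rightarrow> real" where "th t = 2 * cos (2 * ang t)"
definition F :: "nat \<Rightarrow> nat \<Rightarrow> real" where "F j t = poly (map_poly of_int (U j)) (th t)"

lemma theta_eq: "theta m = th 0"
  by (simp add: theta_def th_def ang_def)

lemma four_k_real: "2 ^ m = 4 * real k"
  using arg_cong[OF four_k, of real] by simp

lemma ang_eq: "ang t = (2 * real t + 1) * pi / (4 * real k)"
  unfolding ang_def four_k_real ..

lemma sin_ang_pos: "t < k \<Longrightarrow> sin (ang t) > 0"
proof (rule sin_gt_zero)
  assume t: "t < k"
  show "0 < ang t" using k_pos by (simp add: ang_eq)
  have "2 * real t + 1 < 4 * real k" using t by simp
  then show "ang t < pi" unfolding ang_eq using k_pos by (intro mult_pi_divide_less) simp_all
qed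

lemma th_sin: "2 - th t = 4 * sin (ang t) ^ 2"
  unfolding th_def cos_double_sin by simp

lemma th_bound: "t < k \<Longrightarrow> th t < 2"
  using th_sin[of t] zero_less_power[OF sin_ang_pos[of t], of 2] by linarith

lemma sin_F: "sin (ang t) * F j t = sin ((2 * real j + 1) * ang t)"
  unfolding F_def th_def by (rule sin_mult_U)

lemma sin_ang_sym: "sin ((2 * real i + 1) * ang t) = sin ((2 * real t + 1) * ang i)"
  by (simp add: ang_eq algebra_simps)

lemma sin_orthogonal:
  assumes "i < k" "j < k"
  shows "(\<Sum>t<k. 4 * sin ((2 * real i + 1) * ang t) * sin ((2 * real j + 1) * ang t))
    = (if i = j then 2 * real k else 0)"
proof -
  define D where "D = (real i - real j) * pi / (2 * real k)"
  define B where "B = (real i + real j + 1) * pi / (2 * real k)"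
  have prod: "4 * sin ((2 * real i + 1) * ang t) * sin ((2 * real j + 1) * ang t)
    = 2 * cos ((2 * real t + 1) * D) - 2 * cos ((2 * real t + 1) * B)" for t
  proof -
    have "(2 * real t + 1) * D = (2 * real i + 1) * ang t - (2 * real j + 1) * ang t"
      "(2 * real t + 1) * B = (2 * real i + 1) * ang t + (2 * real j + 1) * ang t"
      using k_pos by (simp_all add: D_def B_def ang_eq field_simps)
    then show ?thesis by (simp only: cos_add cos_diff) simp
  qed
  have sB: "(\<Sum>t<k. cos ((2 * real t + 1) * B)) = 0"
  proof (rule sum_cos_odd)
    have "0 < B" using k_pos by (simp add: B_def)
    moreover have "real i + real j + 1 < 2 * real k" using assms by linarith
    then have "B < pi" unfolding B_def using k_pos by (intro mult_pi_divide_less) simp_all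
    ultimately show "sin B \<noteq> 0" using sin_gt_zero by force
    have "2 * real k * B = real (i + j + 1) * pi" using k_pos by (simp add: B_def)
    then show "sin (2 * real k * B) = 0" by (simp only: sin_npi)
  qed
  have sD: "(\<Sum>t<k. cos ((2 * real t + 1) * D)) = 0" if "i \<noteq> j"
  proof (rule sum_cos_odd)
    have "\<bar>real i - real j\<bar> < 2 * real k" using assms by linarith
    then have "\<bar>real i - real j\<bar> * pi / (2 * real k) < pi" using k_pos by (intro mult_pi_divide_less) simp_all
    then have "\<bar>D\<bar> < pi" by (simp add: D_def abs_mult)
    moreover have "D \<noteq> 0" using that k_pos by (simp add: D_def)
    ultimately show "sin D \<noteq> 0" using sin_eq_0_pi by fastforce
    have "2 * real k * D = of_int (int i - int j) * pi" using k_pos by (simp add: D_def)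
    then show "sin (2 * real k * D) = 0" unfolding sin_zero_iff_int2 by blast
  qed
  show ?thesis
  proof (cases "i = j")
    case True
    then have "D = 0" by (simp add: D_def)
    then show ?thesis unfolding prod using sB True by (simp add: sum_subtractf flip: sum_distrib_left)
  next
    case False
    then show ?thesis unfolding prod using sB sD by (simp add: sum_subtractf flip: sum_distrib_left)
  qed
qed

lemma F_orthogonal:
  assumes "i < k" "j < k"
  shows "(\<Sum>t<k. (2 - th t) * F i t * F j t) = (if i = j then 2 * real k else 0)"
proof -
  have "(2 - th t) * F i t * F j t = 4 * (sin (ang t) * F i t) * (sin (ang t) * F j t)" for t
    by (simp add: th_sin power2_eq_square)
  then show ?thesis unfolding sin_F using sin_orthogonal[OF assms] by simp
qed

lemma F_orthogonal':
  assumes "t < k" "t' < k"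
  shows "(\<Sum>j<k. (2 - th t) * F j t * F j t') = (if t = t' then 2 * real k else 0)"
proof -
  have "sin (ang t') * (\<Sum>j<k. (2 - th t) * F j t * F j t')
      = sin (ang t) * (\<Sum>j<k. 4 * (sin (ang t) * F j t) * (sin (ang t') * F j t'))"
    by (simp add: th_sin power2_eq_square sum_distrib_left mult_ac)
  also have "\<dots> = sin (ang t) * (if t = t' then 2 * real k else 0)"
    unfolding sin_F sin_ang_sym[of _ t] sin_ang_sym[of _ t'] using sin_orthogonal[OF assms] by simp
  finally show ?thesis using sin_ang_pos[OF assms(1)] sin_ang_pos[OF assms(2)] by (auto split: if_splits)
qed

lemma of_real_th: "of_real (th t) = om ^ (2 * t + 1) + inverse (om ^ (2 * t + 1))"
proof -
  have "om ^ (2 * t + 1) = cis (2 * ang t)"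
    unfolding zeta_def Complex.DeMoivre by (simp add: ang_def algebra_simps)
  then show ?thesis by (simp only: cis_inverse) (simp add: th_def complex_eq_iff)
qed

lemma th_in_E [simp]: "of_real (th t) \<in> E"
  unfolding of_real_th by (intro Qzeta_add E_inverse) auto

lemma g_theta: "g s t (of_real (th 0)) = of_real (th t)"
  unfolding of_real_th by (simp add: g_add g_inverse E_inverse g_om)

lemma aint_th [simp]: "aint (of_real (th t))"
proof -
  have "(om ^ (2 * t + 1)) ^ (2 ^ m) = 1" 
    by (metis mult.commute power_mult power_one zeta_power_self zero_less_numeral zero_less_power)
  moreover from this have "inverse (om ^ (2 * t + 1)) ^ (2 ^ m) = 1" by (simp only: power_inverse inverse_1)
  ultimately show ?thesis unfolding of_real_th
    by (intro aint_add aint_root_of_unity[of "2 ^ m"]) simp_all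
qed

lemma of_real_F: "of_real (F j t) = poly (map_poly of_int (U j)) (of_real (th t))"
  by (simp add: F_def poly_altdef)

lemma of_real_F_rpoly: "of_real (F j t) = rpoly (map_poly of_int (U j)) (of_real (th t))"
  unfolding of_real_F rpoly_int_poly ..

lemma F_in_E [simp]: "of_real (F j t) \<in> E"
  unfolding of_real_F_rpoly by simp

lemma aint_F [simp]: "aint (of_real (F j t))"
  unfolding of_real_F by (rule aint_poly) simp

lemma g_F: "g s t (of_real (F j 0)) = of_real (F j t)"
  unfolding of_real_F_rpoly by (simp add: g_rpoly g_theta)

lemma th_reflect: "t < 2 * k \<Longrightarrow> th (2 * k - 1 - t) = th t"
proof -
  assume "t < 2 * k"
  then have "2 * ang (2 * k - 1 - t) = 2 * pi - 2 * ang t"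
    using k_pos by (simp add: ang_eq of_nat_diff field_simps)
  then show ?thesis by (simp add: th_def cos_diff)
qed

text \<open>Hence every conjugate of \<open>th 0\<close> lies in the ring generated by \<open>th 0\<close>.\<close>

lemma th_eq_F: "th t = F (2 * t + 1) 0 - F (2 * t) 0"
proof -
  have "ang t = (2 * real t + 1) * ang 0" by (simp add: ang_eq)
  then have "sin (ang 0) * th t = sin (ang 0) * (2 * cos (2 * ((2 * real t + 1) * ang 0)))" by (simp add: th_def)
  also have "\<dots> = sin ((2 * real (2 * t + 1) + 1) * ang 0) - sin ((2 * real (2 * t) + 1) * ang 0)"
  proof -
    have "(2 * real (2 * t + 1) + 1) * ang 0 = 2 * ((2 * real t + 1) * ang 0) + ang 0"
      "(2 * real (2 * t) + 1) * ang 0 = 2 * ((2 * real t + 1) * ang 0) - ang 0"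
      by (simp_all add: algebra_simps)
    then show ?thesis by (simp only: sin_add sin_diff) simp
  qed
  also have "\<dots> = sin (ang 0) * (F (2 * t + 1) 0 - F (2 * t) 0)"
    unfolding sin_F[symmetric] by (simp only: right_diff_distrib)
  finally show ?thesis using sin_ang_pos[OF k_pos] by simp
qed

lemma prod_two_minus_th: "(\<Prod>t<k. 2 - th t) = 2"
proof -
  let ?z = "\<lambda>t. om ^ (2 * t + 1)"
  define P :: "complex poly" where "P = monom 1 (2 * k) + 1"
  have om_sq: "om ^ (2 * k) = - 1"
  proof -
    have "real (2 * k) * (2 * pi / 2 ^ m) = pi" using k_pos unfolding four_k_real by simp
    then have "om ^ (2 * k) = cis pi" by (simp only: zeta_def Complex.DeMoivre of_nat_power of_nat_numeral)
    then show ?thesis by simp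
  qed
  have inj: "inj_on ?z {..<2 * k}"
  proof (rule inj_onI)
    fix a b assume ab: "a \<in> {..<2 * k}" "b \<in> {..<2 * k}" "?z a = ?z b"
    have "\<And>x. om ^ x = cis (2 * pi * real x / real (2 ^ m))"
      by (simp add: zeta_def Complex.DeMoivre mult_ac)
    then have "inj_on (\<lambda>x. om ^ x) {..<2 ^ m}"
      using Complex.bij_betw_roots_unity[of "2 ^ m"] by (simp add: bij_betw_def)
    moreover have "2 * a + 1 < 2 ^ m" "2 * b + 1 < 2 ^ m" using ab(1,2) four_k by auto
    ultimately have "2 * a + 1 = 2 * b + 1" using ab(3) by (intro inj_onD[of "\<lambda>x. om ^ x" "{..<2 ^ m}"]) simp_all
    then show "a = b" by simp
  qed
  have dP: "degree P = 2 * k"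
    using k_pos unfolding P_def by (subst degree_add_eq_left) (simp_all add: degree_monom_eq)
  have "poly P 1 = (\<Prod>a\<in>?z ` {..<2 * k}. 1 - a)"
  proof (rule monic_eq_prod_roots)
    fix a assume "a \<in> ?z ` {..<2 * k}"
    then obtain t where "a = ?z t" by blast
    then have "a ^ (2 * k) = (om ^ (2 * k)) ^ (2 * t + 1)" by (simp only: mult.commute flip: power_mult)
    then have "a ^ (2 * k) = - 1" by (simp add: om_sq)
    then show "poly P a = 0" by (simp add: P_def poly_monom)
  next
    show "degree P = card (?z ` {..<2 * k})" using inj by (simp add: card_image dP)
    show "lead_coeff P = 1" unfolding dP using k_pos by (simp add: P_def)
  qed simp
  then have "2 = (\<Prod>t<2 * k. 1 - ?z t)" using inj by (simp only: prod.reindex) (simp add: P_def poly_monom)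
  also have "\<dots> = (\<Prod>t<k. (1 - ?z t) * (1 - ?z (2 * k - 1 - t)))" by (rule prod_fold_reflect)
  also have "\<dots> = (\<Prod>t<k. of_real (2 - th t))"
  proof (rule prod.cong[OF refl])
    fix t assume t: "t \<in> {..<k}"
    have "?z t * ?z (2 * k - 1 - t) = om ^ (2 ^ m)"
      unfolding power_add[symmetric] using t four_k by (intro arg_cong[of _ _ "\<lambda>x. om ^ x"]) auto
    also have "\<dots> = 1" by (rule zeta_power_self) simp
    finally have "inverse (?z t) = ?z (2 * k - 1 - t)" by (rule inverse_unique)
    then show "(1 - ?z t) * (1 - ?z (2 * k - 1 - t)) = of_real (2 - th t)"
      unfolding of_real_diff of_real_th by (simp only: flip: \<open>inverse (?z t) = _\<close>) (simp add: field_simps)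
  qed
  finally have "complex_of_real 2 = of_real (\<Prod>t<k. 2 - th t)" by simp
  then show ?thesis by (simp only: of_real_eq_iff)
qed

end

subsection \<open>Embeddings\<close>

lemma sum_swap_pairs:
  "(\<Sum>i\<in>A. \<Sum>j\<in>B. \<Sum>s\<in>C. \<Sum>t\<in>D. f i j s t) = (\<Sum>s\<in>C. \<Sum>t\<in>D. \<Sum>i\<in>A. \<Sum>j\<in>B. f i j s t)"
proof -
  have "(\<Sum>i\<in>A. \<Sum>j\<in>B. \<Sum>s\<in>C. \<Sum>t\<in>D. f i j s t) = (\<Sum>i\<in>A. \<Sum>s\<in>C. \<Sum>j\<in>B. \<Sum>t\<in>D. f i j s t)"
    by (intro sum.cong refl sum.swap)
  also have "\<dots> = (\<Sum>s\<in>C. \<Sum>i\<in>A. \<Sum>j\<in>B. \<Sum>t\<in>D. f i j s t)" by (rule sum.swap)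
  also have "\<dots> = (\<Sum>s\<in>C. \<Sum>i\<in>A. \<Sum>t\<in>D. \<Sum>j\<in>B. f i j s t)"
    by (intro sum.cong refl sum.swap)
  also have "\<dots> = (\<Sum>s\<in>C. \<Sum>t\<in>D. \<Sum>i\<in>A. \<Sum>j\<in>B. f i j s t)"
    by (intro sum.cong refl sum.swap)
  finally show ?thesis .
qed

lemma characters_independent:
  fixes c :: "('a :: monoid_mult \<Rightarrow> complex) \<Rightarrow> complex" and M :: "'a set"
  assumes "finite G"
    and one: "1 \<in> M" and closed: "\<And>a b. a \<in> M \<Longrightarrow> b \<in> M \<Longrightarrow> a * b \<in> M"
    and "\<And>\<phi> a b. \<phi> \<in> G \<Longrightarrow> a \<in> M \<Longrightarrow> b \<in> M \<Longrightarrow> \<phi> (a * b) = \<phi> a * \<phi> b"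
    and "\<And>\<phi>. \<phi> \<in> G \<Longrightarrow> \<phi> 1 = 1"
    and "\<And>\<phi> \<psi>. \<phi> \<in> G \<Longrightarrow> \<psi> \<in> G \<Longrightarrow> \<phi> \<noteq> \<psi> \<Longrightarrow> \<exists>a\<in>M. \<phi> a \<noteq> \<psi> a"
    and "\<And>y. y \<in> M \<Longrightarrow> (\<Sum>\<phi>\<in>G. c \<phi> * \<phi> y) = 0"
  shows "\<forall>\<phi>\<in>G. c \<phi> = 0"
  using assms(1,4-7)
proof (induction G arbitrary: c rule: finite_induct)
  case (insert \<psi> G)
  have "c \<phi>0 = 0" if \<phi>0: "\<phi>0 \<in> G" for \<phi>0
  proof -
    have "\<phi>0 \<noteq> \<psi>" using \<phi>0 insert.hyps(2) by blast
    then obtain a where a: "a \<in> M" "\<phi>0 a \<noteq> \<psi> a"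
      using insert.prems(3)[of \<phi>0 \<psi>] \<phi>0 by blast
    have "(\<Sum>\<phi>\<in>G. c \<phi> * (\<phi> a - \<psi> a) * \<phi> y) = 0" if y: "y \<in> M" for y
    proof -
      have 1: "c \<psi> * \<psi> (a * y) + (\<Sum>\<phi>\<in>G. c \<phi> * \<phi> (a * y)) = 0"
        using insert.prems(4)[OF closed[OF a(1) y]] insert.hyps by simp
      have 2: "c \<psi> * \<psi> y + (\<Sum>\<phi>\<in>G. c \<phi> * \<phi> y) = 0"
        using insert.prems(4)[OF y] insert.hyps by simp
      have "(\<Sum>\<phi>\<in>G. c \<phi> * (\<phi> a - \<psi> a) * \<phi> y)
          = (\<Sum>\<phi>\<in>G. c \<phi> * \<phi> (a * y)) - \<psi> a * (\<Sum>\<phi>\<in>G. c \<phi> * \<phi> y)"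
        unfolding sum_distrib_left sum_subtractf[symmetric]
        using insert.prems(1)[OF insertI2 a(1) y] by (intro sum.cong refl) (simp add: algebra_simps)
      also have "\<dots> = - (c \<psi> * \<psi> (a * y)) + \<psi> a * (c \<psi> * \<psi> y)"
      proof -
        have "(\<Sum>\<phi>\<in>G. c \<phi> * \<phi> (a * y)) = - (c \<psi> * \<psi> (a * y))"
          "(\<Sum>\<phi>\<in>G. c \<phi> * \<phi> y) = - (c \<psi> * \<psi> y)"
          using 1 2 by (simp_all only: add_eq_0_iff)
        then show ?thesis by simp
      qed
      also have "\<dots> = 0" using insert.prems(1)[OF insertI1 a(1) y] by simp
      finally show ?thesis .
    qed
    then have "\<forall>\<phi>\<in>G. c \<phi> * (\<phi> a - \<psi> a) = 0"
      using insert.prems by (intro insert.IH[of "\<lambda>\<phi>. c \<phi> * (\<phi> a - \<psi> a)"]) blast+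
    then show "c \<phi>0 = 0" using \<phi>0 a(2) by auto
  qed
  then have "\<forall>\<phi>\<in>G. c \<phi> = 0" by blast
  moreover from this have "c \<psi> = 0"
    using insert.prems(4)[OF one] insert.prems(2)[of \<psi>] insert.hyps by simp
  ultimately show ?case by simp
qed simp

context
  fixes K :: "complex set"
  assumes K: "is_subfield K"
begin

lemma subfield_0: "0 \<in> K" and subfield_1: "1 \<in> K"
  and subfield_add: "a \<in> K \<Longrightarrow> b \<in> K \<Longrightarrow> a + b \<in> K"
  and subfield_diff: "a \<in> K \<Longrightarrow> b \<in> K \<Longrightarrow> a - b \<in> K"
  and subfield_mult: "a \<in> K \<Longrightarrow> b \<in> K \<Longrightarrow> a * b \<in> K"
  using K unfolding is_subfield_def by simp_all

lemma subfield_inverse: "a \<in> K \<Longrightarrow> inverse a \<in> K"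
  using K unfolding is_subfield_def by (cases "a = 0") simp_all

lemma subfield_sum: "(\<And>i. i \<in> A \<Longrightarrow> f i \<in> K) \<Longrightarrow> sum f A \<in> K"
  by (induction A rule: infinite_finite_induct) (simp_all add: subfield_0 subfield_add)

lemma subfield_of_nat: "of_nat n \<in> K"
  by (induction n) (simp_all add: subfield_0 subfield_1 subfield_add)

lemma subfield_Rats: "a \<in> \<rat> \<Longrightarrow> a \<in> K"
proof -
  assume "a \<in> \<rat>"
  then obtain q where "a = of_rat q" by (auto elim: Rats_cases)
  obtain u v where uv: "q = of_int u / of_int v" "v > 0"
    by (metis Fract_of_int_quotient quotient_of_denom_pos' quotient_of_div surjective_pairing)
  have int: "of_int z \<in> K" for z
  proof -
    have "of_int z = (of_nat (nat z) - of_nat (nat (- z)) :: complex)" by (cases "z \<ge> 0") simp_all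
    then show ?thesis by (simp add: subfield_diff subfield_of_nat)
  qed
  have "a = of_int u * inverse (of_int v)" using \<open>a = of_rat q\<close> uv by (simp add: of_rat_divide flip: divide_inverse)
  then show "a \<in> K" by (simp add: int subfield_mult subfield_inverse)
qed

context
  fixes \<rho> assumes \<rho>: "\<rho> \<in> embeddings K"
begin

lemma embedding_add: "a \<in> K \<Longrightarrow> b \<in> K \<Longrightarrow> \<rho> (a + b) = \<rho> a + \<rho> b"
  and embedding_mult: "a \<in> K \<Longrightarrow> b \<in> K \<Longrightarrow> \<rho> (a * b) = \<rho> a * \<rho> b"
  and embedding_1: "\<rho> 1 = 1"
  using \<rho> by (simp_all add: embeddings_def)

lemma embedding_0: "\<rho> 0 = 0"
  using embedding_add[OF subfield_0 subfield_0] by simp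

lemma embedding_sum: "(\<And>i. i \<in> A \<Longrightarrow> f i \<in> K) \<Longrightarrow> \<rho> (sum f A) = (\<Sum>i\<in>A. \<rho> (f i))"
  by (induction A rule: infinite_finite_induct) (simp_all add: embedding_0 embedding_add subfield_sum)

lemma embedding_of_nat: "\<rho> (of_nat n) = of_nat n"
  by (induction n) (simp_all add: embedding_0 embedding_1 embedding_add subfield_1 subfield_of_nat)

lemma embedding_Rats: "a \<in> \<rat> \<Longrightarrow> \<rho> a = a"
proof -
  assume "a \<in> \<rat>"
  then obtain q where "a = of_rat q" by (auto elim: Rats_cases)
  obtain u v where uv: "q = of_int u / of_int v" "v > 0"
    by (metis Fract_of_int_quotient quotient_of_denom_pos' quotient_of_div surjective_pairing)
  have int: "\<rho> (of_int z) = of_int z" for z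
  proof -
    have z: "of_int z + of_nat (nat (- z)) = (of_nat (nat z) :: complex)" by (cases "z \<ge> 0") simp_all
    have "\<rho> (of_int z) + of_nat (nat (- z)) = of_nat (nat z)"
      using embedding_add[of "of_int z" "of_nat (nat (- z))"] unfolding z
      by (simp add: subfield_Rats embedding_of_nat)
    then show ?thesis using z by (metis add_right_cancel)
  qed
  have av: "a * of_int v = of_int u" using \<open>a = of_rat q\<close> uv by (simp add: of_rat_divide)
  have "\<rho> a * \<rho> (of_int v) = \<rho> (a * of_int v)"
    by (rule embedding_mult[symmetric]) (simp_all add: subfield_Rats \<open>a \<in> \<rat>\<close>)
  then have "\<rho> a * of_int v = a * of_int v" by (simp only: av int)
  moreover have "complex_of_int v \<noteq> 0" using uv(2) by simp
  ultimately show "\<rho> a = a" by simp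
qed

end

end

context lattice_setting
begin

lemma p_nonzero [simp]: "p \<noteq> 0" using p_gt_2 by simp

definition bet :: "nat \<Rightarrow> real" where "bet t = (1 / real p ^ 2) * (1 / real k - th t / (2 * real k))"
definition B :: "nat \<Rightarrow> nat \<Rightarrow> complex" where "B i j = X i * of_real (F j 0)"
definition co :: "nat \<Rightarrow> nat \<Rightarrow> complex \<Rightarrow> complex" where
  "co i j y = (\<Sum>s<l. \<Sum>t<k. of_real (bet t) * g s t y * (X (i + s) * of_real (F j t)))"

lemma bet_eq: "bet t = (2 - th t) / (2 * real k * real p ^ 2)"
  using k_pos by (simp add: bet_def field_simps)

lemma bet_pos: "t < k \<Longrightarrow> bet t > 0"
  unfolding bet_eq using th_bound[of t] k_pos by (intro divide_pos_pos) simp_all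

lemma g_bet: "g s t (of_real (bet 0)) = of_real (bet t)" and bet_in_E [simp]: "of_real (bet t) \<in> E"
proof -
  have bt: "complex_of_real (bet t) = of_rat (1 / (of_nat p ^ 2 * of_nat k)) - of_rat (1 / (2 * of_nat k * of_nat p ^ 2)) * of_real (th t)" for t
    by (simp add: bet_def of_rat_divide of_rat_mult of_rat_power field_simps)
  show "g s t (of_real (bet 0)) = of_real (bet t)"
    unfolding bt by (simp add: g_diff g_mult g_theta)
  show "of_real (bet t) \<in> E" unfolding bt by simp
qed

lemma B_in_E [simp]: "B i j \<in> E"
  by (simp add: B_def)

lemma g_B: "g s t (B i j) = X (i + s) * of_real (F j t)"
  by (simp add: B_def g_mult g_X g_F)

lemma cong_lt_l: "i < l \<Longrightarrow> j < l \<Longrightarrow> [i = j] (mod l) \<longleftrightarrow> i = j"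
  by (simp add: cong_def)

lemma gram:
  assumes "i < l" "i' < l" "j < k" "j' < k"
  shows "(\<Sum>s<l. \<Sum>t<k. of_real (bet t) * (X (i + s) * of_real (F j t)) * (X (i' + s) * of_real (F j' t)))
    = (if i = i' \<and> j = j' then 1 else 0)"
proof -
  have "(\<Sum>s<l. \<Sum>t<k. of_real (bet t) * (X (i + s) * of_real (F j t)) * (X (i' + s) * of_real (F j' t)))
     = (\<Sum>s<l. X (s + i) * X (s + i')) * (\<Sum>t<k. of_real (bet t * F j t * F j' t))"
    by (simp add: sum_product add.commute mult_ac)
  also have "(\<Sum>t<k. of_real (bet t * F j t * F j' t)) = complex_of_real ((\<Sum>t<k. (2 - th t) * F j t * F j' t) / (2 * real k * real p ^ 2))"
    by (simp add: bet_eq sum_divide_distrib)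
  also have "\<dots> = (if j = j' then 1 / of_nat p ^ 2 else 0)"
    unfolding F_orthogonal[OF assms(3,4)] using k_pos by simp
  finally show ?thesis using assms by (simp add: X_orthogonal cong_lt_l)
qed

lemma dual_gram:
  assumes "s < l" "s' < l" "t < k" "t' < k"
  shows "(\<Sum>i<l. \<Sum>j<k. of_real (bet t) * (X (i + s) * of_real (F j t)) * (X (i + s') * of_real (F j t')))
    = (if s = s' \<and> t = t' then 1 else 0)"
proof -
  have "(\<Sum>i<l. \<Sum>j<k. of_real (bet t) * (X (i + s) * of_real (F j t)) * (X (i + s') * of_real (F j t')))
     = (\<Sum>i<l. X (i + s) * X (i + s')) * (\<Sum>j<k. of_real (bet t * F j t * F j t'))"
    by (simp add: sum_product mult_ac)
  also have "(\<Sum>j<k. of_real (bet t * F j t * F j t')) = complex_of_real ((\<Sum>j<k. (2 - th t) * F j t * F j t') / (2 * real k * real p ^ 2))"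
    by (simp add: bet_eq sum_divide_distrib)
  also have "\<dots> = (if t = t' then 1 / of_nat p ^ 2 else 0)"
    unfolding F_orthogonal'[OF assms(3,4)] using k_pos by simp
  finally show ?thesis using assms by (simp add: X_orthogonal cong_lt_l)
qed

lemma expansion:
  assumes y: "y \<in> E"
  shows "(\<Sum>i<l. \<Sum>j<k. co i j y * B i j) = y"
proof -
  have "(\<Sum>i<l. \<Sum>j<k. co i j y * B i j)
     = (\<Sum>i<l. \<Sum>j<k. \<Sum>s<l. \<Sum>t<k. g s t y * (of_real (bet t) * (X (i + s) * of_real (F j t)) * (X (i + 0) * of_real (F j 0))))"
    by (simp add: co_def B_def sum_distrib_right sum_distrib_left mult_ac)
  also have "\<dots> = (\<Sum>s<l. \<Sum>t<k. \<Sum>i<l. \<Sum>j<k. g s t y * (of_real (bet t) * (X (i + s) * of_real (F j t)) * (X (i + 0) * of_real (F j 0))))"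
    by (rule sum_swap_pairs)
  also have "\<dots> = (\<Sum>s<l. \<Sum>t<k. g s t y * (if s = 0 \<and> t = 0 then 1 else 0))"
    using l k_pos by (intro sum.cong refl) (simp only: sum_distrib_left[symmetric] dual_gram lessThan_iff order.strict_trans[OF zero_less_one])
  also have "\<dots> = (\<Sum>s<l. \<Sum>t<k. if t = 0 then (if s = 0 then g 0 0 y else 0) else 0)"
    by (intro sum.cong refl) auto
  also have "\<dots> = (\<Sum>s<l. if s = 0 then g 0 0 y else 0)" using k_pos by simp
  also have "\<dots> = g 0 0 y" using l by simp
  also have "\<dots> = y" by (rule g_0_0[OF y])
  finally show ?thesis .
qed

text \<open>The compositum, described as the field fixed by generators of the Galois group of \<open>E\<close> over it.\<close>

definition Fx :: "complex set" where "Fx = {y \<in> E. g l 0 y = y \<and> g 0 (2 * k - 1) y = y}"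

lemma FxI: "y \<in> E \<Longrightarrow> g l 0 y = y \<Longrightarrow> g 0 (2 * k - 1) y = y \<Longrightarrow> y \<in> Fx"
  unfolding Fx_def by blast

lemma FxD: "y \<in> Fx \<Longrightarrow> g l 0 y = y" "y \<in> Fx \<Longrightarrow> g 0 (2 * k - 1) y = y"
  unfolding Fx_def by blast+

lemma subfield_Fx: "is_subfield Fx"
  unfolding is_subfield_def Fx_def
  by (auto simp: g_add g_diff g_mult g_inverse E_inverse)

lemma Fx_E [simp]: "y \<in> Fx \<Longrightarrow> y \<in> E"
  unfolding Fx_def by blast

lemma Kfield_Fx: "Kfield p r l \<subseteq> Fx"
proof
  fix y assume "y \<in> Kfield p r l"
  then have y: "y \<in> Qzeta p" "(sigma p r ^^ l) y = y" by (simp_all add: Kfield_def)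
  have "g l 0 y = y" using sigma_power[OF y(1), of l 0] y(2) by simp
  moreover have "g 0 (2 * k - 1) y = y" using sigma_power[OF y(1), of 0 "2 * k - 1"] by simp
  ultimately show "y \<in> Fx" using Qzeta_p_E[OF y(1)] unfolding Fx_def by blast
qed

lemma Lfield_Fx: "Lfield m \<subseteq> Fx"
proof
  fix y assume "y \<in> Lfield m"
  then obtain f where y: "y = rpoly f (of_real (th 0))" unfolding Lfield_def theta_eq by blast
  have "th (2 * k - 1) = th 0" using th_reflect[of 0] k_pos by simp
  then show "y \<in> Fx" unfolding y by (intro FxI) (simp_all add: g_rpoly g_theta)
qed

lemma g_period: "y \<in> Fx \<Longrightarrow> g (s + l) t y = g s t y"
  using g_compose[of y s t l 0] FxD(1)[of y] by simp

lemma g_reflect: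
  assumes "y \<in> Fx" "t < 2 * k"
  shows "g s (2 * k - 1 - t) y = g s t y"
proof -
  have "g s t y = g s t (g 0 (2 * k - 1) y)" by (simp only: FxD(2)[OF assms(1)])
  also have "\<dots> = g s (2 * t * (2 * k - 1) + t + (2 * k - 1)) y" using assms(1) by (simp add: g_compose)
  also have "\<dots> = g s (2 * k - 1 - t) y"
  proof (rule g_cong)
    have "2 * (2 * t * (2 * k - 1) + t + (2 * k - 1)) + 1 = (2 * t + 1) * (4 * k - 1)"
    proof -
      obtain k' where "k = Suc k'" using k_pos by (cases k) auto
      then show ?thesis by (simp add: algebra_simps)
    qed
    also have "\<dots> = 2 * (2 * k - 1 - t) + 1 + 2 * t * (4 * k)"
    proof -
      obtain k' where "k = Suc k'" using k_pos by (cases k) auto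
      then show ?thesis using assms(2) by (simp add: algebra_simps)
    qed
    finally show "[2 * (2 * t * (2 * k - 1) + t + (2 * k - 1)) + 1 = 2 * (2 * k - 1 - t) + 1] (mod 2 ^ m)"
      by (simp add: cong_def four_k)
  qed (use assms in simp_all)
  finally show ?thesis ..
qed

lemma trace_Fx_rational:
  assumes y: "y \<in> Fx"
  shows "(\<Sum>s<l. \<Sum>t<k. g s t y) \<in> \<rat>"
proof -
  have "(\<Sum>s<p - 1. \<Sum>t<2 * k. g s t y) = (\<Sum>s<p - 1. \<Sum>t<k. 2 * g s t y)"
    unfolding sum_fold_reflect using g_reflect[OF y] by (intro sum.cong refl) simp
  also have "\<dots> = of_nat d * (\<Sum>s<l. \<Sum>t<k. 2 * g s t y)"
    unfolding dl[symmetric] by (rule sum_periodic) (simp add: g_period[OF y])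
  also have "\<dots> = of_nat (d * 2) * (\<Sum>s<l. \<Sum>t<k. g s t y)"
    by (simp add: sum_distrib_left mult.assoc)
  finally have "of_nat (d * 2) * (\<Sum>s<l. \<Sum>t<k. g s t y) \<in> \<rat>"
    using trace_rational[of y] y by simp
  then have "of_nat (d * 2) * (\<Sum>s<l. \<Sum>t<k. g s t y) / of_nat (d * 2) \<in> \<rat>"
    by (intro Rats_divide) simp_all
  then show ?thesis using d_pos by simp
qed

lemma X_in_Fx [simp]: "X i \<in> Fx"
  using X_in_Kfield Kfield_Fx by blast

lemma F_in_Lfield: "of_real (F j 0) \<in> Lfield m"
  unfolding of_real_F_rpoly Lfield_def theta_eq by blast

lemma F_in_Fx [simp]: "of_real (F j 0) \<in> Fx"
  using F_in_Lfield Lfield_Fx by blast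

lemma B_in_Fx [simp]: "B i j \<in> Fx"
  unfolding B_def by (intro subfield_mult[OF subfield_Fx]) simp_all

lemma co_trace: "y \<in> E \<Longrightarrow> co i j y = (\<Sum>s<l. \<Sum>t<k. g s t (of_real (bet 0) * y * B i j))"
  unfolding co_def by (simp add: g_mult g_bet g_B)

lemma bet_in_Fx [simp]: "of_real (bet 0) \<in> Fx"
proof -
  have "th (2 * k - 1) = th 0" using th_reflect[of 0] k_pos by simp
  then have "bet (2 * k - 1) = bet 0" by (simp only: bet_def)
  then show ?thesis by (intro FxI) (simp_all only: g_bet bet_in_E)
qed

lemma co_rational: "y \<in> Fx \<Longrightarrow> co i j y \<in> \<rat>"
  unfolding co_trace[OF Fx_E]
  by (intro trace_Fx_rational subfield_mult[OF subfield_Fx]) simp_all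

lemma compositum_eq: "compositum (Kfield p r l) (Lfield m) = Fx"
proof
  show "compositum (Kfield p r l) (Lfield m) \<subseteq> Fx"
    unfolding compositum_def using subfield_Fx Kfield_Fx Lfield_Fx by blast
  show "Fx \<subseteq> compositum (Kfield p r l) (Lfield m)"
    unfolding compositum_def
  proof (intro subsetI InterI)
    fix y K assume y: "y \<in> Fx" and "K \<in> {F. is_subfield F \<and> Kfield p r l \<union> Lfield m \<subseteq> F}"
    then have K: "is_subfield K" "Kfield p r l \<subseteq> K" "Lfield m \<subseteq> K" by auto
    have "B i j \<in> K" for i j
      unfolding B_def using X_in_Kfield F_in_Lfield K(2,3) by (intro subfield_mult[OF K(1)]) blast+
    then have "co i j y * B i j \<in> K" for i j
      by (rule subfield_mult[OF K(1) subfield_Rats[OF K(1) co_rational[OF y]]])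
    then have "(\<Sum>i<l. \<Sum>j<k. co i j y * B i j) \<in> K"
      by (intro subfield_sum[OF K(1)])
    then show "y \<in> K" using expansion y by simp
  qed
qed

definition emb :: "nat \<Rightarrow> nat \<Rightarrow> complex \<Rightarrow> complex" where
  "emb s t y = (if y \<in> Fx then g s t y else 0)"

lemma emb_in_embeddings: "emb s t \<in> embeddings Fx"
  unfolding embeddings_def emb_def
  by (auto simp: g_add g_mult subfield_1[OF subfield_Fx] subfield_add[OF subfield_Fx] subfield_mult[OF subfield_Fx])

lemma emb_inj: "inj_on (\<lambda>(s, t). emb s t) ({..<l} \<times> {..<k})"
proof (rule inj_onI, safe)
  fix s t s' t'
  assume st: "s < l" "s' < l" "t < k" "t' < k" and eq: "emb s t = emb s' t'"
  have "g s t (B i j) = g s' t' (B i j)" for i j using fun_cong[OF eq, of "B i j"] by (simp add: emb_def)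
  then have "X (i + s) * of_real (F j t) = X (i + s') * of_real (F j t')" for i j unfolding g_B .
  then have "(if s = s' \<and> t = t' then 1 else (0 :: complex)) = (if s = s \<and> t = t then 1 else 0)"
    unfolding dual_gram[OF st, symmetric] dual_gram[OF st(1,1,3,3), symmetric] by simp
  then show "s = s'" "t = t'" by (auto split: if_splits)
qed

lemma embeddings_eq: "embeddings Fx = (\<lambda>(s, t). emb s t) ` ({..<l} \<times> {..<k})"
proof
  show "(\<lambda>(s, t). emb s t) ` ({..<l} \<times> {..<k}) \<subseteq> embeddings Fx"
    using emb_in_embeddings by auto
  show "embeddings Fx \<subseteq> (\<lambda>(s, t). emb s t) ` ({..<l} \<times> {..<k})" (is "_ \<subseteq> ?G")
  proof (rule subsetI, rule ccontr)
    fix \<rho> assume \<rho>: "\<rho> \<in> embeddings Fx" and notin: "\<rho> \<notin> ?G"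
    define D where "D s t = (\<Sum>i<l. \<Sum>j<k. of_real (bet t) * (X (i + s) * of_real (F j t)) * \<rho> (B i j))" for s t
    have \<rho>_eq: "\<rho> y = (\<Sum>s<l. \<Sum>t<k. D s t * emb s t y)" if y: "y \<in> Fx" for y
    proof -
      note Fx = subfield_Fx
      have in_Fx: "co i j y * B i j \<in> Fx" for i j
        by (rule subfield_mult[OF Fx subfield_Rats[OF Fx co_rational[OF y]] B_in_Fx])
      have "\<rho> y = \<rho> (\<Sum>i<l. \<Sum>j<k. co i j y * B i j)" using expansion y by simp
      also have "\<dots> = (\<Sum>i<l. \<Sum>j<k. \<rho> (co i j y * B i j))"
        using in_Fx by (simp add: embedding_sum[OF Fx \<rho>] subfield_sum[OF Fx])
      also have "\<dots> = (\<Sum>i<l. \<Sum>j<k. co i j y * \<rho> (B i j))"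
        using co_rational[OF y] by (simp add: embedding_mult[OF Fx \<rho>] subfield_Rats[OF Fx] embedding_Rats[OF Fx \<rho>])
      also have "\<dots> = (\<Sum>i<l. \<Sum>j<k. \<Sum>s<l. \<Sum>t<k. of_real (bet t) * (X (i + s) * of_real (F j t)) * \<rho> (B i j) * emb s t y)"
        using y by (simp add: co_def emb_def sum_distrib_right sum_distrib_left mult_ac)
      also have "\<dots> = (\<Sum>s<l. \<Sum>t<k. \<Sum>i<l. \<Sum>j<k. of_real (bet t) * (X (i + s) * of_real (F j t)) * \<rho> (B i j) * emb s t y)"
        by (rule sum_swap_pairs)
      also have "\<dots> = (\<Sum>s<l. \<Sum>t<k. D s t * emb s t y)"
        unfolding D_def by (simp only: sum_distrib_right)
      finally show ?thesis .
    qed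
    define c where "c \<phi> = (if \<phi> = \<rho> then - 1 else (case the_inv_into ({..<l} \<times> {..<k}) (\<lambda>(s, t). emb s t) \<phi> of (s, t) \<Rightarrow> D s t))" for \<phi>
    have c_emb: "c (emb s t) = D s t" if "s < l" "t < k" for s t
    proof -
      have "emb s t \<noteq> \<rho>" using notin that by auto
      moreover have "the_inv_into ({..<l} \<times> {..<k}) (\<lambda>(s, t). emb s t) (emb s t) = (s, t)"
        using the_inv_into_f_f[OF emb_inj, of "(s, t)"] that by simp
      ultimately show ?thesis by (simp add: c_def)
    qed
    have G_emb: "\<phi> \<in> embeddings Fx" if "\<phi> \<in> insert \<rho> ?G" for \<phi>
      using that \<rho> emb_in_embeddings by auto
    have "\<forall>\<phi>\<in>insert \<rho> ?G. c \<phi> = 0"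
    proof (rule characters_independent)
      show "finite (insert \<rho> ?G)" by simp
      show "1 \<in> Fx" by (rule subfield_1[OF subfield_Fx])
      show "a * b \<in> Fx" if "a \<in> Fx" "b \<in> Fx" for a b using that by (rule subfield_mult[OF subfield_Fx])
      show "\<phi> (a * b) = \<phi> a * \<phi> b" if "\<phi> \<in> insert \<rho> ?G" "a \<in> Fx" "b \<in> Fx" for \<phi> a b
        using embedding_mult[OF subfield_Fx G_emb[OF that(1)] that(2,3)] .
      show "\<phi> 1 = 1" if "\<phi> \<in> insert \<rho> ?G" for \<phi>
        using embedding_1[OF subfield_Fx G_emb[OF that]] .
      show "\<exists>a\<in>Fx. \<phi> a \<noteq> \<psi> a" if "\<phi> \<in> insert \<rho> ?G" "\<psi> \<in> insert \<rho> ?G" "\<phi> \<noteq> \<psi>" for \<phi> \<psi>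
      proof -
        obtain a where a: "\<phi> a \<noteq> \<psi> a" using \<open>\<phi> \<noteq> \<psi>\<close> by blast
        have "a \<in> Fx"
        proof (rule ccontr)
          assume "a \<notin> Fx"
          then have "\<phi> a = 0" "\<psi> a = 0" using G_emb[OF that(1)] G_emb[OF that(2)] by (simp_all add: embeddings_def)
          then show False using a by simp
        qed
        then show ?thesis using a by blast
      qed
      show "(\<Sum>\<phi>\<in>insert \<rho> ?G. c \<phi> * \<phi> y) = 0" if y: "y \<in> Fx" for y
      proof -
        have "(\<Sum>\<phi>\<in>?G. c \<phi> * \<phi> y) = (\<Sum>(s, t)\<in>{..<l} \<times> {..<k}. c (emb s t) * emb s t y)"
          by (subst sum.reindex[OF emb_inj]) (simp add: split_def)
        also have "\<dots> = (\<Sum>(s, t)\<in>{..<l} \<times> {..<k}. D s t * emb s t y)"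
          by (intro sum.cong refl) (auto simp: c_emb)
        also have "\<dots> = \<rho> y" using \<rho>_eq[OF y] by (simp add: sum.cartesian_product)
        finally show ?thesis using notin by (simp add: c_def)
      qed
    qed
    then have "c \<rho> = 0" by blast
    then show False by (simp add: c_def)
  qed
qed

lemma X_real: "X s \<in> \<real>"
proof -
  have "cnj (X s) = X (s + h)" using cnj_g[of "X s"] by (simp add: g_X)
  also have "\<dots> = X s" by (rule X_cong) (simp add: h_eq cong_def)
  finally show ?thesis by (simp add: Reals_cnj_iff)
qed

lemma g_expansion:
  assumes y: "y \<in> Fx"
  shows "g s t y = (\<Sum>i<l. \<Sum>j<k. co i j y * (X (i + s) * of_real (F j t)))"
proof -
  have in_E: "co i j y \<in> E" for i j using co_rational[OF y] by (rule Qzeta_Rats)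
  have "g s t (co i j y) = co i j y" for i j
    using co_rational[OF y, of i j] by (auto elim!: Rats_cases)
  then have "g s t (\<Sum>i<l. \<Sum>j<k. co i j y * B i j) = (\<Sum>i<l. \<Sum>j<k. co i j y * g s t (B i j))"
    using in_E by (simp add: g_sum g_mult)
  then show ?thesis using expansion y by (simp add: g_B)
qed

lemma g_real:
  assumes "y \<in> Fx"
  shows "g s t y \<in> \<real>"
proof -
  have "co i j y \<in> \<real>" for i j
    using co_rational[OF assms, of i j] by (auto elim!: Rats_cases simp: Reals_cnj_iff cnj_of_rat)
  then show ?thesis unfolding g_expansion[OF assms] using X_real by (intro sum_in_Reals Reals_mult) auto
qed

lemma real_embeddings_eq: "real_embeddings Fx = embeddings Fx"
  unfolding real_embeddings_def embeddings_eq using g_real by (auto simp: emb_def)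

lemma sum_real_embeddings: "(\<Sum>\<rho>\<in>real_embeddings Fx. f \<rho>) = (\<Sum>s<l. \<Sum>t<k. f (emb s t))"
  unfolding real_embeddings_eq embeddings_eq
  by (subst sum.reindex[OF emb_inj]) (simp add: split_def sum.cartesian_product)

lemma prod_embeddings: "(\<Prod>\<rho>\<in>embeddings Fx. f \<rho>) = (\<Prod>s<l. \<Prod>t<k. f (emb s t))"
  unfolding embeddings_eq
  by (subst prod.reindex[OF emb_inj]) (simp add: split_def prod.cartesian_product)

lemma card_real_embeddings: "card (real_embeddings Fx) = k * l"
  unfolding real_embeddings_eq embeddings_eq by (simp add: card_image[OF emb_inj])

end

context lattice_setting
begin

subsection \<open>The ring generated by \<open>th 0\<close> is integrally closed\<close>

definition \<pi>0 :: complex where "\<pi>0 = of_real (2 - th 0)"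
definition ZT :: "complex set" where "ZT = {poly (map_poly of_int f) \<pi>0 | f :: int poly. True}"

lemma ZT_poly [intro]: "poly (map_poly of_int f) \<pi>0 \<in> ZT"
  unfolding ZT_def by blast

lemma ZT_E: assumes "y \<in> ZT" obtains f where "y = poly (map_poly of_int f) \<pi>0"
  using assms unfolding ZT_def by blast

lemma ZT_add: "x \<in> ZT \<Longrightarrow> y \<in> ZT \<Longrightarrow> x + y \<in> ZT"
  by (elim ZT_E) (simp flip: poly_add of_int_poly_hom.hom_add add: ZT_poly)

lemma ZT_mult: "x \<in> ZT \<Longrightarrow> y \<in> ZT \<Longrightarrow> x * y \<in> ZT"
  by (elim ZT_E) (simp flip: poly_mult of_int_poly_hom.hom_mult add: ZT_poly)

lemma ZT_of_int: "of_int n \<in> ZT"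
  using ZT_poly[of "[:n:]"] by (simp add: of_int_hom.map_poly_pCons_hom)

lemma ZT_sum: "(\<And>i. i \<in> M \<Longrightarrow> f i \<in> ZT) \<Longrightarrow> sum f M \<in> ZT"
  using ZT_of_int[of 0] by (induction M rule: infinite_finite_induct) (simp_all add: ZT_add)

lemma ZT_prod: "(\<And>i. i \<in> M \<Longrightarrow> f i \<in> ZT) \<Longrightarrow> prod f M \<in> ZT"
  using ZT_of_int[of 1] by (induction M rule: infinite_finite_induct) (simp_all add: ZT_mult)

lemma ZT_power: "x \<in> ZT \<Longrightarrow> x ^ n \<in> ZT"
  using ZT_of_int[of 1] by (induction n) (simp_all add: ZT_mult)

lemma ZT_ipoly: "x \<in> ZT \<Longrightarrow> poly (map_poly of_int f) x \<in> ZT"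
  by (simp add: poly_altdef ZT_sum ZT_mult ZT_of_int ZT_power)

lemma ZT_diff: "x \<in> ZT \<Longrightarrow> y \<in> ZT \<Longrightarrow> x - y \<in> ZT"
  using ZT_add[of x "of_int (- 1) * y"] by (simp add: ZT_mult ZT_of_int del: of_int_minus) (simp)

lemma ZT_th: "of_real (th t) \<in> ZT"
proof -
  have "\<pi>0 \<in> ZT" using ZT_poly[of "[:0, 1:]"] by (simp add: of_int_hom.map_poly_pCons_hom)
  then have "of_int 2 - \<pi>0 \<in> ZT" by (intro ZT_diff ZT_of_int)
  then have "of_real (th 0) \<in> ZT" by (simp add: \<pi>0_def)
  then have "of_real (F j 0) \<in> ZT" for j unfolding of_real_F by (rule ZT_ipoly)
  then show ?thesis unfolding th_eq_F of_real_diff by (intro ZT_diff)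
qed

lemma ZT_F: "of_real (F j t) \<in> ZT"
  unfolding of_real_F by (rule ZT_ipoly[OF ZT_th])

lemma aint_pi0 [simp]: "aint \<pi>0"
proof -
  have "aint (2 - of_real (th 0))" by (intro aint_diff) auto
  then show ?thesis by (simp add: \<pi>0_def)
qed

definition un :: "nat \<Rightarrow> complex" where "un t = (\<Prod>i<k. of_real (F i t) ^ 2)"

lemma two_eq: "2 = of_real (2 - th t) ^ k * un t"
proof -
  have sF: "sin (ang i) = sin (ang 0) * F i 0" for i
    unfolding sin_F by (simp add: ang_eq)
  have "2 - th i = (2 - th 0) * F i 0 ^ 2" for i
    unfolding th_sin sF[of i] power_mult_distrib by simp
  then have "(\<Prod>i<k. 2 - th i) = (\<Prod>i<k. (2 - th 0) * F i 0 ^ 2)" by (intro prod.cong refl)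
  then have "2 = (\<Prod>i<k. (2 - th 0) * F i 0 ^ 2)" by (simp only: prod_two_minus_th)
  then have "2 = (2 - th 0) ^ k * (\<Prod>i<k. F i 0 ^ 2)" by (simp add: prod.distrib)
  then have "of_real 2 = complex_of_real ((2 - th 0) ^ k * (\<Prod>i<k. F i 0 ^ 2))" by (simp only:)
  then have "of_nat 2 = of_real (2 - th 0) ^ k * un 0" by (simp add: un_def)
  then have "g 0 t (of_nat 2) = g 0 t (of_real (2 - th 0) ^ k * un 0)" by (simp only:)
  also have "g 0 t (of_real (2 - th 0) ^ k * un 0) = of_real (2 - th t) ^ k * un t"
  proof -
    have eq: "of_real (2 - th i) = (of_nat 2 - of_real (th i) :: complex)" for i by simp
    have "complex_of_nat 2 \<in> E" by (intro Qzeta_Rats Rats_of_nat)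
    then have "g 0 t (of_real (2 - th 0)) = of_real (2 - th t)" "of_real (2 - th 0) \<in> E"
      unfolding eq by (simp_all only: g_diff g_theta g_of_nat th_in_E Qzeta_diff)
    then show ?thesis by (simp add: un_def g_mult g_power g_prod g_F del: of_real_diff)
  qed
  finally show ?thesis using g_of_nat[of 0 t 2] by (simp only: of_nat_numeral)
qed

lemma prod_un: "(\<Prod>t<k. un t) = 1"
proof -
  have "(\<Prod>t<k. of_real (2 - th t) ^ k * un t) = (\<Prod>t<k. 2)"
    by (intro prod.cong refl two_eq[symmetric])
  then have "2 ^ k = (\<Prod>t<k. of_real (2 - th t) ^ k * un t)" by (simp only: prod_constant card_lessThan)
  also have "\<dots> = of_real (\<Prod>t<k. 2 - th t) ^ k * (\<Prod>t<k. un t)"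
    unfolding of_real_prod by (simp add: prod.distrib prod_power_distrib)
  finally show ?thesis unfolding prod_two_minus_th by simp
qed

lemma pi0_power: obtains u where "u \<in> ZT" "\<pi>0 ^ k = 2 * u" "un 0 * u = 1"
proof
  define u where "u = (\<Prod>t\<in>{1..<k}. un t)"
  show "u \<in> ZT" unfolding u_def un_def by (intro ZT_prod ZT_power ZT_F)
  have "{..<k} = insert 0 {1..<k}" using k_pos by auto
  then show u: "un 0 * u = 1" using prod_un by (simp add: u_def)
  have "2 * u = \<pi>0 ^ k * (un 0 * u)" using two_eq[of 0] by (simp add: \<pi>0_def mult.assoc)
  then show "\<pi>0 ^ k = 2 * u" using u by simp
qed

lemma aint_un [simp]: "aint (un t)"
  unfolding un_def by (intro aint_prod aint_power) simp

lemma aint_ZT: "y \<in> ZT \<Longrightarrow> aint y"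
  by (elim ZT_E) auto

lemma pi0_nonzero: "\<pi>0 \<noteq> 0"
  unfolding \<pi>0_def of_real_eq_0_iff using th_bound[OF k_pos] by simp

text \<open>The Eisenstein argument: \<open>2\<close> is a unit times \<open>\<pi>0 ^ k\<close>, so in a representation of \<open>2 * y\<close>
  as a polynomial in \<open>\<pi>0\<close> the coefficients of degree less than \<open>k\<close> are successively even.\<close>

lemma ZT_half:
  assumes y: "aint y" "2 * y \<in> ZT"
  shows "y \<in> ZT"
proof -
  let ?P = "\<lambda>f. poly (map_poly of_int f) \<pi>0"
  obtain u where u: "u \<in> ZT" "\<pi>0 ^ k = 2 * u" "un 0 * u = 1" by (rule pi0_power)
  have two: "2 = \<pi>0 ^ k * un 0" using u by (simp add: mult_ac)
  have "\<exists>f f'. 2 * y = \<pi>0 ^ i * ?P f + 2 * ?P f'" if "i \<le> k" for i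
    using that
  proof (induction i)
    case 0
    obtain f where "2 * y = ?P f" using y(2) by (rule ZT_E)
    then show ?case by (intro exI[of _ f] exI[of _ 0]) simp
  next
    case (Suc i)
    then obtain f f' where f: "2 * y = \<pi>0 ^ i * ?P f + 2 * ?P f'" by auto
    obtain a f1 where a: "f = pCons a f1" by (cases f)
    have Pf: "?P f = of_int a + \<pi>0 * ?P f1" by (simp add: a of_int_hom.map_poly_pCons_hom)
    have "of_int a / \<pi>0 = \<pi>0 ^ (k - Suc i) * un 0 * (y - ?P f') - ?P f1"
    proof -
      have "k = Suc i + (k - Suc i)" using Suc.prems by simp
      then have "2 = \<pi>0 ^ (Suc i + (k - Suc i)) * un 0" using two by (simp only:)
      then have t: "2 = \<pi>0 ^ i * \<pi>0 * \<pi>0 ^ (k - Suc i) * un 0" by (simp only: power_add power_Suc mult_ac)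
      have "\<pi>0 ^ i * of_int a = 2 * (y - ?P f') - \<pi>0 ^ i * \<pi>0 * ?P f1"
        using f unfolding Pf by (simp add: algebra_simps)
      also have "\<dots> = \<pi>0 ^ i * (\<pi>0 * (\<pi>0 ^ (k - Suc i) * un 0 * (y - ?P f') - ?P f1))"
        by (subst t) (simp only: right_diff_distrib mult_ac)
      finally have "of_int a = \<pi>0 * (\<pi>0 ^ (k - Suc i) * un 0 * (y - ?P f') - ?P f1)"
        using pi0_nonzero by simp
      then show ?thesis using pi0_nonzero by simp
    qed
    also have "aint \<dots>" using y(1) by (intro aint_diff aint_mult aint_power aint_poly) simp_all
    finally have "aint ((of_int a / \<pi>0) ^ k * u)" using aint_ZT[OF u(1)] by (intro aint_mult aint_power)
    also have "(of_int a / \<pi>0) ^ k * u = of_int (a ^ k) / of_int 2"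
    proof -
      have "u \<noteq> 0" using u(3) by auto
      then show ?thesis by (simp add: power_divide u(2))
    qed
    finally have "2 dvd a ^ k" by (rule aint_divide_int) simp
    then have "even a" using k_pos by simp
    then obtain b where b: "a = 2 * b" by (auto elim: evenE)
    have "2 * y = \<pi>0 ^ Suc i * ?P f1 + 2 * ?P (f' + monom b i)"
      unfolding f Pf b by (simp add: of_int_poly_hom.hom_add poly_monom algebra_simps)
    then show ?case by blast
  qed
  from this[of k] obtain f f' where "2 * y = \<pi>0 ^ k * ?P f + 2 * ?P f'" by auto
  then have "2 * y = 2 * (u * ?P f + ?P f')" unfolding u(2) by (simp only: distrib_left mult.assoc)
  then have "y = u * ?P f + ?P f'" by (rule mult_left_cancel[OF zero_neq_numeral[symmetric], THEN iffD1])
  then show ?thesis using u(1) by (auto intro: ZT_add ZT_mult)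
qed

lemma ZT_two_power: "aint y \<Longrightarrow> 2 ^ a * y \<in> ZT \<Longrightarrow> y \<in> ZT"
proof (induction a)
  case (Suc a)
  have "aint (2 ^ a * y)" using Suc.prems(1) by (intro aint_mult aint_power) auto
  moreover have "2 * (2 ^ a * y) \<in> ZT" using Suc.prems(2) by (simp add: mult.assoc)
  ultimately have "2 ^ a * y \<in> ZT" by (rule ZT_half)
  then show ?case using Suc by simp
qed simp

definition Fspan :: "complex set" where
  "Fspan = {\<Sum>j<k. of_int (c j) * of_real (F j 0) | c :: nat \<Rightarrow> int. True}"

lemma FspanI: "y = (\<Sum>j<k. of_int (c j) * of_real (F j 0)) \<Longrightarrow> y \<in> Fspan"
  unfolding Fspan_def by blast

lemma Fspan_add: "x \<in> Fspan \<Longrightarrow> y \<in> Fspan \<Longrightarrow> x + y \<in> Fspan"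
proof -
  assume "x \<in> Fspan" "y \<in> Fspan"
  then obtain c c' where "x = (\<Sum>j<k. of_int (c j) * of_real (F j 0))" "y = (\<Sum>j<k. of_int (c' j) * of_real (F j 0))"
    unfolding Fspan_def by blast
  then show ?thesis by (intro FspanI[of _ "\<lambda>j. c j + c' j"]) (simp add: sum.distrib distrib_right)
qed

lemma Fspan_of_int_mult: "x \<in> Fspan \<Longrightarrow> of_int n * x \<in> Fspan"
proof -
  assume "x \<in> Fspan"
  then obtain c where "x = (\<Sum>j<k. of_int (c j) * of_real (F j 0))" unfolding Fspan_def by blast
  then show ?thesis by (intro FspanI[of _ "\<lambda>j. n * c j"]) (simp add: sum_distrib_left mult.assoc)
qed

lemma Fspan_diff: "x \<in> Fspan \<Longrightarrow> y \<in> Fspan \<Longrightarrow> x - y \<in> Fspan"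
  using Fspan_add[of x "of_int (- 1) * y"] Fspan_of_int_mult[of y "- 1"] by simp

lemma Fspan_sum: "(\<And>i. i \<in> M \<Longrightarrow> f i \<in> Fspan) \<Longrightarrow> sum f M \<in> Fspan"
proof (induction M rule: infinite_finite_induct)
  case (insert x M)
  then show ?case by (simp add: Fspan_add)
qed (auto intro!: FspanI[of _ "\<lambda>_. 0"])

lemma Fspan_F: "j \<le> k \<Longrightarrow> of_real (F j 0) \<in> Fspan"
proof -
  have lt: "of_real (F j 0) \<in> Fspan" if "j < k" for j
  proof (rule FspanI[of _ "\<lambda>i. if i = j then 1 else 0"])
    have "(\<Sum>i<k. of_int (if i = j then 1 else 0) * complex_of_real (F i 0)) = (\<Sum>i<k. if i = j then of_real (F j 0) else 0)"
      by (intro sum.cong refl) auto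
    then show "complex_of_real (F j 0) = (\<Sum>i<k. of_int (if i = j then 1 else 0) * of_real (F i 0))"
      using that by simp
  qed
  have "F k 0 = F (k - 1) 0"
  proof -
    have half: "2 * real k * ang 0 = pi / 2" using k_pos by (simp add: ang_eq)
    have "sin (ang 0) * F k 0 = sin (pi / 2 + ang 0)"
      unfolding sin_F half[symmetric] by (simp add: algebra_simps)
    also have "\<dots> = sin (pi / 2 - ang 0)" by (simp only: sin_add sin_diff) simp
    also have "\<dots> = sin ((2 * real (k - 1) + 1) * ang 0)"
      unfolding half[symmetric] using k_pos by (simp add: of_nat_diff algebra_simps)
    also have "\<dots> = sin (ang 0) * F (k - 1) 0" by (simp only: sin_F)
    finally show ?thesis using sin_ang_pos[OF k_pos] by simp
  qed
  then show "j \<le> k \<Longrightarrow> ?thesis" using lt[of j] lt[of "k - 1"] k_pos by (cases "j = k") simp_all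
qed

lemma Fspan_pi0:
  assumes "y \<in> Fspan"
  shows "\<pi>0 * y \<in> Fspan"
proof -
  obtain c where y: "y = (\<Sum>j<k. of_int (c j) * of_real (F j 0))" using assms unfolding Fspan_def by blast
  have "\<pi>0 * of_real (F j 0) \<in> Fspan" if j: "j < k" for j
  proof (cases j)
    case 0
    have "\<pi>0 * of_real (F j 0) = of_int 3 * of_real (F 0 0) - of_real (F 1 0)"
      using 0 by (simp add: \<pi>0_def F_def of_int_hom.map_poly_pCons_hom)
    then show ?thesis using Fspan_F[of 0] Fspan_F[of 1] k_pos
      by (simp only:) (intro Fspan_diff Fspan_of_int_mult; simp)
  next
    case (Suc i)
    have "\<pi>0 * of_real (F j 0) = of_int 2 * of_real (F (Suc i) 0) - (of_real (F (Suc (Suc i)) 0) + of_real (F i 0))"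
      using Suc by (simp add: \<pi>0_def F_def of_int_poly_hom.hom_minus of_int_poly_hom.hom_mult
          of_int_hom.map_poly_pCons_hom algebra_simps)
    then show ?thesis using Fspan_F[of i] Fspan_F[of "Suc i"] Fspan_F[of "Suc (Suc i)"] j Suc
      by (simp only:) (intro Fspan_diff Fspan_add Fspan_of_int_mult; simp)
  qed
  then have "(\<Sum>j<k. of_int (c j) * (\<pi>0 * of_real (F j 0))) \<in> Fspan"
    by (intro Fspan_sum Fspan_of_int_mult) simp
  then show ?thesis by (simp add: y sum_distrib_left mult_ac)
qed

lemma ZT_Fspan: "y \<in> ZT \<Longrightarrow> y \<in> Fspan"
proof -
  have "poly (map_poly of_int f) \<pi>0 \<in> Fspan" for f
  proof (induction f)
    case 0
    show ?case by (rule FspanI[of _ "\<lambda>_. 0"]) simp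
  next
    case (pCons a f)
    have "complex_of_real (F 0 0) = 1" by (simp add: F_def)
    then have "of_int a \<in> Fspan" using Fspan_of_int_mult[OF Fspan_F[of 0], of a] by simp
    then show ?case using Fspan_pi0[OF pCons.IH] by (simp add: of_int_hom.map_poly_pCons_hom Fspan_add)
  qed
  then show "y \<in> ZT \<Longrightarrow> ?thesis" by (elim ZT_E) simp
qed

lemma F_orthogonal_complex:
  "i < k \<Longrightarrow> j < k \<Longrightarrow> (\<Sum>t<k. of_real (2 - th t) * of_real (F i t) * of_real (F j t)) = (if i = j then 2 * of_nat k else (0 :: complex))"
  using arg_cong[OF F_orthogonal[of i j], of complex_of_real] by (auto simp del: of_real_diff)

lemma F_orthogonal'_complex:
  "s < k \<Longrightarrow> t < k \<Longrightarrow> (\<Sum>j<k. of_real (2 - th s) * of_real (F j s) * of_real (F j t)) = (if s = t then 2 * of_nat k else (0 :: complex))"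
  using arg_cong[OF F_orthogonal'[of s t], of complex_of_real] by (auto simp del: of_real_diff)

lemma L_coordinates_integral:
  fixes V :: complex
  defines "c j \<equiv> (\<Sum>t<k. of_real (2 - th t) * of_real (F j t) * g 0 t V) / (2 * of_nat k)"
  assumes V: "V \<in> E" "aint V" and rat: "\<And>j. j < k \<Longrightarrow> c j \<in> \<rat>" and j: "j < k"
  obtains n where "c j = of_int n"
proof -
  have k0: "complex_of_nat k \<noteq> 0" using k_pos by simp
  have V_eq: "V = (\<Sum>j<k. c j * of_real (F j 0))"
  proof -
    have "(\<Sum>j<k. c j * of_real (F j 0))
       = (\<Sum>j<k. \<Sum>t<k. g 0 t V / (2 * of_nat k) * (of_real (2 - th t) * of_real (F j t) * of_real (F j 0)))"
      by (simp add: c_def sum_distrib_right sum_distrib_left sum_divide_distrib mult_ac)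
    also have "\<dots> = (\<Sum>t<k. g 0 t V / (2 * of_nat k) * (\<Sum>j<k. of_real (2 - th t) * of_real (F j t) * of_real (F j 0)))"
      by (subst sum.swap) (simp only: sum_distrib_left)
    also have "\<dots> = (\<Sum>t<k. if t = 0 then g 0 0 V else 0)"
      using k_pos k0 by (intro sum.cong refl) (auto simp: F_orthogonal'_complex simp del: of_real_diff)
    also have "\<dots> = V" using k_pos g_0_0[OF V(1)] by simp
    finally show ?thesis ..
  qed
  have "\<exists>n. 2 * of_nat k * c i = of_int n" if i: "i < k" for i
  proof -
    have "2 * of_nat k * c i = (\<Sum>t<k. of_real (2 - th t) * of_real (F i t) * g 0 t V)"
      using k0 by (simp add: c_def)
    moreover have "aint (\<Sum>t<k. of_real (2 - th t) * of_real (F i t) * g 0 t V)"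
    proof (intro aint_sum aint_mult aint_F aint_g V)
      show "aint (of_real (2 - th t))" for t
        using aint_diff[OF aint_numeral(1) aint_th[of t]] by simp
    qed
    ultimately have "aint (2 * of_nat k * c i)" by simp
    moreover have "2 * of_nat k * c i \<in> \<rat>" using rat[OF i] by (intro Rats_mult) auto
    ultimately show ?thesis using rational_aint_int by metis
  qed
  then obtain n where n: "\<And>i. i < k \<Longrightarrow> 2 * of_nat k * c i = of_int (n i)" by metis
  have "2 * of_nat k * V = (\<Sum>j<k. of_int (n j) * of_real (F j 0))"
    unfolding V_eq sum_distrib_left by (intro sum.cong refl) (simp add: n flip: mult.assoc)
  also have "\<dots> \<in> ZT" by (intro ZT_sum ZT_mult ZT_of_int ZT_F)
  also have "2 * of_nat k = (2 :: complex) ^ Suc (m - 2)" by (simp add: k_def)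
  finally have "V \<in> ZT" using ZT_two_power V(2) by blast
  then obtain c' where c': "V = (\<Sum>i<k. of_int (c' i) * of_real (F i 0))"
    using ZT_Fspan unfolding Fspan_def by blast
  have gV: "g 0 t V = (\<Sum>i<k. of_int (c' i) * of_real (F i t))" for t
    unfolding c' by (simp add: g_sum g_mult g_F Qzeta_Rats)
  have "(\<Sum>t<k. of_real (2 - th t) * of_real (F j t) * g 0 t V)
      = (\<Sum>t<k. \<Sum>i<k. of_int (c' i) * (of_real (2 - th t) * of_real (F j t) * of_real (F i t)))"
    unfolding gV by (simp add: sum_distrib_left mult_ac)
  also have "\<dots> = (\<Sum>i<k. of_int (c' i) * (\<Sum>t<k. of_real (2 - th t) * of_real (F j t) * of_real (F i t)))"
    by (subst sum.swap) (simp only: sum_distrib_left)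
  also have "\<dots> = (\<Sum>i<k. if i = j then of_int (c' j) * (2 * of_nat k) else 0)"
    using j by (intro sum.cong refl) (auto simp: F_orthogonal_complex simp del: of_real_diff)
  also have "\<dots> = of_int (c' j) * (2 * of_nat k)" using j by simp
  finally have "c j = of_int (c' j)" using k0 by (simp add: c_def)
  then show ?thesis using that by blast
qed

subsection \<open>Integrality of the coordinates\<close>

lemma p_sq_co_integral:
  assumes y: "y \<in> Fx" "aint y" and j: "j < k"
  obtains n where "of_nat p ^ 2 * co i j y = of_int n"
proof -
  define V where "V = (\<Sum>s<l. g s 0 y * X (i + s))"
  have V: "V \<in> E" "aint V"
    unfolding V_def using y by (auto intro!: aint_sum aint_mult aint_g)
  have gV: "g 0 t V = (\<Sum>s<l. g s t y * X (i + s))" for t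
    unfolding V_def using y by (simp add: g_sum g_mult g_compose g_X)
  have c: "(\<Sum>t<k. of_real (2 - th t) * of_real (F j t) * g 0 t V) / (2 * of_nat k) = of_nat p ^ 2 * co i j y" for j
  proof -
    have "of_nat p ^ 2 * co i j y = (\<Sum>t<k. \<Sum>s<l. of_nat p ^ 2 * (of_real (bet t) * g s t y * (X (i + s) * of_real (F j t))))"
      unfolding co_def by (subst sum.swap) (simp only: sum_distrib_left)
    also have "\<dots> = (\<Sum>t<k. \<Sum>s<l. of_real (2 - th t) * of_real (F j t) * (g s t y * X (i + s)) / (2 * of_nat k))"
      by (intro sum.cong refl) (simp add: bet_eq)
    also have "\<dots> = (\<Sum>t<k. of_real (2 - th t) * of_real (F j t) * g 0 t V) / (2 * of_nat k)"
      unfolding gV by (simp only: sum_distrib_left sum_divide_distrib)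
    finally show ?thesis ..
  qed
  have "of_nat p ^ 2 * co i j y \<in> \<rat>" for j using co_rational[OF y(1)] by (intro Rats_mult) auto
  then show ?thesis using L_coordinates_integral[OF V _ j] that unfolding c by blast
qed

lemma two_k_co_integral:
  assumes y: "y \<in> Fx" "aint y"
  obtains n where "2 * of_nat k * co i j (X 0 * y) = of_int n"
proof -
  define Q where "Q = (\<Sum>s<l. \<Sum>t<k. (- 1) ^ h * of_real (2 - th t) * of_real (F j t) * g s t y * (S s * S (i + s)))"
  have z: "1 - zp \<noteq> 0" using e_ne_1[of 0] by (simp add: e_0)
  have XX: "X s * X (i + s) = (- 1) ^ h * of_nat p * (S s * S (i + s))" for s
    unfolding X_def w_square[symmetric] by (simp add: mult_ac)
  have Q: "2 * of_nat k * of_nat p * co i j (X 0 * y) = Q"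
  proof -
    have "2 * of_nat k * of_nat p * co i j (X 0 * y)
       = (\<Sum>s<l. \<Sum>t<k. 2 * of_nat k * of_nat p * of_real (bet t) * of_real (F j t) * g s t y * (X s * X (i + s)))"
      using y(1) by (simp add: co_def sum_distrib_left g_mult g_X mult_ac)
    also have "\<dots> = Q"
      unfolding Q_def XX using k_pos by (intro sum.cong refl) (simp add: bet_eq power2_eq_square)
    finally show ?thesis .
  qed
  have aint2: "aint (of_real (2 - th t))" for t
    using aint_diff[OF aint_numeral(1) aint_th[of t]] by simp
  have aintS: "aint (S s)" for s
    unfolding S_def by (intro aint_sum aint_mult) auto
  have "Q / (1 - zp) = (\<Sum>s<l. \<Sum>t<k. (- 1) ^ h * of_real (2 - th t) * of_real (F j t) * g s t y * (S s / (1 - zp) * S (i + s)))"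
    unfolding Q_def by (simp add: sum_divide_distrib)
  also have "aint \<dots>"
    using y by (intro aint_sum aint_mult aint2 aintS one_minus_zp_dvd_S aint_g) simp_all
  finally have aQ: "aint (Q / (1 - zp))" .
  have "aint (Q / (1 - zp) * (1 - zp))" by (intro aint_mult aQ aint_diff) auto
  then have "aint Q" using z by simp
  moreover have "Q \<in> \<rat>"
    unfolding Q[symmetric] using y(1) by (intro Rats_mult co_rational subfield_mult[OF subfield_Fx]) auto
  ultimately obtain n where n: "Q = of_int n" using rational_aint_int by metis
  then have "int p dvd n" using aQ dvd_of_one_minus_zp by simp
  then obtain n' where "n = int p * n'" by (auto elim: dvdE)
  then have "of_nat p * (2 * of_nat k * co i j (X 0 * y)) = of_nat p * of_int n'"
    using Q n by (simp add: mult_ac)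
  then show ?thesis using that by simp
qed

lemma co_integral:
  assumes y: "y \<in> Fx" "aint y" and j: "j < k"
  obtains n where "co i j (X 0 * y) = of_int n"
proof -
  have "X 0 * y \<in> Fx" using y(1) by (intro subfield_mult[OF subfield_Fx]) simp_all
  moreover have "aint (X 0 * y)" using y(2) by (intro aint_mult) simp_all
  ultimately obtain a where a: "of_nat p ^ 2 * co i j (X 0 * y) = of_int a"
    using p_sq_co_integral[OF _ _ j] by blast
  obtain b where b: "2 * of_nat k * co i j (X 0 * y) = of_int b"
    using two_k_co_integral[OF y] by blast
  have "coprime (int p ^ 2) (2 * int k)"
    using odd_p by (simp add: k_def)
  then obtain u v where uv: "u * int p ^ 2 + v * (2 * int k) = 1"
    using bezout_int[of "int p ^ 2" "2 * int k"] by (auto simp: coprime_iff_gcd_eq_1)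
  have "co i j (X 0 * y) = of_int (u * int p ^ 2 + v * (2 * int k)) * co i j (X 0 * y)" unfolding uv by simp
  also have "\<dots> = of_int u * (of_nat p ^ 2 * co i j (X 0 * y)) + of_int v * (2 * of_nat k * co i j (X 0 * y))"
    by (simp add: algebra_simps)
  also have "\<dots> = of_int (u * a + v * b)" unfolding a b by simp
  finally show ?thesis using that by blast
qed

end

lemma zspan_subset:
  assumes "T \<subseteq> M" "0 \<in> M" "\<And>a b. a \<in> M \<Longrightarrow> b \<in> M \<Longrightarrow> a + b \<in> M"
    "\<And>n a. a \<in> M \<Longrightarrow> of_int n * a \<in> M"
  shows "zspan T \<subseteq> M"
proof
  fix y assume "y \<in> zspan T"
  then obtain n c t where y: "y = (\<Sum>i<n. of_int (c i) * t i)" "\<forall>i<(n::nat). t i \<in> T"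
    unfolding zspan_def by blast
  have "(\<Sum>i<n'. of_int (c i) * t i) \<in> M" if "n' \<le> n" for n'
    using that
  proof (induction n')
    case (Suc n')
    have "t n' \<in> M" using assms(1) y(2) Suc.prems by auto
    then have "(\<Sum>i<n'. of_int (c i) * t i) + of_int (c n') * t n' \<in> M"
      using Suc.prems by (intro assms(3,4) Suc.IH) simp_all
    then show ?case by simp
  qed (simp add: assms)
  then show "y \<in> M" using y(1) by simp
qed

lemma zspanI: "(\<And>i. i < (n :: nat) \<Longrightarrow> t i \<in> T) \<Longrightarrow> (\<Sum>i<n. of_int (c i) * t i) \<in> zspan T"
  unfolding zspan_def mem_Collect_eq by (rule exI[of _ n], rule exI[of _ c], rule exI[of _ t]) simp

lemma zspan_base: "a \<in> T \<Longrightarrow> a \<in> zspan T"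
  using zspanI[of "Suc 0" "\<lambda>_. a" T "\<lambda>_. 1"] by simp

lemma prod_sqrt: "(\<Prod>t\<in>M. sqrt (f t)) = sqrt (\<Prod>t\<in>M. f t)"
  by (induction M rule: infinite_finite_induct) (simp_all add: real_sqrt_mult)

lemma Zzeta_aint: "n > 0 \<Longrightarrow> y \<in> Zzeta n \<Longrightarrow> aint y"
  unfolding Zzeta_def by auto

lemma one_le_of_one_le_power:
  fixes a :: real
  assumes "a ^ n \<ge> 1" "a \<ge> 0" "n > 0"
  shows "a \<ge> 1"
  using assms power_less_one_iff[of a n] by (meson not_le)

context lattice_setting
begin

definition OK :: "complex set" where "OK = {y \<in> Fx. aint y}"

lemma OK_eq: "ring_of_integers Fx = OK"
  by (simp add: OK_def ring_of_integers_def)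

lemma OK_1: "1 \<in> OK"
  by (simp add: OK_def subfield_1[OF subfield_Fx])

definition Bsum :: "(nat \<Rightarrow> int) \<Rightarrow> complex" where
  "Bsum c = (\<Sum>q<k * l. of_int (c q) * B (q div k) (q mod k))"

lemma Bsum_eq: "(\<Sum>i<l. \<Sum>j<k. of_int (n i j) * B i j) = Bsum (\<lambda>q. n (q div k) (q mod k))"
proof -
  have "(\<Sum>i<l. \<Sum>j<k. of_int (n i j) * B i j)
     = (\<Sum>i<l. \<Sum>j<k. of_int (n ((i * k + j) div k) ((i * k + j) mod k)) * B ((i * k + j) div k) ((i * k + j) mod k))"
    by (intro sum.cong refl) simp
  also have "\<dots> = Bsum (\<lambda>q. n (q div k) (q mod k))"
    unfolding Bsum_def mult.commute[of k l]
    by (rule sum_block[of "\<lambda>q. of_int (n (q div k) (q mod k)) * B (q div k) (q mod k)"])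
  finally show ?thesis .
qed

lemma Bsum_of_coordinates:
  assumes "y \<in> E" and "\<And>i j. i < l \<Longrightarrow> j < k \<Longrightarrow> \<exists>n. co i j y = of_int n"
  obtains c where "y = Bsum c"
proof -
  obtain n where n: "\<And>i j. i < l \<Longrightarrow> j < k \<Longrightarrow> co i j y = of_int (n i j)" using assms(2) by metis
  have "y = (\<Sum>i<l. \<Sum>j<k. of_int (n i j) * B i j)"
    by (subst expansion[OF assms(1), symmetric]) (intro sum.cong refl, simp add: n)
  then show ?thesis using that Bsum_eq by metis
qed

lemma Iset_eq: "Iset p r l lam = zspan {X j | j. j < l}"
  unfolding Iset_def sigma_xelt ..

definition II :: "complex set" where
  "II = prod_module (Iset p r l lam) (ring_of_integers (Lfield m))"

lemma Bsum_in_II: "Bsum c \<in> II"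
  unfolding Bsum_def II_def prod_module_def
proof (rule zspanI)
  fix q assume "q < k * l"
  then have "q div k < l" by (simp add: less_mult_imp_div_less mult.commute)
  then have "X (q div k) \<in> Iset p r l lam" unfolding Iset_eq by (intro zspan_base) blast
  moreover have "of_real (F (q mod k) 0) \<in> ring_of_integers (Lfield m)"
    by (simp add: ring_of_integers_def F_in_Lfield)
  ultimately show "B (q div k) (q mod k) \<in> {a * b |a b. a \<in> Iset p r l lam \<and> b \<in> ring_of_integers (Lfield m)}"
    unfolding B_def by blast
qed

lemma OK_Bsum: "y \<in> OK \<Longrightarrow> \<exists>c. X 0 * y = Bsum c"
proof -
  assume y: "y \<in> OK"
  have "X 0 * y \<in> E" using y by (simp add: OK_def)
  moreover have "\<exists>n. co i j (X 0 * y) = of_int n" if "j < k" for i j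
    using co_integral[of y j i] y that by (auto simp: OK_def)
  ultimately show ?thesis using Bsum_of_coordinates by metis
qed

context
  assumes hyp: "aint (X 1 / X 0)"
begin

lemma aint_X_ratio: "aint (X (i + s) / X s)"
proof (induction i)
  case 0
  then show ?case by (simp add: X_nonzero)
next
  case (Suc i)
  have "g (i + s) 0 (X 1 / X 0) = X (Suc i + s) / X (i + s)"
    by (simp add: divide_inverse g_mult g_inverse E_inverse g_X)
  moreover have "aint (g (i + s) 0 (X 1 / X 0))"
    using hyp by (intro aint_g) (simp_all add: divide_inverse E_inverse)
  ultimately have "aint (X (Suc i + s) / X (i + s) * (X (i + s) / X s))"
    using Suc by (metis aint_mult)
  then show ?case by (simp add: X_nonzero)
qed

lemma II_subset: "II \<subseteq> (\<lambda>y. X 0 * y) ` OK"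
proof -
  let ?M = "{y \<in> Fx. aint (y / X 0)}"
  note Fx = subfield_Fx
  have add: "a + b \<in> ?M" if "a \<in> ?M" "b \<in> ?M" for a b
    using that by (auto simp: add_divide_distrib subfield_add[OF Fx])
  have smult: "of_int n * a \<in> ?M" if "a \<in> ?M" for n a
    using that aint_mult[of "of_int n" "a / X 0"] by (auto simp: subfield_mult[OF Fx] subfield_Rats[OF Fx])
  have zero: "0 \<in> ?M" by (simp add: subfield_0[OF Fx])
  have "Iset p r l lam \<subseteq> ?M"
    unfolding Iset_eq
  proof (rule zspan_subset[OF _ zero add smult])
    show "{X j |j. j < l} \<subseteq> ?M" using aint_X_ratio[of _ 0] by auto
  qed
  then have "{a * b |a b. a \<in> Iset p r l lam \<and> b \<in> ring_of_integers (Lfield m)} \<subseteq> ?M"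
    using Lfield_Fx by (auto simp: ring_of_integers_def subfield_mult[OF Fx] subset_iff)
       (metis aint_mult times_divide_eq_left)
  then have "II \<subseteq> ?M"
    unfolding II_def prod_module_def by (rule zspan_subset[OF _ zero add smult])
  moreover have "?M \<subseteq> (\<lambda>y. X 0 * y) ` OK"
  proof
    fix y assume y: "y \<in> ?M"
    then have "y / X 0 \<in> OK"
      by (simp add: OK_def divide_inverse subfield_mult[OF Fx] subfield_inverse[OF Fx])
    moreover have "y = X 0 * (y / X 0)" using X_nonzero by simp
    ultimately show "y \<in> (\<lambda>y. X 0 * y) ` OK" by blast
  qed
  ultimately show ?thesis by blast
qed

lemma II_eq: "II = (\<lambda>y. X 0 * y) ` OK" and II_Bsum: "II = range Bsum"
proof -
  have "(\<lambda>y. X 0 * y) ` OK \<subseteq> range Bsum" using OK_Bsum by auto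
  moreover have "range Bsum \<subseteq> II" using Bsum_in_II by auto
  ultimately show "II = (\<lambda>y. X 0 * y) ` OK" "II = range Bsum" using II_subset by blast+
qed

end

subsection \<open>Norms\<close>

lemma rational_of_fixed:
  assumes "v \<in> E" "\<And>s t. g s t v = v"
  shows "v \<in> \<rat>"
proof -
  have "of_nat ((p - 1) * (2 * k)) * v \<in> \<rat>"
    using trace_rational[OF assms(1)] by (simp add: assms(2) mult.assoc)
  then have "of_nat ((p - 1) * (2 * k)) * v / of_nat ((p - 1) * (2 * k)) \<in> \<rat>"
    by (intro Rats_divide Rats_of_nat)
  moreover have "(p - 1) * (2 * k) \<noteq> 0" using p_gt_2 k_pos by simp
  then have "complex_of_nat ((p - 1) * (2 * k)) \<noteq> 0" by (simp only: of_nat_eq_0_iff) simp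
  ultimately show ?thesis by simp
qed

lemma g_mod: "y \<in> E \<Longrightarrow> g s (t mod (2 * k)) y = g s t y"
proof (rule g_cong)
  have "2 * (t mod (2 * k)) = 2 * t mod 2 ^ m" using mult_mod_right[of 2 t "2 * k"] four_k by simp
  then have "[2 * (t mod (2 * k)) = 2 * t] (mod 2 ^ m)" by (simp add: cong_def)
  then show "[2 * (t mod (2 * k)) + 1 = 2 * t + 1] (mod 2 ^ m)" by (intro cong_add) simp_all
qed simp_all

lemma bij_odd_mult: "bij_betw (\<lambda>t. (2 * c * t + c + t) mod (2 * k)) {..<2 * k} {..<2 * k}"
proof -
  have "inj_on (\<lambda>t. (2 * c * t + c + t) mod (2 * k)) {..<2 * k}"
  proof (rule inj_onI)
    fix a b assume ab: "a \<in> {..<2 * k}" "b \<in> {..<2 * k}"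
      "(2 * c * a + c + a) mod (2 * k) = (2 * c * b + c + b) mod (2 * k)"
    then have "[(2 * c + 1) * a + c = (2 * c + 1) * b + c] (mod (2 * k))"
      by (simp add: cong_def algebra_simps)
    then have "[(2 * c + 1) * a = (2 * c + 1) * b] (mod (2 * k))" by (simp only: cong_add_rcancel_nat)
    moreover have "coprime (2 * c + 1) (2 * k)" by (simp add: k_def)
    ultimately have "[a = b] (mod (2 * k))" by (simp only: cong_mult_lcancel_nat)
    then show "a = b" using ab by (simp add: cong_def)
  qed
  moreover have "(\<lambda>t. (2 * c * t + c + t) mod (2 * k)) ` {..<2 * k} \<subseteq> {..<2 * k}"
    using k_pos by auto
  ultimately show ?thesis by (simp add: bij_betw_def endo_inj_surj)
qed

lemma norm_E_ge_1:
  assumes y: "y \<in> E" "aint y" "y \<noteq> 0"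
  shows "cmod (\<Prod>s<p - 1. \<Prod>t<2 * k. g s t y) \<ge> 1"
proof -
  let ?v = "\<Prod>s<p - 1. \<Prod>t<2 * k. g s t y"
  have v: "?v \<in> E" using y(1) by simp
  have "g s' t' ?v = ?v" for s' t'
  proof -
    have "g s' t' ?v = (\<Prod>s<p - 1. \<Prod>t<2 * k. g (s' + s) (2 * t' * t + t' + t) y)"
      using y(1) by (simp add: g_prod g_compose)
    also have "\<dots> = (\<Prod>s<p - 1. \<Prod>t<2 * k. g (s' + s) ((2 * t' * t + t' + t) mod (2 * k)) y)"
      using y(1) by (simp only: g_mod)
    also have "\<dots> = (\<Prod>s<p - 1. \<Prod>t<2 * k. g (s + s') t y)"
      unfolding prod.reindex_bij_betw[OF bij_odd_mult, of "\<lambda>t. g (s' + s) t y" for s] by (simp only: add.commute)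
    also have "\<dots> = ?v"
    proof (rule prod_shift_periodic)
      show "(\<Prod>t<2 * k. g (s + (p - 1)) t y) = (\<Prod>t<2 * k. g s t y)" for s
        using y(1) by (intro prod.cong refl g_cong) (simp_all add: cong_def)
    qed
    finally show ?thesis .
  qed
  then have "?v \<in> \<rat>" by (rule rational_of_fixed[OF v])
  moreover have "aint ?v" using y by (intro aint_prod aint_g) simp_all
  ultimately obtain n where n: "?v = of_int n" using rational_aint_int by blast
  have "?v \<noteq> 0" using g_nonzero y by simp
  then have "complex_of_int n \<noteq> 0" unfolding n .
  then have "n \<noteq> 0" by simp
  then have "1 \<le> \<bar>real_of_int n\<bar>" by linarith
  then show ?thesis unfolding n by simp
qed

definition nrm :: "complex \<Rightarrow> complex" where "nrm y = (\<Prod>s<l. \<Prod>t<k. g s t y)"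

lemma field_norm_eq: "y \<in> Fx \<Longrightarrow> field_norm Fx y = nrm y"
  unfolding field_norm_def prod_embeddings nrm_def by (simp add: emb_def)

lemma nrm_mult: "x \<in> E \<Longrightarrow> y \<in> E \<Longrightarrow> nrm (x * y) = nrm x * nrm y"
  by (simp add: nrm_def g_mult prod.distrib)

lemma nrm_ge_1:
  assumes y: "y \<in> OK" "y \<noteq> 0"
  shows "cmod (nrm y) \<ge> 1"
proof -
  have Fx: "y \<in> Fx" "aint y" using y by (simp_all add: OK_def)
  let ?f = "\<lambda>s. (\<Prod>t<k. g s t y) ^ 2"
  have per: "?f (j * l + s) = ?f s" for j s
  proof (induction j)
    case (Suc j)
    have "Suc j * l + s = (j * l + s) + l" by simp
    then have "?f (Suc j * l + s) = ?f (j * l + s)" by (simp only: g_period[OF Fx(1)])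
    then show ?case using Suc by simp
  qed simp
  have "(\<Prod>s<p - 1. \<Prod>t<2 * k. g s t y) = (\<Prod>s<p - 1. ?f s)"
    unfolding prod_fold_reflect using g_reflect[OF Fx(1)]
    by (intro prod.cong refl) (simp add: power2_eq_square prod.distrib)
  also have "\<dots> = (\<Prod>j<d. \<Prod>s<l. ?f (j * l + s))" unfolding dl[symmetric] by (rule prod_block[symmetric])
  also have "\<dots> = nrm y ^ (2 * d)"
    unfolding per by (simp add: nrm_def power_mult prod_power_distrib)
  finally have "cmod (nrm y) ^ (2 * d) \<ge> 1"
    using norm_E_ge_1[of y] Fx y(2) by (simp add: norm_power)
  then show ?thesis by (rule one_le_of_one_le_power) (use d_pos in simp_all)
qed

definition PX :: complex where "PX = (\<Prod>s<l. X s)"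

lemma nrm_X: "nrm (X 0) = PX ^ k"
  by (simp add: nrm_def PX_def g_X prod_power_distrib)

lemma PX_lower: "cmod PX ^ 2 \<ge> real p ^ (l + 1)"
proof -
  define v where "v = (\<Prod>s<l. S s ^ 2)"
  have PXv: "PX ^ 2 = ((- 1) ^ h * of_nat p) ^ l * v"
  proof -
    have "X s ^ 2 = ((- 1) ^ h * of_nat p) * S s ^ 2" for s
      unfolding w_square[symmetric] by (simp add: X_def power2_eq_square mult_ac)
    then have "(\<Prod>s<l. X s ^ 2) = (\<Prod>s<l. ((- 1) ^ h * of_nat p) * S s ^ 2)" by (simp only:)
    then show ?thesis
      by (simp only: PX_def v_def prod_power_distrib prod.distrib prod_constant card_lessThan power_mult_distrib)
  qed
  have PX0: "PX \<noteq> 0" by (simp add: PX_def X_nonzero)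
  have "PX \<in> \<rat>"
  proof (rule rational_of_fixed)
    show "g s t PX = PX" for s t
      unfolding PX_def by (simp add: g_prod g_X prod_shift_periodic[of X, OF X_period])
  qed (simp add: PX_def)
  moreover have "v = PX ^ 2 / ((- 1) ^ h * of_nat p) ^ l" unfolding PXv by simp
  ultimately have "v \<in> \<rat>" by (auto intro!: Rats_divide Rats_power Rats_mult)
  moreover have aS: "aint (S s)" for s unfolding S_def by (intro aint_sum aint_mult) auto
  then have "aint v" unfolding v_def by (intro aint_prod aint_power)
  ultimately obtain n where n: "v = of_int n" using rational_aint_int by blast
  have "{..<l} = insert 0 {1..<l}" using l by auto
  then have "v / (1 - zp) = S 0 / (1 - zp) * (S 0 * (\<Prod>s\<in>{1..<l}. S s ^ 2))"
    by (simp add: v_def power2_eq_square)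
  also have "aint \<dots>" using aS by (intro aint_mult aint_prod aint_power one_minus_zp_dvd_S)
  finally have "int p dvd n" unfolding n by (rule dvd_of_one_minus_zp)
  moreover have "n \<noteq> 0" using PX0 PXv n by auto
  ultimately have "\<bar>int p\<bar> \<le> \<bar>n\<bar>" by (intro dvd_imp_le_int)
  then have "real p \<le> \<bar>real_of_int n\<bar>" by linarith
  then have "real p ^ l * real p \<le> real p ^ l * \<bar>real_of_int n\<bar>" by (rule mult_left_mono) simp
  moreover have "cmod (PX ^ 2) = real p ^ l * \<bar>real_of_int n\<bar>"
    unfolding PXv n by (simp add: norm_mult norm_power)
  ultimately show ?thesis by (simp add: norm_power mult.commute)
qed

definition varpi :: "nat \<Rightarrow> complex" where "varpi s = (\<Prod>j<d. 1 - e (j * l + s))"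

lemma varpi_in_E [simp]: "varpi s \<in> E"
  unfolding varpi_def by simp

lemma g_varpi: "g s t (varpi i) = varpi (i + s)"
  unfolding varpi_def by (simp add: g_prod g_diff g_e add.assoc)

lemma varpi_period: "varpi (s + l) = varpi s"
proof -
  define f where "f j = 1 - e (j * l + s)" for j
  have "f (j + d) = f j" for j
    using e_period[of "j * l + s"] by (simp add: f_def algebra_simps)
  then have "(\<Prod>j<d. f (j + 1)) = prod f {..<d}" by (rule prod_shift_periodic)
  then show ?thesis by (simp add: varpi_def f_def algebra_simps)
qed

lemma prod_varpi: "(\<Prod>s<l. varpi s) = of_nat p"
proof -
  have "(\<Prod>s<l. varpi s) = (\<Prod>j<d. \<Prod>s<l. 1 - e (j * l + s))" unfolding varpi_def by (rule prod.swap)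
  also have "\<dots> = (\<Prod>i<d * l. 1 - e i)" by (rule prod_block)
  finally show ?thesis unfolding dl prod_e .
qed

lemma aint_varpi: "aint (varpi s)" and aint_varpi_div: "aint (varpi s / (1 - zp))"
proof -
  have a: "aint (1 - e i)" for i by (intro aint_diff) auto
  show "aint (varpi s)" unfolding varpi_def by (intro aint_prod a)
  have z: "1 - zp \<noteq> 0" using e_ne_1[of 0] by (simp add: e_0)
  have "1 - e s = (1 - zp) * (\<Sum>u<r ^ s. zp ^ u)"
    using z by (simp add: e_def sum_gp_strict)
  moreover have "{..<d} = insert 0 {1..<d}" using d_pos by auto
  ultimately have "varpi s / (1 - zp) = (\<Sum>u<r ^ s. zp ^ u) * (\<Prod>j\<in>{1..<d}. 1 - e (j * l + s))"
    using z by (simp add: varpi_def)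
  also have "aint \<dots>" by (intro aint_mult aint_prod aint_sum aint_power a) simp
  finally show "aint (varpi s / (1 - zp))" .
qed

lemma varpi_in_Fx: "varpi 0 \<in> Fx"
  using varpi_period[of 0] by (intro FxI) (simp_all add: g_varpi)

lemma sum_bet_F: "j < k \<Longrightarrow> (\<Sum>t<k. of_real (bet t) * of_real (F j t)) = (if j = 0 then 1 / of_nat p ^ 2 else (0 :: complex))"
proof -
  assume j: "j < k"
  have "(\<Sum>t<k. of_real (bet t) * of_real (F j t))
      = (\<Sum>t<k. of_real (2 - th t) * of_real (F j t) * of_real (F 0 t)) / (2 * of_nat k * of_nat p ^ 2 :: complex)"
    by (simp add: bet_eq sum_divide_distrib F_def[of 0])
  also have "\<dots> = (if j = 0 then 1 / of_nat p ^ 2 else 0)"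
    unfolding F_orthogonal_complex[OF j k_pos] using k_pos by simp
  finally show ?thesis .
qed

text \<open>The element \<open>varpi 0 / of_nat p\<close> generates the codifferent of the degree \<open>l\<close> field; testing it
  against the self-dual module spanned by the \<open>X i\<close> bounds the norm of \<open>X 0\<close> from above.\<close>

lemma PX_upper:
  assumes hyp: "aint (X 1 / X 0)"
  shows "cmod PX ^ 2 \<le> real p ^ (l + 1)"
proof -
  note Fx = subfield_Fx
  define y where "y = of_nat p * varpi 0 * inverse (X 0)"
  have y_Fx: "y \<in> Fx"
    unfolding y_def
    by (intro subfield_mult[OF Fx] subfield_inverse[OF Fx] varpi_in_Fx subfield_of_nat[OF Fx] X_in_Fx)
  have gy: "g s t y = of_nat p * varpi s * inverse (X s)" for s t
    unfolding y_def by (simp add: g_mult g_inverse g_varpi g_X E_inverse Qzeta_Rats)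
  define R where "R i = (\<Sum>s<l. varpi s * (X (i + s) / X s))" for i
  have co_y: "co i j y = R i * (if j = 0 then 1 / of_nat p else 0)" if "j < k" for i j
  proof -
    have "co i j y = of_nat p * (R i * (\<Sum>t<k. of_real (bet t) * of_real (F j t)))"
      unfolding co_def gy R_def sum_product by (simp add: sum_distrib_left divide_inverse mult_ac)
    then show ?thesis unfolding sum_bet_F[OF that] by (simp add: power2_eq_square)
  qed
  have "\<exists>n. co i j y = of_int n" if j: "j < k" for i j
  proof (cases "j = 0")
    case True
    have Rp: "R i = of_nat p * co i 0 y" using co_y[OF k_pos, of i] by simp
    have "R i \<in> \<rat>" unfolding Rp using co_rational[OF y_Fx] by (intro Rats_mult) simp_all
    moreover have "aint (R i)"
      unfolding R_def by (intro aint_sum aint_mult aint_varpi aint_X_ratio[OF hyp])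
    ultimately obtain n where n: "R i = of_int n" using rational_aint_int by blast
    have "R i / (1 - zp) = (\<Sum>s<l. varpi s / (1 - zp) * (X (i + s) / X s))"
      by (simp add: R_def sum_divide_distrib mult_ac)
    also have "aint \<dots>" by (intro aint_sum aint_mult aint_varpi_div aint_X_ratio[OF hyp])
    finally have "int p dvd n" unfolding n by (rule dvd_of_one_minus_zp)
    then obtain n' where "n = int p * n'" by (auto elim: dvdE)
    then have "of_nat p * co i 0 y = of_nat p * of_int n'" using Rp n by simp
    then have "co i 0 y = of_int n'" by simp
    then show ?thesis using True by blast
  next
    case False
    then show ?thesis using co_y[OF j] by (intro exI[of _ 0]) simp
  qed
  then obtain c where "y = Bsum c" using Bsum_of_coordinates[of y] y_Fx by auto
  then have "y \<in> II" using Bsum_in_II by simp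
  then obtain z where z: "z \<in> OK" "y = X 0 * z" using II_subset[OF hyp] by auto
  have "varpi 0 \<noteq> 0" unfolding varpi_def using e_ne_1 by simp
  then have "z \<noteq> 0" using z(2) X_nonzero by (auto simp: y_def)
  then have "1 \<le> cmod (nrm z)" using z(1) nrm_ge_1 by blast
  also have "nrm z = (of_nat p ^ (l + 1) / PX ^ 2) ^ k"
  proof -
    have zE: "z \<in> E" using z(1) by (simp add: OK_def)
    have "nrm y = nrm (X 0) * nrm z" unfolding z(2) using zE by (simp add: nrm_mult)
    moreover have "nrm y = (of_nat p ^ (l + 1) / PX) ^ k"
    proof -
      have "nrm y = (\<Prod>s<l. of_nat p * varpi s * inverse (X s)) ^ k"
        unfolding nrm_def gy by (simp add: prod_power_distrib)
      also have "(\<Prod>s<l. of_nat p * varpi s * inverse (X s)) = of_nat p ^ (l + 1) / PX"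
        using prod_inversef[of X "{..<l}"]
        by (simp add: prod.distrib prod_varpi PX_def divide_inverse comp_def)
      finally show ?thesis .
    qed
    moreover have "PX \<noteq> 0" by (simp add: PX_def X_nonzero)
    ultimately show ?thesis unfolding nrm_X by (simp add: power_divide power2_eq_square power_mult_distrib field_simps)
  qed
  also have "cmod ((of_nat p ^ (l + 1) / PX ^ 2) ^ k) = (real p ^ (l + 1) / cmod PX ^ 2) ^ k"
    by (simp add: norm_power norm_divide norm_mult)
  finally have "1 \<le> real p ^ (l + 1) / cmod PX ^ 2"
    by (rule one_le_of_one_le_power[OF _ _ k_pos]) simp
  moreover have "cmod PX ^ 2 > 0" by (simp add: PX_def X_nonzero)
  ultimately show ?thesis by (simp add: le_divide_eq)
qed

lemma norm_X:
  assumes hyp: "aint (X 1 / X 0)"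
  shows "cmod (nrm (X 0)) = real p powr ((real (k * l) + real k) / 2)"
proof -
  have "cmod PX ^ 2 = real p ^ (l + 1)" using PX_lower PX_upper[OF hyp] by simp
  then have "cmod PX = sqrt (real p ^ (l + 1))" by (metis norm_ge_zero real_sqrt_unique)
  also have "\<dots> = (real p powr real (l + 1)) powr (1 / 2)"
    by (simp add: powr_half_sqrt powr_realpow del: of_nat_Suc)
  also have "\<dots> = real p powr (real (l + 1) / 2)" by (simp add: powr_powr)
  finally have "cmod (nrm (X 0)) = (real p powr (real (l + 1) / 2)) ^ k"
    unfolding nrm_X norm_power by simp
  also have "\<dots> = (real p powr (real (l + 1) / 2)) powr real k"
    by (rule powr_realpow[symmetric]) simp
  also have "\<dots> = real p powr ((real (k * l) + real k) / 2)"
    by (simp add: powr_powr algebra_simps add_divide_distrib)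
  finally show ?thesis .
qed

subsection \<open>The lattice\<close>

abbreviation \<beta> :: complex where "\<beta> \<equiv> of_real (bet 0)"

lemma phi_emb: "y \<in> Fx \<Longrightarrow> s < l \<Longrightarrow> t < k \<Longrightarrow> phi Fx \<beta> y (emb s t) = sqrt (bet t) * Re (g s t y)"
  unfolding phi_def real_embeddings_eq using emb_in_embeddings by (simp add: emb_def g_bet)

lemma phi_outside: "\<rho> \<notin> real_embeddings Fx \<Longrightarrow> phi Fx \<beta> y \<rho> = 0"
  by (simp add: phi_def)

lemma real_embedding_cases:
  assumes "\<rho> \<in> real_embeddings Fx"
  obtains s t where "\<rho> = emb s t" "s < l" "t < k"
  using assms unfolding real_embeddings_eq embeddings_eq by auto

lemma phi_0: "phi Fx \<beta> 0 = (\<lambda>_. 0)"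
proof
  fix \<rho>
  show "phi Fx \<beta> 0 \<rho> = 0"
  proof (cases "\<rho> \<in> real_embeddings Fx")
    case True
    then obtain s t where "\<rho> = emb s t" "s < l" "t < k" by (rule real_embedding_cases)
    then show ?thesis by (simp add: phi_emb subfield_0[OF subfield_Fx])
  qed (simp add: phi_outside)
qed

lemma Bsum_in_Fx: "Bsum c \<in> Fx"
  unfolding Bsum_def
  by (intro subfield_sum[OF subfield_Fx] subfield_mult[OF subfield_Fx subfield_Rats[OF subfield_Fx Rats_of_int]] B_in_Fx)

lemma phi_Bsum: "phi Fx \<beta> (Bsum c) = (\<lambda>\<rho>. \<Sum>q<k * l. of_int (c q) * phi Fx \<beta> (B (q div k) (q mod k)) \<rho>)"
proof
  fix \<rho>
  show "phi Fx \<beta> (Bsum c) \<rho> = (\<Sum>q<k * l. of_int (c q) * phi Fx \<beta> (B (q div k) (q mod k)) \<rho>)"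
  proof (cases "\<rho> \<in> real_embeddings Fx")
    case True
    then obtain s t where st: "\<rho> = emb s t" "s < l" "t < k" by (rule real_embedding_cases)
    have "g s t (Bsum c) = (\<Sum>q<k * l. of_int (c q) * g s t (B (q div k) (q mod k)))"
      unfolding Bsum_def by (simp add: g_sum g_mult Qzeta_Rats)
    then have "Re (g s t (Bsum c)) = (\<Sum>q<k * l. of_int (c q) * Re (g s t (B (q div k) (q mod k))))"
      by simp
    then show ?thesis using st by (simp add: phi_emb Bsum_in_Fx sum_distrib_left mult_ac)
  qed (simp add: phi_outside)
qed

lemma phi_orthonormal:
  assumes "q < k * l" "q' < k * l"
  shows "(\<Sum>\<rho>\<in>real_embeddings Fx. phi Fx \<beta> (B (q div k) (q mod k)) \<rho> * phi Fx \<beta> (B (q' div k) (q' mod k)) \<rho>)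
    = (if q = q' then 1 else 0)"
proof -
  let ?i = "q div k" and ?j = "q mod k" and ?i' = "q' div k" and ?j' = "q' mod k"
  have less: "?i < l" "?i' < l" "?j < k" "?j' < k"
    using assms k_pos by (simp_all add: less_mult_imp_div_less mult.commute)
  have re: "complex_of_real (Re (g s t (B i j))) = X (i + s) * of_real (F j t)" for s t i j
    using g_real[OF B_in_Fx, of s t i j] unfolding g_B by (simp only: of_real_Re)
  let ?T = "\<Sum>s<l. \<Sum>t<k. bet t * Re (g s t (B ?i ?j)) * Re (g s t (B ?i' ?j'))"
  have T: "(\<Sum>\<rho>\<in>real_embeddings Fx. phi Fx \<beta> (B ?i ?j) \<rho> * phi Fx \<beta> (B ?i' ?j') \<rho>) = ?T"
    unfolding sum_real_embeddings
  proof (intro sum.cong refl)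
    fix s t assume "s \<in> {..<l}" "t \<in> {..<k}"
    then have "s < l" "t < k" "sqrt (bet t) * sqrt (bet t) = bet t" using bet_pos[of t] by auto
    then show "phi Fx \<beta> (B ?i ?j) (emb s t) * phi Fx \<beta> (B ?i' ?j') (emb s t)
      = bet t * Re (g s t (B ?i ?j)) * Re (g s t (B ?i' ?j'))"
      by (simp add: phi_emb)
  qed
  have "complex_of_real ?T = (if ?i = ?i' \<and> ?j = ?j' then 1 else 0)"
    by (simp only: of_real_sum of_real_mult re gram[OF less])
  also have "?i = ?i' \<and> ?j = ?j' \<longleftrightarrow> q = q'" by (metis div_mult_mod_eq)
  also have "(if q = q' then 1 else 0) = complex_of_real (if q = q' then 1 else 0)" by simp
  finally show ?thesis unfolding T of_real_eq_iff .
qed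

lemma rotated_II:
  assumes hyp: "aint (X 1 / X 0)"
  shows "rotated_Zn Fx (k * l) (phi Fx \<beta> ` II)"
  unfolding rotated_Zn_def
proof (intro conjI exI[of _ "\<lambda>q. phi Fx \<beta> (B (q div k) (q mod k))"] allI impI)
  show "card (real_embeddings Fx) = k * l" by (rule card_real_embeddings)
  show "phi Fx \<beta> ` II = {\<lambda>\<rho>. \<Sum>q<k * l. of_int (c q) * phi Fx \<beta> (B (q div k) (q mod k)) \<rho> |c. True}"
    unfolding II_Bsum[OF hyp] by (auto simp: image_iff phi_Bsum)
qed (simp_all add: phi_outside phi_orthonormal)

lemma prod_phi:
  assumes "y \<in> Fx"
  shows "\<bar>\<Prod>\<rho>\<in>real_embeddings Fx. phi Fx \<beta> y \<rho>\<bar> = sqrt (\<Prod>t<k. bet t) ^ l * cmod (nrm y)"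
proof -
  have "(\<Prod>\<rho>\<in>real_embeddings Fx. phi Fx \<beta> y \<rho>) = (\<Prod>s<l. \<Prod>t<k. sqrt (bet t) * Re (g s t y))"
    unfolding real_embeddings_eq prod_embeddings using assms by (intro prod.cong refl) (simp add: phi_emb)
  then have "\<bar>\<Prod>\<rho>\<in>real_embeddings Fx. phi Fx \<beta> y \<rho>\<bar> = (\<Prod>s<l. \<Prod>t<k. \<bar>sqrt (bet t) * Re (g s t y)\<bar>)"
    by (simp only: abs_prod)
  also have "\<dots> = (\<Prod>s<l. \<Prod>t<k. sqrt (bet t) * cmod (g s t y))"
  proof (intro prod.cong refl)
    fix s t assume "t \<in> {..<k}"
    then have "bet t > 0" using bet_pos by simp
    moreover have "cmod (g s t y) = \<bar>Re (g s t y)\<bar>"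
      using g_real[OF assms, of s t] by (simp add: complex_is_Real_iff cmod_eq_Re)
    ultimately show "\<bar>sqrt (bet t) * Re (g s t y)\<bar> = sqrt (bet t) * cmod (g s t y)"
      by (simp add: abs_mult)
  qed
  also have "\<dots> = (\<Prod>t<k. sqrt (bet t)) ^ l * cmod (nrm y)"
    by (simp add: prod.distrib nrm_def prod_norm)
  also have "(\<Prod>t<k. sqrt (bet t)) = sqrt (\<Prod>t<k. bet t)"
    by (rule prod_sqrt)
  finally show ?thesis .
qed

lemma sqrt_prod_bet: "sqrt (\<Prod>t<k. bet t) ^ l = real p powr (- real (k * l)) * 2 powr ((real l - real (k * l) * (real m - 1)) / 2)"
proof -
  have two_k: "2 * real k = 2 powr (real m - 1)"
  proof -
    have "2 * real k = 2 ^ (m - 1)" using m by (simp add: k_def flip: power_Suc)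
    also have "\<dots> = 2 powr real (m - 1)" by (simp add: powr_realpow)
    finally show ?thesis using m by (simp add: of_nat_diff)
  qed
  have "(\<Prod>t<k. bet t) = 2 / (2 * real k * real p ^ 2) ^ k"
    unfolding bet_eq prod_dividef prod_two_minus_th by simp
  also have "\<dots> = 2 powr (1 - (real m - 1) * real k) * real p powr (- 2 * real k)"
  proof -
    have "(2 * real k * real p ^ 2) ^ k = (2 powr (real m - 1)) ^ k * (real p ^ 2) ^ k"
      unfolding two_k by (simp add: power_mult_distrib)
    also have "(2 powr (real m - 1)) ^ k = 2 powr ((real m - 1) * real k)"
      by (simp add: powr_powr flip: powr_realpow)
    also have "(real p ^ 2) ^ k = real p ^ (2 * k)" by (simp only: power_mult)
    also have "\<dots> = real p powr real (2 * k)" by (rule powr_realpow[symmetric]) simp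
    also have "real (2 * k) = 2 * real k" by simp
    finally show ?thesis by (simp add: powr_diff powr_minus divide_inverse)
  qed
  finally have "sqrt (\<Prod>t<k. bet t) = (2 powr (1 - (real m - 1) * real k) * real p powr (- 2 * real k)) powr (1 / 2)"
    by (simp add: powr_half_sqrt)
  also have "\<dots> = 2 powr ((1 - (real m - 1) * real k) / 2) * real p powr (- real k)"
    by (simp add: powr_mult powr_powr)
  finally have "sqrt (\<Prod>t<k. bet t) ^ l = (2 powr ((1 - (real m - 1) * real k) / 2) * real p powr (- real k)) powr real l"
    by (simp add: powr_realpow)
  also have "\<dots> = 2 powr ((1 - (real m - 1) * real k) / 2 * real l) * real p powr (- real k * real l)"
    by (simp add: powr_mult powr_powr)
  finally show ?thesis by (simp add: algebra_simps diff_divide_distrib)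
qed

lemma dpmin_II:
  assumes hyp: "aint (X 1 / X 0)"
  shows "dpmin Fx (phi Fx \<beta> ` II) = real p powr ((real k - real (k * l)) / 2)
    * 2 powr ((real l - real (k * l) * (real m - 1)) / 2)"
proof -
  let ?C = "sqrt (\<Prod>t<k. bet t) ^ l"
  let ?S = "{\<bar>\<Prod>\<rho>\<in>real_embeddings Fx. v \<rho>\<bar> | v. v \<in> phi Fx \<beta> ` II \<and> v \<noteq> (\<lambda>_. 0)}"
  have "(\<Prod>t<k. bet t) > 0" using bet_pos by (intro prod_pos) simp
  then have C: "?C > 0" by simp
  have X0: "X 0 \<in> Fx" by simp
  have "Inf ?S = ?C * cmod (nrm (X 0))"
  proof (rule cInf_eq_minimum)
    have "X 0 \<in> II" unfolding II_eq[OF hyp] using OK_1 by force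
    moreover have "phi Fx \<beta> (X 0) \<noteq> (\<lambda>_. 0)"
    proof
      assume zero: "phi Fx \<beta> (X 0) = (\<lambda>_. 0)"
      have "card (real_embeddings Fx) > 0" unfolding card_real_embeddings using k_pos l by simp
      then have "\<bar>\<Prod>\<rho>\<in>real_embeddings Fx. phi Fx \<beta> (X 0) \<rho>\<bar> = 0"
        unfolding zero by (simp only: prod_constant power_0_left) simp
      moreover have "?C * cmod (nrm (X 0)) > 0"
        by (rule mult_pos_pos[OF C]) (simp add: nrm_X PX_def X_nonzero)
      ultimately show False unfolding prod_phi[OF X0] by linarith
    qed
    ultimately show "?C * cmod (nrm (X 0)) \<in> ?S" unfolding prod_phi[OF X0, symmetric] by blast
  next
    fix a assume "a \<in> ?S"
    then obtain v where v: "a = \<bar>\<Prod>\<rho>\<in>real_embeddings Fx. v \<rho>\<bar>" "v \<in> phi Fx \<beta> ` II" "v \<noteq> (\<lambda>_. 0)" by blast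
    then obtain y where y: "y \<in> OK" "v = phi Fx \<beta> (X 0 * y)" unfolding II_eq[OF hyp] by blast
    have "y \<noteq> 0"
    proof
      assume "y = 0"
      then have "v = (\<lambda>_. 0)" by (simp add: y(2) phi_0)
      then show False using v(3) by simp
    qed
    then have "1 \<le> cmod (nrm y)" using nrm_ge_1 y(1) by blast
    moreover have yFx: "y \<in> Fx" using y(1) by (simp add: OK_def)
    then have "X 0 * y \<in> Fx" by (intro subfield_mult[OF subfield_Fx]) simp_all
    then have "a = ?C * (cmod (nrm (X 0)) * cmod (nrm y))"
      using yFx by (simp add: v(1) y(2) prod_phi nrm_mult norm_mult)
    ultimately show "?C * cmod (nrm (X 0)) \<le> a"
      using C by (simp add: mult_le_cancel_left1)
  qed
  also have "\<dots> = (real p powr (- real (k * l)) * real p powr ((real (k * l) + real k) / 2))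
      * 2 powr ((real l - real (k * l) * (real m - 1)) / 2)"
    unfolding norm_X[OF hyp] sqrt_prod_bet by (simp only: mult_ac)
  also have "real p powr (- real (k * l)) * real p powr ((real (k * l) + real k) / 2)
      = real p powr ((real k - real (k * l)) / 2)"
    unfolding powr_add[symmetric] by (rule arg_cong[of _ _ "\<lambda>x. real p powr x"]) (simp add: field_simps)
  finally show ?thesis unfolding dpmin_def .
qed

end

theorem theorem10:
  fixes l p r m :: nat and lam :: int
  assumes "l > 1" and "odd l"
    and "prime p" and "[p = 1] (mod l)"
    and "residue_primroot p r"
    and "[lam * (int r - 1) = 1] (mod int p)"
    and "m \<ge> 3"
    and "sigma p r (xelt p r l lam) / xelt p r l lam \<in> Zzeta p"
  shows "let k = 2 ^ (m - 2); n = k * l; x = xelt p r l lam;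
             KL = compositum (Kfield p r l) (Lfield m);
             \<I> = prod_module (Iset p r l lam) (ring_of_integers (Lfield m));
             \<beta> = complex_of_real ((1 / real p ^ 2) * (1 / real k - theta m / (2 * real k)));
             \<Lambda> = phi KL \<beta> ` \<I>
         in \<I> = {x * y | y. y \<in> ring_of_integers KL}
          \<and> rotated_Zn KL n \<Lambda>
          \<and> dpmin KL \<Lambda> = real p powr ((real k - real n) / 2)
                          * 2 powr ((real l - real n * (real m - 1)) / 2)
          \<and> cmod (field_norm KL x) = real p powr ((real n + real k) / 2)"
proof -
  interpret lattice_setting l p r m lam
    using assms by unfold_locales
  have s1: "sigma p r (X 0) = X 1" using sigma_eq_g[of "X 0" 0] by (simp add: g_X)
  have hyp: "aint (X 1 / X 0)"
    using Zzeta_aint[OF p_pos assms(8)] unfolding xelt_eq s1 .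
  have "II = {X 0 * y | y. y \<in> OK}" unfolding II_eq[OF hyp] by auto
  then show ?thesis
    unfolding Let_def k_def[symmetric] compositum_eq xelt_eq II_def[symmetric] theta_eq bet_def[symmetric] OK_eq
    using rotated_II[OF hyp] dpmin_II[OF hyp] norm_X[OF hyp] field_norm_eq[of "X 0"] by simp
qed

end
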